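(* Let $N>0$ and let $$0<\tau\leq \tau_0(N):=\frac{1}{N+1+\sqrt{(N+1)^2+4}}.$$ Then problem $(P)_\tau$ admits a radially symmetric solution with flux pair $(\beta_1,\beta_2)$ if and only if $$\beta_1^2+\beta_2^2-2\tau\beta_1\beta_2-4(N+1)\beta_1-4\beta_2=0,\qquad \beta_1>4(N+1),\qquad \beta_2>4 .$$
   Context: For $N>0$, $\tau>0$ and real numbers $\beta_1,\beta_2$, problem $(P)_\tau$ asks for functions $v_1,v_2\in L^1_{loc}(\mathbb{R}^2)$ with $|x|^{2N}e^{v_1}\in L^1(\mathbb{R}^2)$ and $e^{v_2}\in L^1(\mathbb{R}^2)$ such that, in the sense of distributions on $\mathbb{R}^2$, $$-\Delta v_1=|x|^{2N}e^{v_1}-\tau e^{v_2},\qquad -\Delta v_2=e^{v_2}-\tau|x|^{2N}e^{v_1},$$ and $$\beta_1=\frac{1}{2\pi}\int_{\mathbb{R}^2}|x|^{2N}e^{v_1}\,dx,\qquad \beta_2=\frac{1}{2\pi}\int_{\mathbb{R}^2}e^{v_2}\,dx .$$ The pair $(\beta_1,\beta_2)$ is called the flux pair of the solution. A radial solution is a solution with $v_1,v_2$ radially symmetric about the origin. *)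

theory Defs
  imports "HOL-Analysis.Analysis"
begin

type_synonym R2 = "real^2"

definition dirderiv :: "(R2 \<Rightarrow> real) \<Rightarrow> R2 \<Rightarrow> R2 \<Rightarrow> real" where
  "dirderiv f v x = frechet_derivative f (at x) v"

definition iter_dirderiv :: "R2 list \<Rightarrow> (R2 \<Rightarrow> real) \<Rightarrow> R2 \<Rightarrow> real" where
  "iter_dirderiv vs f = foldr (\<lambda>v g. dirderiv g v) vs f"

definition smooth :: "(R2 \<Rightarrow> real) \<Rightarrow> bool" where
  "smooth f \<longleftrightarrow> (\<forall>vs x. iter_dirderiv vs f differentiable (at x))"

definition test_function :: "(R2 \<Rightarrow> real) \<Rightarrow> bool" where
  "test_function \<phi> \<longleftrightarrow> smooth \<phi> \<and> compact (closure {x. \<phi> x \<noteq> 0})"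

definition laplacian :: "(R2 \<Rightarrow> real) \<Rightarrow> R2 \<Rightarrow> real" where
  "laplacian \<phi> x = (\<Sum>i\<in>UNIV. dirderiv (dirderiv \<phi> (axis i 1)) (axis i 1) x)"

definition locally_integrable :: "(R2 \<Rightarrow> real) \<Rightarrow> bool" where
  "locally_integrable v \<longleftrightarrow> (\<forall>K. compact K \<longrightarrow> set_integrable lborel K v)"

definition distr_neg_laplace_eq :: "(R2 \<Rightarrow> real) \<Rightarrow> (R2 \<Rightarrow> real) \<Rightarrow> bool" where
  "distr_neg_laplace_eq v f \<longleftrightarrow>
     (\<forall>\<phi>. test_function \<phi> \<longrightarrow>
        (\<integral>x. v x * (- laplacian \<phi> x) \<partial>lborel) = (\<integral>x. f x * \<phi> x \<partial>lborel))"

definition solves_P :: "real \<Rightarrow> real \<Rightarrow> (R2 \<Rightarrow> real) \<Rightarrow> (R2 \<Rightarrow> real) \<Rightarrow> real \<Rightarrow> real \<Rightarrow> bool" where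
  "solves_P N \<tau> v1 v2 b1 b2 \<longleftrightarrow>
     locally_integrable v1 \<and> locally_integrable v2 \<and>
     integrable lborel (\<lambda>x. norm x powr (2*N) * exp (v1 x)) \<and>
     integrable lborel (\<lambda>x. exp (v2 x)) \<and>
     distr_neg_laplace_eq v1 (\<lambda>x. norm x powr (2*N) * exp (v1 x) - \<tau> * exp (v2 x)) \<and>
     distr_neg_laplace_eq v2 (\<lambda>x. exp (v2 x) - \<tau> * norm x powr (2*N) * exp (v1 x)) \<and>
     b1 = 1 / (2*pi) * (\<integral>x. norm x powr (2*N) * exp (v1 x) \<partial>lborel) \<and>
     b2 = 1 / (2*pi) * (\<integral>x. exp (v2 x) \<partial>lborel)"

definition radial :: "(R2 \<Rightarrow> real) \<Rightarrow> bool" where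
  "radial v \<longleftrightarrow> (\<forall>x y. norm x = norm y \<longrightarrow> v x = v y)"

end

(*
Write s = |x|^2. For radial solutions the partial fluxes f1, f2 over the disc |x|^2 < s satisfy, with
P_i = 2 s f_i', the autonomous flow P1' = f1' (2(N+1) - f1 + tau f2), P2' = f2' (2 - f2 + tau f1).
Its Pohozaev identity expresses P1 + P2 as a quadratic polynomial in (f1, f2); at infinity P1 and P2
vanish, so the fluxes lie on the conic. Dropping the coupling term in one equation gives the strict
inequalities beta1 > 4(N+1) and beta2 > 4.

Conversely, the solutions regular at the origin form, up to scaling, a one-parameter family depending
continuously on the parameter. The fluxes are increasing limits, hence lower semicontinuous in the
parameter, and for tau <= tau_0 the arc is a strictly decreasing graph. So {beta1 too large} and
{beta2 too large} are disjoint open sets of parameters. Both are nonempty: if one component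
concentrates much later than the other, it sees the mass 4(N+1) (resp. 4) of the first bubble as a
point source, which pushes the fluxes towards one of the two end points of the arc. By connectedness
some parameter lies in neither set, and it realises the given point of the arc.
*)
theory Submission
  imports Defs
begin

text \<open>The threshold comes from the arc. With a1 = N + 1 and a2 = 1 its ends are (4 a1, 4 a2 +
  8 \<tau> a1) and (4 a1 + 8 \<tau> a2, 4 a2), and it is a decreasing graph once both partial
  derivatives of the quadratic polynomial are nonnegative there. Each of them is smallest at one
  end; the decisive condition is 4 \<tau>^2 + 2 \<tau> (N + 1) <= 1, whose largest solution is
  \<tau>_0(N).

  Two obstacles shape the rest. The flow is singular at s = 0 and its exponential nonlinearity has
  no global Lipschitz bound; hence the unknowns f_i / s, cut off at a level that the Pohozaev
  identity shows is never reached. A given solution is only locally integrable and satisfies its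
  equations in the sense of distributions; hence the flow is recovered from weak identities, with
  test functions that are constant, but in general not zero, near the origin, so that no point mass
  can hide there.

  Both components carry general weights with exponents N1 and N2, although the problem has N2 = 0:
  exchanging the components is then a symmetry and each estimate is proved for one component
  only.\<close>

section \<open>The radial flow and its Pohozaev identity\<close>

text \<open>Differentiating along the flow, the difference of the two sides is constant, and it
  tends to 0 at the origin. The interval may end at \<open>S\<close> because the clamped flow
  constructed later obeys these equations only as long as its clamp is known to be inactive.\<close>

lemma pohozaev_identity_on:
  fixes a1 a2 \<tau> S :: real and f1 f2 P1 P2 :: "real \<Rightarrow> real"
  assumes f1: "\<And>s. 0 < s \<Longrightarrow> s < S \<Longrightarrow> (f1 has_real_derivative P1 s / (2 * s)) (at s)"
    and f2: "\<And>s. 0 < s \<Longrightarrow> s < S \<Longrightarrow> (f2 has_real_derivative P2 s / (2 * s)) (at s)"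
    and P1: "\<And>s. 0 < s \<Longrightarrow> s < S \<Longrightarrow>
      (P1 has_real_derivative P1 s / (2 * s) * (2*a1 - f1 s + \<tau> * f2 s)) (at s)"
    and P2: "\<And>s. 0 < s \<Longrightarrow> s < S \<Longrightarrow>
      (P2 has_real_derivative P2 s / (2 * s) * (2*a2 - f2 s + \<tau> * f1 s)) (at s)"
    and lim: "(f1 \<longlongrightarrow> 0) (at_right 0)" "(f2 \<longlongrightarrow> 0) (at_right 0)"
      "(P1 \<longlongrightarrow> 0) (at_right 0)" "(P2 \<longlongrightarrow> 0) (at_right 0)"
    and s: "0 < s" "s < S"
  shows "P1 s + P2 s = 2*a1*f1 s + 2*a2*f2 s - (f1 s)\<^sup>2/2 - (f2 s)\<^sup>2/2 + \<tau> * f1 s * f2 s"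
proof -
  define D where "D x = P1 x + P2 x - (2*a1*f1 x + 2*a2*f2 x - (f1 x)\<^sup>2/2 - (f2 x)\<^sup>2/2 + \<tau> * f1 x * f2 x)" for x
  have D0: "(D has_real_derivative 0) (at x)" if "0 < x" "x < S" for x
  proof -
    define A B where "A = P1 x / (2 * x)" and "B = P2 x / (2 * x)"
    note d = f1[OF that, folded A_def] f2[OF that, folded B_def] P1[OF that, folded A_def] P2[OF that, folded B_def]
    show ?thesis
      unfolding D_def power2_eq_square 
      by (rule DERIV_cdivide d derivative_eq_intros refl)+ (simp add: algebra_simps)
  qed
  have const: "D x = D s" if "0 < x" "x < S" for x
  proof (rule DERIV_zero_connected_constant[of "{0<..<S}" "{}"])
    show "continuous_on {0<..<S} D"
      using D0 by (intro continuous_at_imp_continuous_on ballI DERIV_isCont) auto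
    show "\<forall>x\<in>{0<..<S} - {}. (D has_real_derivative 0) (at x)"
      using D0 by auto
  qed (use that s in auto)
  have "(D \<longlongrightarrow> 0) (at_right 0)"
    unfolding D_def by (rule tendsto_eq_intros lim refl | simp)+
  moreover have "eventually (\<lambda>x. D x = D s) (at_right 0)"
    unfolding eventually_at_right_field using s by (intro exI[of _ S]) (blast intro: const less_trans)
  then have "(D \<longlongrightarrow> D s) (at_right 0)"
    by (rule tendsto_eventually)
  ultimately have "D s = 0"
    using tendsto_unique[OF trivial_limit_at_right_real] by blast
  then show ?thesis by (simp add: D_def)
qed

text \<open>The constants \<open>a1\<close>, \<open>a2\<close> are the weight exponents plus one.
  Regularity at the origin is encoded by the vanishing of \<open>f1\<close> and \<open>f2\<close>
  alone; the vanishing of \<open>P1\<close> and \<open>P2\<close> is derived, since for a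
  distributional solution nothing is known in advance about the densities near the origin.\<close>

locale liouville_flow =
  fixes a1 a2 \<tau> :: real and f1 f2 P1 P2 :: "real \<Rightarrow> real"
  assumes params: "a1 > 0" "a2 > 0" "\<tau> > 0"
    and P1_pos: "\<And>s. 0 < s \<Longrightarrow> P1 s > 0"
    and P2_pos: "\<And>s. 0 < s \<Longrightarrow> P2 s > 0"
    and f1_deriv: "\<And>s. 0 < s \<Longrightarrow> (f1 has_real_derivative P1 s / (2 * s)) (at s)"
    and f2_deriv: "\<And>s. 0 < s \<Longrightarrow> (f2 has_real_derivative P2 s / (2 * s)) (at s)"
    and P1_deriv: "\<And>s. 0 < s \<Longrightarrow>
      (P1 has_real_derivative P1 s / (2 * s) * (2*a1 - f1 s + \<tau> * f2 s)) (at s)"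
    and P2_deriv: "\<And>s. 0 < s \<Longrightarrow>
      (P2 has_real_derivative P2 s / (2 * s) * (2*a2 - f2 s + \<tau> * f1 s)) (at s)"
    and f1_lim0: "(f1 \<longlongrightarrow> 0) (at_right 0)"
    and f2_lim0: "(f2 \<longlongrightarrow> 0) (at_right 0)"
begin

lemma swap: "liouville_flow a2 a1 \<tau> f2 f1 P2 P1"
  by unfold_locales
    (use params P1_pos P2_pos f1_deriv f2_deriv P1_deriv P2_deriv f1_lim0 f2_lim0 in auto)

lemma f1_mono:
  assumes "0 < s" "s < t" shows "f1 s < f1 t"
proof (rule DERIV_pos_imp_increasing[OF assms(2)])
  fix x assume "s \<le> x" "x \<le> t"
  then show "\<exists>y. (f1 has_real_derivative y) (at x) \<and> 0 < y"
    using f1_deriv[of x] P1_pos[of x] assms by (intro exI[of _ "P1 x / (2*x)"]) auto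
qed

lemma f1_pos:
  assumes "0 < s" shows "f1 s > 0"
proof -
  have "0 \<le> f1 (s/2)"
  proof (rule tendsto_upperbound[OF f1_lim0])
    show "eventually (\<lambda>x. f1 x \<le> f1 (s/2)) (at_right 0)"
      using f1_mono assms by (auto simp: eventually_at_right_field intro!: exI[of _ "s/2"] less_imp_le)
  qed simp
  also have "\<dots> < f1 s" using assms by (intro f1_mono) auto
  finally show ?thesis .
qed

lemma f1_less_limit:
  assumes "(f1 \<longlongrightarrow> \<beta>1) at_top" "0 < s" shows "f1 s < \<beta>1"
proof -
  have "f1 s < f1 (s+1)" using assms by (intro f1_mono) auto
  also have "\<dots> \<le> \<beta>1"
  proof (rule tendsto_lowerbound[OF assms(1)])
    show "eventually (\<lambda>x. f1 (s+1) \<le> f1 x) at_top"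
      using eventually_gt_at_top[of "s+1"] by eventually_elim (use f1_mono assms in \<open>auto intro!: less_imp_le\<close>)
  qed simp
  finally show ?thesis .
qed

text \<open>The defect of the scalar Pohozaev identity; the coupling makes it strictly increasing.\<close>

definition R1 where "R1 s = P1 s - 2*a1*f1 s + (f1 s)\<^sup>2/2"

lemma f2_pos: "0 < s \<Longrightarrow> f2 s > 0"
  by (rule liouville_flow.f1_pos[OF swap])

lemma R1_mono:
  assumes "0 < s" "s < t" shows "R1 s < R1 t"
proof (rule DERIV_pos_imp_increasing[OF assms(2)])
  fix x assume x: "s \<le> x" "x \<le> t"
  then have x0: "0 < x" using assms by simp
  define A where "A = P1 x / (2 * x)"
  note d = f1_deriv[OF x0, folded A_def] P1_deriv[OF x0, folded A_def]
  have "(R1 has_real_derivative A * \<tau> * f2 x) (at x)"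
    unfolding R1_def power2_eq_square 
      by (rule DERIV_cdivide d derivative_eq_intros refl)+ (simp add: algebra_simps)
  then show "\<exists>y. (R1 has_real_derivative y) (at x) \<and> 0 < y"
    using P1_pos[OF x0] f2_pos[OF x0] params x0 by (intro exI[of _ "A * \<tau> * f2 x"]) (auto simp: A_def)
qed

text \<open>Since \<open>f1\<close> has derivative \<open>P1 s / (2 * s)\<close>, a lower bound for
  \<open>P1\<close> forces logarithmic growth of \<open>f1\<close>. Each use is a contradiction with
  a bound on \<open>f1\<close>.\<close>

lemma P1_log_growth:
  assumes "0 < s" "s \<le> t" and P: "\<And>x. s \<le> x \<Longrightarrow> x \<le> t \<Longrightarrow> L \<le> P1 x"
  shows "f1 s + L/2 * (ln t - ln s) \<le> f1 t"
proof -
  have "f1 s - L/2 * ln s \<le> f1 t - L/2 * ln t"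
  proof (rule DERIV_nonneg_imp_nondecreasing[OF assms(2), where f="\<lambda>x. f1 x - L/2 * ln x"])
    fix x assume x: "s \<le> x" "x \<le> t"
    then have x0: "0 < x" using assms by simp
    have "((\<lambda>x. f1 x - L/2 * ln x) has_real_derivative P1 x / (2*x) - L/2 * (1/x)) (at x)"
      by (rule derivative_eq_intros f1_deriv x0 refl)+ simp
    moreover have "P1 x / (2*x) - L/2 * (1/x) \<ge> 0"
      using P[OF x] x0 by (simp add: field_simps)
    ultimately show "\<exists>y. ((\<lambda>x. f1 x - L/2 * ln x) has_real_derivative y) (at x) \<and> y \<ge> 0" by blast
  qed
  then show ?thesis by (simp add: right_diff_distrib)
qed

lemma P1_small_near_0:
  assumes "0 < \<epsilon>" "0 < s" shows "\<exists>x. 0 < x \<and> x < s \<and> P1 x < \<epsilon>"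
proof (rule ccontr)
  assume "\<not> ?thesis"
  then have P: "\<epsilon> \<le> P1 x" if "0 < x" "x < s" for x using that by force
  define t where "t = s/2"
  have t: "0 < t" "t < s" using assms by (auto simp: t_def)
  \<comment> \<open>Chosen so that the logarithmic growth between \<open>r\<close> and
    \<open>t\<close> alone already amounts to \<open>f1 t\<close>, leaving no room for
    \<open>f1 r > 0\<close>.\<close>
  define r where "r = t * exp (- (2 * f1 t / \<epsilon>))"
  have r: "0 < r" "r \<le> t" using t f1_pos[of t] assms by (auto simp: r_def)
  have "f1 r + \<epsilon>/2 * (ln t - ln r) \<le> f1 t"
    using r t P by (intro P1_log_growth) auto
  moreover have "ln t - ln r = 2 * f1 t / \<epsilon>"
    using t by (simp add: r_def ln_mult)
  ultimately show False using f1_pos[OF r(1)] assms by simp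
qed

lemma P1_small_at_top:
  assumes "0 < \<epsilon>" "0 < s" "(f1 \<longlongrightarrow> \<beta>1) at_top" shows "\<exists>x. s < x \<and> P1 x < \<epsilon>"
proof (rule ccontr)
  assume "\<not> ?thesis"
  then have P: "\<epsilon> \<le> P1 x" if "s < x" for x using that by force
  have b: "f1 x < \<beta>1" if "0 < x" for x using f1_less_limit[OF assms(3) that] .
  define t where "t = (s+1) * exp (2 * \<beta>1 / \<epsilon>)"
  have "\<beta>1 > 0" using b[of 1] f1_pos[of 1] by simp
  then have t: "s+1 \<le> t" using assms by (auto simp: t_def)
  have "f1 (s+1) + \<epsilon>/2 * (ln t - ln (s+1)) \<le> f1 t"
    using t P assms by (intro P1_log_growth) auto
  moreover have "ln t - ln (s+1) = 2 * \<beta>1 / \<epsilon>"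
    using assms by (simp add: t_def ln_mult)
  ultimately show False using f1_pos[of "s+1"] b[of t] t assms by simp
qed

text \<open>So far \<open>P1\<close> is small only at some points near 0. Monotonicity of
  \<open>R1\<close> spreads this to all smaller arguments: it bounds \<open>P1 s\<close> by
  \<open>P1 x\<close> up to terms in \<open>f1\<close>, which vanish at the origin.\<close>

lemma P1_lim0: "(P1 \<longlongrightarrow> 0) (at_right 0)"
proof (rule tendstoI)
  fix e :: real assume e: "e > 0"
  have "((\<lambda>s. 2*a1*f1 s + (f1 s)\<^sup>2/2) \<longlongrightarrow> 0) (at_right 0)"
    by (rule tendsto_eq_intros f1_lim0 refl | simp)+
  then have "eventually (\<lambda>s. 2*a1*f1 s + (f1 s)\<^sup>2/2 < e/4) (at_right 0)"
    using e by (intro order_tendstoD) auto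
  then obtain d where d: "d > 0" "\<And>s. 0 < s \<Longrightarrow> s < d \<Longrightarrow> 2*a1*f1 s + (f1 s)\<^sup>2/2 < e/4"
    by (auto simp: eventually_at_right_field)
  obtain x where x: "0 < x" "x < d" "P1 x < e/2" using P1_small_near_0[of "e/2" d] d e by auto
  have "P1 s < e" if s: "0 < s" "s < x" for s
  proof -
    have "P1 s \<le> P1 x - 2*a1*f1 x + (f1 x)\<^sup>2/2 + 2*a1*f1 s - (f1 s)\<^sup>2/2"
      using R1_mono[OF s] by (simp add: R1_def)
    also have "\<dots> \<le> P1 x + (2*a1*f1 x + (f1 x)\<^sup>2/2) + (2*a1*f1 s + (f1 s)\<^sup>2/2)"
      using params f1_pos[of x] x by simp
    also have "\<dots> < e" using x d(2)[of x] d(2)[of s] s by simp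
    finally show ?thesis .
  qed
  then show "eventually (\<lambda>s. dist (P1 s) 0 < e) (at_right 0)"
    using x(1) P1_pos by (auto simp: eventually_at_right_field dist_real_def abs_of_pos intro!: exI[of _ x])
qed

lemma P1_lim_top:
  assumes "(f1 \<longlongrightarrow> \<beta>1) at_top" shows "(P1 \<longlongrightarrow> 0) at_top"
proof (rule tendstoI)
  fix e :: real assume e: "e > 0"
  have "((\<lambda>s. (\<beta>1\<^sup>2 - (f1 s)\<^sup>2)/2) \<longlongrightarrow> 0) at_top"
    by (rule tendsto_eq_intros assms refl | simp)+
  then have "eventually (\<lambda>s. (\<beta>1\<^sup>2 - (f1 s)\<^sup>2)/2 < e/2) at_top"
    using e by (intro order_tendstoD) auto
  with eventually_gt_at_top[of 0] show "eventually (\<lambda>s. dist (P1 s) 0 < e) at_top"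
  proof eventually_elim
    case (elim s)
    obtain x where x: "s < x" "P1 x < e/2" using P1_small_at_top[of "e/2" s] e elim assms by auto
    \<comment> \<open>As at the origin, but now \<open>x\<close> lies to the right of
      \<open>s\<close>: the linear term has the good sign and the quadratic one is controlled by the
      tail of the convergent \<open>f1\<close>.\<close>
    have "P1 s \<le> P1 x + 2*a1*(f1 s - f1 x) + ((f1 x)\<^sup>2 - (f1 s)\<^sup>2)/2"
      using R1_mono[of s x] x elim by (simp add: R1_def algebra_simps diff_divide_distrib)
    also have "2*a1*(f1 s - f1 x) \<le> 0"
      using f1_mono[of s x] x elim params by (intro mult_nonneg_nonpos) auto
    also have "(f1 x)\<^sup>2 \<le> \<beta>1\<^sup>2"
      using f1_less_limit[OF assms, of x] f1_pos[of x] x elim by (intro power_mono) auto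
    finally have "P1 s \<le> P1 x + (\<beta>1\<^sup>2 - (f1 s)\<^sup>2)/2" by simp
    then have "P1 s < e" using x(2) elim by linarith
    then show ?case using elim P1_pos[of s] by (simp add: dist_real_def abs_of_pos)
  qed
qed

lemma R1_pos: assumes "0 < s" shows "R1 s > 0"
proof -
  have "(R1 \<longlongrightarrow> 0) (at_right 0)"
    unfolding R1_def by (rule tendsto_eq_intros f1_lim0 P1_lim0 refl | simp)+
  then have "0 \<le> R1 (s/2)"
  proof (rule tendsto_upperbound)
    show "eventually (\<lambda>x. R1 x \<le> R1 (s/2)) (at_right 0)"
      using R1_mono assms by (auto simp: eventually_at_right_field intro!: exI[of _ "s/2"] less_imp_le)
  qed simp
  also have "\<dots> < R1 s" using assms by (intro R1_mono) auto
  finally show ?thesis .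
qed

lemma flux1_gt:
  assumes "(f1 \<longlongrightarrow> \<beta>1) at_top" shows "\<beta>1 > 4*a1"
proof -
  have lim: "(R1 \<longlongrightarrow> - 2*a1*\<beta>1 + \<beta>1\<^sup>2/2) at_top"
    unfolding R1_def by (rule tendsto_eq_intros assms P1_lim_top[OF assms] refl | simp)+
  \<comment> \<open>Comparing the limit with the positive value of \<open>R1\<close> at a fixed
    point, here 1, keeps the inequality strict in the limit.\<close>
  have "R1 1 \<le> - 2*a1*\<beta>1 + \<beta>1\<^sup>2/2"
  proof (rule tendsto_lowerbound[OF lim])
    show "eventually (\<lambda>x. R1 1 \<le> R1 x) at_top"
      using eventually_gt_at_top[of 1] by eventually_elim (use R1_mono in \<open>auto intro!: less_imp_le\<close>)
  qed simp
  then have "\<beta>1 * (\<beta>1 - 4*a1) > 0"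
    using R1_pos[of 1] by (simp add: power2_eq_square algebra_simps)
  moreover have "\<beta>1 > 0" using f1_less_limit[OF assms, of 1] f1_pos[of 1] by simp
  ultimately show ?thesis by (simp add: zero_less_mult_iff)
qed


lemmas f2_less_limit = liouville_flow.f1_less_limit[OF swap]
lemmas P2_lim0 = liouville_flow.P1_lim0[OF swap]
lemmas P2_lim_top = liouville_flow.P1_lim_top[OF swap]
lemmas flux2_gt = liouville_flow.flux1_gt[OF swap]

lemma pohozaev_identity:
  assumes "0 < s"
  shows "P1 s + P2 s = 2*a1*f1 s + 2*a2*f2 s - (f1 s)\<^sup>2/2 - (f2 s)\<^sup>2/2 + \<tau> * f1 s * f2 s"
  by (rule pohozaev_identity_on[where S = "s+1"])
    (use assms f1_deriv f2_deriv P1_deriv P2_deriv f1_lim0 f2_lim0 P1_lim0 P2_lim0 in auto)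

lemma flux_identity:
  assumes b: "(f1 \<longlongrightarrow> \<beta>1) at_top" "(f2 \<longlongrightarrow> \<beta>2) at_top"
  shows "\<beta>1\<^sup>2 + \<beta>2\<^sup>2 - 2*\<tau>*\<beta>1*\<beta>2 - 4*a1*\<beta>1 - 4*a2*\<beta>2 = 0"
proof -
  let ?G = "\<lambda>x y. 2*a1*x + 2*a2*y - x\<^sup>2/2 - y\<^sup>2/2 + \<tau> * x * y"
  have "((\<lambda>s. ?G (f1 s) (f2 s)) \<longlongrightarrow> ?G \<beta>1 \<beta>2) at_top"
    by (intro tendsto_intros b) auto
  moreover have "((\<lambda>s. P1 s + P2 s) \<longlongrightarrow> 0) at_top"
    by (rule tendsto_eq_intros P1_lim_top P2_lim_top b refl | simp)+
  then have "((\<lambda>s. ?G (f1 s) (f2 s)) \<longlongrightarrow> 0) at_top"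
    by (rule Lim_transform_eventually)
      (use eventually_gt_at_top[of 0] in \<open>eventually_elim, auto simp: pohozaev_identity\<close>)
  ultimately have "?G \<beta>1 \<beta>2 = 0" by (intro tendsto_unique[OF trivial_limit_at_top_linorder])
  then show ?thesis by (simp add: algebra_simps)
qed

text \<open>Positivity of \<open>R1\<close> gives \<open>P1 > f1 * (2*a1 - f1/2)\<close>, so as long
  as \<open>f1\<close> stays between \<open>c\<close> and \<open>4*a1 - \<epsilon>\<close>,
  \<open>P1\<close> is at least \<open>c*\<epsilon>/2\<close> and \<open>f1\<close> grows
  logarithmically. The time depends only on \<open>a1\<close>, \<open>c\<close> and
  \<open>\<epsilon>\<close>; this uniformity allows the second component to be made small up to that
  time afterwards.\<close>

lemma f1_reaches_first_bubble:
  assumes "0 < c" "c \<le> f1 1" "0 < \<epsilon>"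
  shows "4*a1 - \<epsilon> \<le> f1 (exp (16*a1/(c*\<epsilon>)))"
proof (rule ccontr)
  define T where "T = exp (16*a1/(c*\<epsilon>))"
  assume "\<not> ?thesis"
  then have lt: "f1 T < 4*a1 - \<epsilon>" by (simp add: T_def)
  have T: "1 \<le> T" using params assms by (auto simp: T_def)
  have "f1 1 + (c*\<epsilon>/2)/2 * (ln T - ln 1) \<le> f1 T"
  proof (rule P1_log_growth)
    fix x assume x: "1 \<le> x" "x \<le> T"
    have fx: "c \<le> f1 x" "f1 x < 4*a1 - \<epsilon>"
      using f1_mono[of 1 x] f1_mono[of x T] x assms lt by (cases "x = 1"; cases "x = T"; force)+
    have "c*\<epsilon>/2 \<le> f1 x * (2*a1 - f1 x/2)"
      using mult_mono[of c "f1 x" "\<epsilon>/2" "2*a1 - f1 x/2"] fx assms by (simp add: field_simps)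
    also have "\<dots> \<le> P1 x"
      using R1_pos[of x] x by (simp add: R1_def power2_eq_square algebra_simps)
    finally show "c*\<epsilon>/2 \<le> P1 x" .
  qed (use T in auto)
  moreover have "(c*\<epsilon>/2)/2 * (ln T - ln 1) = 4*a1" using assms by (simp add: T_def)
  ultimately show False using lt assms by linarith
qed

text \<open>After \<open>T\<close> the mass \<open>K\<close> of the first component acts on the
  second like a point source and replaces \<open>2*a2\<close> by \<open>2*a2 + \<tau>*K\<close>.
  \<open>Q\<close> is the scalar Pohozaev defect for this shifted exponent; it is nondecreasing
  because \<open>f1\<close> stays above \<open>K\<close>.\<close>

lemma late_bubble:
  assumes b2: "(f2 \<longlongrightarrow> \<beta>2) at_top" and T: "0 < T" and K: "K \<le> f1 T"
  shows "4*a2 + 2*\<tau>*K - f2 T \<le> \<beta>2"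
proof -
  define Q where "Q s = P2 s - (2*a2 + \<tau>*K) * f2 s + (f2 s)\<^sup>2/2" for s
  have mono: "Q T \<le> Q t" if "T \<le> t" for t
  proof (rule DERIV_nonneg_imp_nondecreasing[OF that])
    fix x assume x: "T \<le> x" "x \<le> t"
    then have x0: "0 < x" using T by simp
    have fx: "K \<le> f1 x" using f1_mono[of T x] T K x by (cases "x = T") auto
    define A where "A = P2 x / (2 * x)"
    note d = f2_deriv[OF x0, folded A_def] P2_deriv[OF x0, folded A_def]
    have "(Q has_real_derivative A * (\<tau> * (f1 x - K))) (at x)"
      unfolding Q_def power2_eq_square 
      by (rule DERIV_cdivide d derivative_eq_intros refl)+ (simp add: algebra_simps)
    moreover have "A * (\<tau> * (f1 x - K)) \<ge> 0"
      unfolding A_def using P2_pos[OF x0] x0 fx params by (intro mult_nonneg_nonneg) auto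
    ultimately show "\<exists>y. (Q has_real_derivative y) (at x) \<and> y \<ge> 0" by blast
  qed
  have lim: "(Q \<longlongrightarrow> 0 - (2*a2 + \<tau>*K) * \<beta>2 + \<beta>2\<^sup>2/2) at_top"
    unfolding Q_def by (rule tendsto_eq_intros b2 P2_lim_top[OF b2] refl | simp)+
  have "Q T \<le> 0 - (2*a2 + \<tau>*K) * \<beta>2 + \<beta>2\<^sup>2/2"
    by (rule tendsto_lowerbound[OF lim])
      (auto intro: eventually_mono[OF eventually_ge_at_top[of T] mono])
  \<comment> \<open>The right-hand side is the limit of \<open>Q\<close> minus \<open>Q T\<close>,
    plus \<open>P2 T\<close>. As its first factor is positive, so is the second, which is the
    claim.\<close>
  then have "0 < (\<beta>2 - f2 T) * ((\<beta>2 + f2 T)/2 - (2*a2 + \<tau>*K))"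
    using P2_pos[OF T] by (simp add: Q_def power2_eq_square algebra_simps add_divide_distrib diff_divide_distrib)
  then show ?thesis using f2_less_limit[OF b2 T] by (simp add: zero_less_mult_iff)
qed

end

section \<open>Geometry of the conic: a priori bounds and the decreasing arc\<close>

lemma conic_bound:
  fixes x y a1 a2 \<tau> :: real
  assumes "0 \<le> x" "0 \<le> y" "0 < a1" "0 < a2" "0 < \<tau>" "\<tau> \<le> 1/2"
    and G: "0 \<le> 2*a1*x + 2*a2*y - x\<^sup>2/2 - y\<^sup>2/2 + \<tau> * x * y"
  shows "x \<le> 8*(a1+a2)" "y \<le> 8*(a1+a2)"
proof -
  define m where "m = max x y"
  have m: "0 \<le> m" "x \<le> m" "y \<le> m" using assms by (auto simp: m_def)
  \<comment> \<open>The mixed term consumes at most half of the negative squares. What remains is at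
    least \<open>m\<^sup>2/4\<close>, against a linear part of at most \<open>2*(a1+a2)*m\<close>;
    hence the constant 8.\<close>
  have "\<tau> * (x * y) \<le> 1/2 * (x * y)" using assms by (intro mult_right_mono mult_nonneg_nonneg) auto
  moreover have "2 * (x * y) \<le> x\<^sup>2 + y\<^sup>2" using sum_squares_bound[of x y] by simp
  moreover have "m\<^sup>2 \<le> x\<^sup>2 + y\<^sup>2" by (auto simp: m_def max_def)
  moreover have "a1*x \<le> a1*m" "a2*y \<le> a2*m" using assms m by (auto intro!: mult_left_mono)
  ultimately have "m\<^sup>2/4 \<le> 2*(a1*m) + 2*(a2*m)" using G by (simp add: mult.assoc)
  then have "m * m \<le> m * (8*(a1+a2))" by (simp add: power2_eq_square algebra_simps)
  then have "m \<le> 8*(a1+a2)" using m(1) assms by (cases "m = 0") auto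
  then show "x \<le> 8*(a1+a2)" "y \<le> 8*(a1+a2)" using m by auto
qed

lemma (in liouville_flow) flow_bounded:
  assumes "\<tau> \<le> 1/2" "0 < s"
  shows "f1 s \<le> 8*(a1+a2)" "f2 s \<le> 8*(a1+a2)"
  using conic_bound[of "f1 s" "f2 s" a1 a2 \<tau>] pohozaev_identity[OF assms(2)] P1_pos[OF assms(2)] P2_pos[OF assms(2)]
    f1_pos[OF assms(2)] f2_pos[OF assms(2)] params assms(1) by auto

lemma (in liouville_flow) f1_convergent:
  assumes "\<tau> \<le> 1/2" shows "\<exists>\<beta>1. (f1 \<longlongrightarrow> \<beta>1) at_top"
proof -
  have bdd: "bdd_above (f1 ` {0<..})"
    using flow_bounded(1)[OF assms] by (auto intro!: bdd_aboveI2)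
  have "(f1 \<longlongrightarrow> (SUP s\<in>{0<..}. f1 s)) at_top"
  proof (rule order_tendstoI)
    fix y assume "y < (SUP s\<in>{0<..}. f1 s)"
    then obtain t where t: "0 < t" "y < f1 t"
      using less_cSUP_iff[OF _ bdd] by auto
    show "eventually (\<lambda>s. y < f1 s) at_top"
      using eventually_gt_at_top[of t] by eventually_elim (use f1_mono[OF t(1)] t(2) in force)
  next
    fix y assume y: "(SUP s\<in>{0<..}. f1 s) < y"
    show "eventually (\<lambda>s. f1 s < y) at_top"
      using eventually_gt_at_top[of 0]
    proof eventually_elim
      case (elim s)
      then have "f1 s \<le> (SUP s\<in>{0<..}. f1 s)" by (intro cSUP_upper bdd) auto
      then show ?case using y by simp
    qed
  qed
  then show ?thesis by blast
qed

lemma (in liouville_flow) f2_convergent: "\<tau> \<le> 1/2 \<Longrightarrow> \<exists>\<beta>2. (f2 \<longlongrightarrow> \<beta>2) at_top"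
  by (rule liouville_flow.f1_convergent[OF swap])

text \<open>If the gradient of the polynomial is componentwise nonnegative at one zero, moving up or
  right strictly increases the polynomial, so no second zero dominates the first.\<close>

lemma conic_comparison:
  fixes a1 a2 \<tau> x1 x2 y1 y2 :: real
  assumes E: "x1\<^sup>2 + x2\<^sup>2 - 2*\<tau>*x1*x2 - 4*a1*x1 - 4*a2*x2 = 0"
      "y1\<^sup>2 + y2\<^sup>2 - 2*\<tau>*y1*y2 - 4*a1*y1 - 4*a2*y2 = 0"
    and le: "x1 \<le> y1" "x2 \<le> y2" and \<tau>: "0 \<le> \<tau>" "\<tau> < 1"
    and grad: "2*a1 \<le> x1 - \<tau>*x2" "2*a2 \<le> x2 - \<tau>*x1"
  shows "x1 = y1" "x2 = y2"
proof -
  define d1 d2 where "d1 = y1 - x1" and "d2 = y2 - x2"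
  have "0 \<le> d1" "0 \<le> d2" using le by (auto simp: d1_def d2_def)
  have y: "y1 = x1 + d1" "y2 = x2 + d2" by (auto simp: d1_def d2_def)
  \<comment> \<open>Exact Taylor expansion of the quadratic at \<open>(x1, x2)\<close>; the
    quadratic form in \<open>(d1, d2)\<close> is written as a sum of squares that exhibits its
    definiteness for \<open>\<tau> < 1\<close>.\<close>
  have "2*(x1 - \<tau>*x2 - 2*a1)*d1 + 2*(x2 - \<tau>*x1 - 2*a2)*d2 + \<tau>*(d1-d2)\<^sup>2 + (1-\<tau>)*(d1\<^sup>2+d2\<^sup>2) = 0"
    using E unfolding y by (simp add: power2_eq_square algebra_simps)
  moreover have "2*(x1 - \<tau>*x2 - 2*a1)*d1 \<ge> 0" "2*(x2 - \<tau>*x1 - 2*a2)*d2 \<ge> 0" "\<tau>*(d1-d2)\<^sup>2 \<ge> 0"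
    using grad \<tau> \<open>0 \<le> d1\<close> \<open>0 \<le> d2\<close> by (auto intro!: mult_nonneg_nonneg)
  ultimately have "(1-\<tau>)*(d1\<^sup>2+d2\<^sup>2) \<le> 0" by linarith
  then have "d1\<^sup>2+d2\<^sup>2 \<le> 0" using \<tau> by (simp add: mult_le_0_iff)
  then have "d1 = 0" "d2 = 0" by (auto simp: sum_power2_le_zero_iff)
  then show "x1 = y1" "x2 = y2" by (auto simp: y)
qed

text \<open>\<open>cond1\<close> says that the first partial derivative of the conic polynomial is
  nonnegative at the end point \<open>(4*a1, 4*a2 + 8*\<tau>*a1)\<close>, \<open>cond2\<close> that
  the second one is nonnegative at \<open>(4*a1 + 8*\<tau>*a2, 4*a2)\<close>. At these points they
  are at their smallest.\<close>

locale flux_arc =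
  fixes a1 a2 \<tau> :: real
  assumes params: "a1 > 0" "a2 > 0" "0 < \<tau>" "\<tau> < 1"
    and cond1: "4*\<tau>\<^sup>2*a1 + 2*\<tau>*a2 \<le> a1"
    and cond2: "4*\<tau>\<^sup>2*a2 + 2*\<tau>*a1 \<le> a2"
begin

definition on_arc :: "real \<Rightarrow> real \<Rightarrow> bool" where
  "on_arc x y \<longleftrightarrow> x\<^sup>2 + y\<^sup>2 - 2*\<tau>*x*y - 4*a1*x - 4*a2*y = 0 \<and> x > 4*a1 \<and> y > 4*a2"

text \<open>Otherwise the point would dominate the end point
  \<open>(4*a1 + 8*\<tau>*a2, 4*a2)\<close> of the conic, where the gradient is nonnegative by
  \<open>cond2\<close>, and hence coincide with it.\<close>

lemma arc_less1: assumes "on_arc x y" shows "x < 4*a1 + 8*\<tau>*a2"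
proof (rule ccontr)
  assume "\<not> ?thesis"
  then have "4*a2 = y"
    using assms params cond1 cond2
    by (intro conic_comparison(2)[of "4*a1 + 8*\<tau>*a2" "4*a2" \<tau> a1 a2 x y])
      (auto simp: on_arc_def power2_eq_square algebra_simps)
  then show False using assms by (simp add: on_arc_def)
qed

lemma arc_less2: assumes "on_arc x y" shows "y < 4*a2 + 8*\<tau>*a1"
proof (rule ccontr)
  assume "\<not> ?thesis"
  then have "4*a1 = x"
    using assms params cond1 cond2
    by (intro conic_comparison(1)[of "4*a1" "4*a2 + 8*\<tau>*a1" \<tau> a1 a2 x y])
      (auto simp: on_arc_def power2_eq_square algebra_simps)
  then show False using assms by (simp add: on_arc_def)
qed

text \<open>The bounds on both coordinates reduce the sign of each partial derivative to its sign at
  an end point. This is the form in which the arc is a decreasing graph: comparable points are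
  equal.\<close>

lemma arc_antichain:
  assumes x: "on_arc x1 x2" and y: "on_arc y1 y2" and le: "x1 \<le> y1" "x2 \<le> y2"
  shows "x1 = y1" "x2 = y2"
proof -
  have "\<tau> * x2 \<le> \<tau> * (4*a2 + 8*\<tau>*a1)" "\<tau> * x1 \<le> \<tau> * (4*a1 + 8*\<tau>*a2)"
    using arc_less1[OF x] arc_less2[OF x] params by (auto intro!: mult_left_mono)
  then have "2*a1 \<le> x1 - \<tau>*x2" "2*a2 \<le> x2 - \<tau>*x1"
    using cond1 cond2 x by (auto simp: on_arc_def power2_eq_square algebra_simps)
  then show "x1 = y1" "x2 = y2"
    using x y le params conic_comparison[of x1 x2 \<tau> a1 a2 y1 y2] by (auto simp: on_arc_def)
qed

end

section \<open>Existence and continuous dependence for the flow\<close>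

text \<open>The mean of \<open>h\<close> over [0, s], so that \<open>s * avg h s\<close> is the
  integral of \<open>h\<close> from 0 to \<open>s\<close>. The rescaling to the fixed interval
  [0, 1] removes the division by \<open>s\<close>, and continuity at \<open>s = 0\<close> needs no
  separate argument.\<close>

definition avg :: "(real \<Rightarrow> real) \<Rightarrow> real \<Rightarrow> real" where
  "avg h s = integral {0..1} (\<lambda>\<sigma>. h (s * \<sigma>))"

lemma avg_continuous:
  fixes H :: "real \<times> real \<Rightarrow> real"
  assumes "continuous_on UNIV H"
  shows "continuous_on UNIV (\<lambda>(s,l). avg (\<lambda>r. H (r, l)) s)"
proof -
  have "continuous_on (UNIV \<times> cbox (0::real) 1) (\<lambda>(x, t). H (fst x * t, snd x))"
    unfolding case_prod_beta
    by (rule continuous_on_compose2[OF assms]) (auto intro!: continuous_intros)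
  then have "continuous_on UNIV (\<lambda>x. integral (cbox 0 1) (\<lambda>t. H (fst x * t, snd x)))"
    by (rule integral_continuous_on_param)
  then show ?thesis by (simp add: avg_def case_prod_beta)
qed

lemma avg_integrable:
  fixes h :: "real \<Rightarrow> real"
  assumes "continuous_on UNIV h"
  shows "(\<lambda>\<sigma>. h (s * \<sigma>)) integrable_on {0..1::real}"
  by (rule integrable_continuous_real) (auto intro!: continuous_on_compose2[OF assms] continuous_intros)

lemma avg_mono:
  assumes h: "continuous_on UNIV h" "continuous_on UNIV k" and s: "0 \<le> s"
    and le: "\<And>r. 0 \<le> r \<Longrightarrow> r \<le> s \<Longrightarrow> h r \<le> k r"
  shows "avg h s \<le> avg k s"
  unfolding avg_def
  by (rule integral_le[OF avg_integrable avg_integrable])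
    (use h s in \<open>auto intro!: le simp: mult_left_le\<close>)

lemma avg_const [simp]: "avg (\<lambda>_. c) s = c"
  by (simp add: avg_def)

lemma avg_abs_diff_le:
  assumes h: "continuous_on UNIV h" "continuous_on UNIV h'" "continuous_on UNIV k" and s: "0 \<le> s"
    and le: "\<And>r. 0 \<le> r \<Longrightarrow> r \<le> s \<Longrightarrow> \<bar>h r - h' r\<bar> \<le> k r"
  shows "\<bar>avg h s - avg h' s\<bar> \<le> avg k s"
proof -
  have d: "avg h s - avg h' s = avg (\<lambda>r. h r - h' r) s"
    unfolding avg_def by (rule integral_diff[symmetric]) (auto intro: avg_integrable h)
  have c: "continuous_on UNIV (\<lambda>r. h r - h' r)" by (intro continuous_intros h)
  have "avg (\<lambda>r. h r - h' r) s \<le> avg k s"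
    by (rule avg_mono[OF c h(3) s]) (use le in \<open>auto simp: abs_le_iff\<close>)
  moreover have "avg (\<lambda>r. - k r) s \<le> avg (\<lambda>r. h r - h' r) s"
    by (rule avg_mono[OF _ c s]) (use h le in \<open>auto simp: abs_le_iff intro!: continuous_intros\<close>, force)
  moreover have "avg (\<lambda>r. - k r) s = - avg k s" by (simp add: avg_def)
  ultimately show ?thesis unfolding d by linarith
qed

lemma avg_antiderivative:
  assumes F: "\<And>r. (F has_real_derivative h r) (at r)"
  shows "s * avg h s = F s - F 0"
proof -
  have "((\<lambda>\<sigma>. s * h (s * \<sigma>)) has_integral F (s * 1) - F (s * 0)) {0..1}"
  proof (rule fundamental_theorem_of_calculus)
    fix x :: real
    have "((\<lambda>\<sigma>. F (s * \<sigma>)) has_real_derivative h (s * x) * s) (at x within {0..1})"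
      by (rule DERIV_subset[OF DERIV_chain2[OF F]]) (auto intro!: derivative_eq_intros)
    then show "((\<lambda>\<sigma>. F (s * \<sigma>)) has_vector_derivative s * h (s * x)) (at x within {0..1})"
      by (simp add: has_real_derivative_iff_has_vector_derivative mult.commute)
  qed simp
  from integral_unique[OF this] show ?thesis by (simp add: avg_def)
qed

lemma antiderivative_exists:
  assumes "continuous_on UNIV (h :: real \<Rightarrow> real)"
  obtains F where "\<And>x. (F has_real_derivative h x) (at x)"
proof -
  have "isCont h x" for x using assms by (simp add: continuous_on_eq_continuous_at)
  then have "\<exists>F. \<forall>x::real. -\<infinity> < ereal x \<longrightarrow> ereal x < \<infinity> \<longrightarrow> (F has_vector_derivative h x) (at x)"
    by (intro einterval_antiderivative) auto
  then show thesis using that by (auto simp: has_real_derivative_iff_has_vector_derivative)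
qed

lemma avg_deriv:
  assumes "continuous_on UNIV h"
  shows "((\<lambda>s. s * avg h s) has_real_derivative h x) (at x)"
proof -
  obtain F where F: "\<And>x. (F has_real_derivative h x) (at x)"
    using antiderivative_exists[OF assms] by blast
  have "((\<lambda>s. F s - F 0) has_real_derivative h x) (at x)"
    by (auto intro!: derivative_eq_intros F)
  then show ?thesis using avg_antiderivative[OF F] by simp
qed

section \<open>The integral equation for the radial profile\<close>

lemma exp_diff_le:
  fixes x y M :: real
  assumes "x \<le> M" "y \<le> M" shows "\<bar>exp x - exp y\<bar> \<le> exp M * \<bar>x - y\<bar>"
proof -
  have *: "exp b - exp a \<le> exp M * (b - a)" if "a \<le> b" "b \<le> M" for a b :: real
  proof -
    have "exp b * (1 + (a - b)) \<le> exp b * exp (a - b)"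
      by (intro mult_left_mono exp_ge_add_one_self) auto
    then have "exp b - exp a \<le> exp b * (b - a)" by (simp add: exp_diff algebra_simps)
    also have "\<dots> \<le> exp M * (b - a)" using that by (intro mult_right_mono) auto
    finally show ?thesis .
  qed
  show ?thesis using *[of x y] *[of y x] assms
    by (cases "x \<le> y") (auto simp: abs_if)
qed

text \<open>The weight s^n, extended continuously to the whole line. The case \<open>n = 0\<close>
  is separate because \<open>0 powr 0 = 0\<close> would make the constant weight jump at the
  origin.\<close>

definition wt :: "real \<Rightarrow> real \<Rightarrow> real" where
  "wt n s = (if n = 0 then 1 else max 0 s powr n)"

lemma wt_pos_eq: "0 < s \<Longrightarrow> wt n s = s powr n"
  by (simp add: wt_def)

lemma wt_nonneg: "0 \<le> wt n s"
  by (simp add: wt_def)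

lemma wt_continuous: "0 \<le> n \<Longrightarrow> continuous_on A (wt n)"
  unfolding wt_def by (cases "n = 0") (auto intro!: continuous_intros continuous_on_powr')

text \<open>From \<open>ln s \<le> s\<close>. In this form the weight merges with the exponential
  factors of the contraction estimate.\<close>

lemma wt_le_exp:
  assumes "0 \<le> n" "n \<le> N" "0 \<le> s" shows "wt n s \<le> exp (N * s)"
proof (cases "s = 0")
  case True then show ?thesis by (simp add: wt_def)
next
  case False
  have "ln s \<le> s" using False assms ln_le_minus_one[of s] by simp
  then have "n * ln s \<le> n * s" using assms by (intro mult_left_mono) auto
  also have "\<dots> \<le> N * s" using assms by (intro mult_right_mono) auto
  finally show ?thesis using False assms by (simp add: wt_pos_eq powr_def)
qed

text \<open>The flow in the unknowns \<open>z\<^sub>i = f\<^sub>i / s\<close>, which are regular at the origin. Clamping \<open>z\<^sub>i\<close>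
  to \<open>[0, Z]\<close> makes the integral equation globally Lipschitz in a weighted norm.
  The parameter \<open>\<lambda>\<close> is carried as a second argument of the unknown, so that the
  fixed point is jointly continuous.\<close>

locale clamped_problem =
  fixes N1 N2 \<tau> Z :: real
  assumes N: "0 \<le> N1" "0 \<le> N2" and \<tau>: "0 < \<tau>" "\<tau> \<le> 1/2" and Z: "0 < Z"
begin

definition clampZ :: "real \<Rightarrow> real" where "clampZ x = max 0 (min x Z)"

lemma clampZ_bounds: "0 \<le> clampZ x" "clampZ x \<le> Z"
  using Z by (auto simp: clampZ_def)

lemma clampZ_lipschitz: "\<bar>clampZ x - clampZ y\<bar> \<le> \<bar>x - y\<bar>"
  by (auto simp: clampZ_def max_def min_def)

lemma clampZ_continuous [continuous_intros]:
  "continuous_on A f \<Longrightarrow> continuous_on A (\<lambda>x. clampZ (f x))"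
  unfolding clampZ_def by (intro continuous_intros)

text \<open>The radial potential v(x) as a function of s = |x|^2: its value at the origin is
  \<open>\<alpha>\<close>, and its derivative is -(f - \<tau> f')/(2s) = -(z - \<tau> z')/2, where f
  and f' are the two partial fluxes. The operator \<open>op\<close> below turns this potential back
  into f/s.\<close>

definition pot :: "real \<Rightarrow> (real \<Rightarrow> real) \<Rightarrow> (real \<Rightarrow> real) \<Rightarrow> real \<Rightarrow> real" where
  "pot \<alpha> z z' s = \<alpha> - 1/2 * (s * avg (\<lambda>r. clampZ (z r) - \<tau> * clampZ (z' r)) s)"

definition op :: "real \<Rightarrow> real \<Rightarrow> (real \<Rightarrow> real) \<Rightarrow> (real \<Rightarrow> real) \<Rightarrow> real \<Rightarrow> real" where
  "op n \<alpha> z z' s = 1/2 * avg (\<lambda>r. wt n r * exp (pot \<alpha> z z' r)) s"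

lemma pot_continuous:
  fixes z z' :: "real \<Rightarrow> real \<Rightarrow> real" and \<alpha> :: "real \<Rightarrow> real"
  assumes "continuous_on UNIV (\<lambda>(s,l). z s l)" "continuous_on UNIV (\<lambda>(s,l). z' s l)" "continuous_on UNIV \<alpha>"
  shows "continuous_on UNIV (\<lambda>(s,l). pot (\<alpha> l) (\<lambda>r. z r l) (\<lambda>r. z' r l) s)"
proof -
  have "continuous_on UNIV (\<lambda>x. clampZ (z (fst x) (snd x)) - \<tau> * clampZ (z' (fst x) (snd x)))"
    using assms(1,2) unfolding case_prod_beta by (intro continuous_intros)
  from avg_continuous[OF this] show ?thesis
    unfolding pot_def case_prod_beta
    by (intro continuous_intros continuous_on_compose2[OF assms(3)]) auto
qed

lemma op_continuous:
  fixes z z' :: "real \<Rightarrow> real \<Rightarrow> real" and \<alpha> :: "real \<Rightarrow> real"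
  assumes "continuous_on UNIV (\<lambda>(s,l). z s l)" "continuous_on UNIV (\<lambda>(s,l). z' s l)" "continuous_on UNIV \<alpha>" "0 \<le> n"
  shows "continuous_on UNIV (\<lambda>(s,l). op n (\<alpha> l) (\<lambda>r. z r l) (\<lambda>r. z' r l) s)"
proof -
  have "continuous_on UNIV (\<lambda>x. wt n (fst x) * exp (pot (\<alpha> (snd x)) (\<lambda>r. z r (snd x)) (\<lambda>r. z' r (snd x)) (fst x)))"
    using pot_continuous[OF assms(1-3)] unfolding case_prod_beta
    by (intro continuous_intros continuous_on_compose2[OF wt_continuous[OF assms(4), of UNIV]]) auto
  from avg_continuous[OF this] show ?thesis
    unfolding op_def case_prod_beta by (intro continuous_intros) auto
qed

lemma continuous_const_param:
  "continuous_on UNIV (z :: real \<Rightarrow> real) \<Longrightarrow> continuous_on UNIV (\<lambda>(s,l::real). z s)"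
  unfolding case_prod_beta by (rule continuous_on_compose2[of UNIV z]) (auto intro!: continuous_intros)

lemma pot_continuous1:
  assumes "continuous_on UNIV z" "continuous_on UNIV z'"
  shows "continuous_on UNIV (pot \<alpha> z z')"
proof -
  have "continuous_on UNIV (\<lambda>x::real\<times>real. pot \<alpha> z z' (fst x))"
    using pot_continuous[OF continuous_const_param[OF assms(1)] continuous_const_param[OF assms(2)], of "\<lambda>_. \<alpha>"]
    by (simp add: case_prod_beta)
  from continuous_on_compose2[OF this, of UNIV "\<lambda>s. (s, 0)"] show ?thesis
    by (simp add: continuous_on_Pair)
qed

lemma integrand_continuous:
  assumes "continuous_on UNIV z" "continuous_on UNIV z'" "0 \<le> n"
  shows "continuous_on UNIV (\<lambda>r. wt n r * exp (pot \<alpha> z z' r))"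
  by (intro continuous_intros wt_continuous pot_continuous1 assms)

lemma pot_bounds:
  assumes z: "continuous_on UNIV z" "continuous_on UNIV z'" and s: "0 \<le> s"
  shows "pot \<alpha> z z' s \<le> \<alpha> + \<tau> * Z * s / 2" "\<alpha> - Z * s / 2 \<le> pot \<alpha> z z' s"
proof -
  have c: "continuous_on UNIV (\<lambda>r. clampZ (z r) - \<tau> * clampZ (z' r))"
    by (intro continuous_intros z)
  have "avg (\<lambda>_. - (\<tau> * Z)) s \<le> avg (\<lambda>r. clampZ (z r) - \<tau> * clampZ (z' r)) s"
  proof (rule avg_mono[OF _ c s])
    fix r show "- (\<tau> * Z) \<le> clampZ (z r) - \<tau> * clampZ (z' r)"
    proof -
      have "\<tau> * clampZ (z' r) \<le> \<tau> * Z" using \<tau> clampZ_bounds by (intro mult_left_mono) auto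
      then show ?thesis using clampZ_bounds(1)[of "z r"] by linarith
    qed
  qed auto
  then have "s * - (\<tau> * Z) \<le> s * avg (\<lambda>r. clampZ (z r) - \<tau> * clampZ (z' r)) s"
    using s by (intro mult_left_mono) auto
  then show "pot \<alpha> z z' s \<le> \<alpha> + \<tau> * Z * s / 2" by (simp add: pot_def algebra_simps)
  have "avg (\<lambda>r. clampZ (z r) - \<tau> * clampZ (z' r)) s \<le> avg (\<lambda>_. Z) s"
  proof (rule avg_mono[OF c _ s])
    fix r show "clampZ (z r) - \<tau> * clampZ (z' r) \<le> Z"
    proof -
      have "0 \<le> \<tau> * clampZ (z' r)" using \<tau> clampZ_bounds by (intro mult_nonneg_nonneg) auto
      then show ?thesis using clampZ_bounds(2)[of "z r"] by linarith
    qed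
  qed auto
  then have "s * avg (\<lambda>r. clampZ (z r) - \<tau> * clampZ (z' r)) s \<le> s * Z"
    using s by (intro mult_left_mono) auto
  then show "\<alpha> - Z * s / 2 \<le> pot \<alpha> z z' s" by (simp add: pot_def algebra_simps)
qed

lemma op_nonneg:
  assumes "continuous_on UNIV z" "continuous_on UNIV z'" "0 \<le> n" "0 \<le> s"
  shows "0 \<le> op n \<alpha> z z' s"
  using avg_mono[OF continuous_on_const integrand_continuous[OF assms(1-3)] assms(4), of 0]
  by (simp add: op_def wt_nonneg)

lemma op_le:
  assumes z: "continuous_on UNIV z" "continuous_on UNIV z'" and n: "0 \<le> n" "n \<le> K" and s: "0 \<le> s"
  shows "op n \<alpha> z z' s \<le> 1/2 * (exp (K * s) * exp (\<alpha> + \<tau> * Z * s / 2))"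
proof -
  have "avg (\<lambda>r. wt n r * exp (pot \<alpha> z z' r)) s \<le> avg (\<lambda>_. exp (K * s) * exp (\<alpha> + \<tau> * Z * s / 2)) s"
  proof (rule avg_mono[OF integrand_continuous[OF z n(1)] _ s])
    fix r assume r: "0 \<le> r" "r \<le> s"
    have "wt n r \<le> exp (K * r)" by (rule wt_le_exp[OF n r(1)])
    also have "\<dots> \<le> exp (K * s)" using r n by (auto intro!: mult_left_mono)
    finally have 1: "wt n r \<le> exp (K * s)" .
    have "pot \<alpha> z z' r \<le> \<alpha> + \<tau> * Z * r / 2" by (rule pot_bounds[OF z r(1)])
    also have "\<dots> \<le> \<alpha> + \<tau> * Z * s / 2" using r \<tau> Z by (auto intro!: mult_left_mono divide_right_mono)
    finally have 2: "exp (pot \<alpha> z z' r) \<le> exp (\<alpha> + \<tau> * Z * s / 2)" by simp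
    show "wt n r * exp (pot \<alpha> z z' r) \<le> exp (K * s) * exp (\<alpha> + \<tau> * Z * s / 2)"
      by (intro mult_mono 1 2) auto
  qed auto
  then show ?thesis by (simp add: op_def)
qed

definition rate :: real where "rate = max N1 N2 + Z"

lemma rate_pos: "rate > 0" using N Z by (auto simp: rate_def)

text \<open>The doubly exponential weight is dictated by the Lipschitz constant of the integral
  operator, which itself grows like \<open>exp (rate * s)\<close>. The norm weight
  \<open>bielecki\<close> is the derivative of \<open>cum\<close> and equals \<open>cum\<close>
  times twice that factor, so one integration absorbs the growth on the whole half-line at
  once.\<close>

definition cum :: "real \<Rightarrow> real" where "cum s = exp (2 / rate * exp (rate * s))"

definition bielecki :: "real \<Rightarrow> real" where "bielecki s = 2 * exp (rate * s) * cum s"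

lemma cum_deriv: "(cum has_real_derivative bielecki s) (at s)"
  unfolding cum_def bielecki_def
  using rate_pos by (auto intro!: derivative_eq_intros simp: field_simps)

lemma cum_pos: "0 < cum s" by (simp add: cum_def)

lemma bielecki_pos: "0 < bielecki s" by (simp add: bielecki_def cum_def)

lemma bielecki_continuous: "continuous_on A bielecki"
  unfolding bielecki_def cum_def using rate_pos by (intro continuous_intros) auto

lemma pot_lipschitz:
  assumes z: "continuous_on UNIV z" "continuous_on UNIV z'" "continuous_on UNIV y" "continuous_on UNIV y'"
    and s: "0 \<le> s"
    and d: "\<And>r. 0 \<le> r \<Longrightarrow> \<bar>z r - y r\<bar> \<le> D * bielecki r" "\<And>r. 0 \<le> r \<Longrightarrow> \<bar>z' r - y' r\<bar> \<le> D * bielecki r"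
  shows "\<bar>pot \<alpha> z z' s - pot \<alpha> y y' s\<bar> \<le> D * cum s"
proof -
  let ?h = "\<lambda>z z' r. clampZ (z r) - \<tau> * clampZ (z' r)"
  have "0 \<le> D * bielecki 0" using d(1)[OF order_refl] by linarith
  then have "0 \<le> D" using bielecki_pos[of 0] by (simp add: zero_le_mult_iff)
  have "\<bar>avg (?h z z') s - avg (?h y y') s\<bar> \<le> avg (\<lambda>r. 2 * (D * bielecki r)) s"
  proof (rule avg_abs_diff_le)
    fix r assume "0 \<le> r" "r \<le> s"
    then have "\<bar>clampZ (z r) - clampZ (y r)\<bar> \<le> D * bielecki r" "\<bar>clampZ (z' r) - clampZ (y' r)\<bar> \<le> D * bielecki r"
      using d order_trans[OF clampZ_lipschitz] by auto
    moreover have "?h z z' r - ?h y y' r = (clampZ (z r) - clampZ (y r)) - \<tau> * (clampZ (z' r) - clampZ (y' r))"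
      by (simp add: algebra_simps)
    moreover have "\<bar>\<tau> * (clampZ (z' r) - clampZ (y' r))\<bar> \<le> \<bar>clampZ (z' r) - clampZ (y' r)\<bar>"
      unfolding abs_mult using \<tau> by (intro mult_left_le_one_le) auto
    ultimately show "\<bar>?h z z' r - ?h y y' r\<bar> \<le> 2 * (D * bielecki r)" by linarith
  qed (auto intro!: continuous_intros z s bielecki_continuous)
  then have "s * \<bar>avg (?h z z') s - avg (?h y y') s\<bar> \<le> s * avg (\<lambda>r. 2 * (D * bielecki r)) s"
    using s by (intro mult_left_mono) auto
  also have "\<dots> = 2 * D * cum s - 2 * D * cum 0"
    by (rule avg_antiderivative) (auto intro!: derivative_eq_intros cum_deriv)
  also have "\<dots> \<le> 2 * D * cum s" using \<open>0 \<le> D\<close> cum_pos[of 0] by (auto intro!: mult_nonneg_nonneg)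
  finally have *: "s * \<bar>avg (?h z z') s - avg (?h y y') s\<bar> \<le> 2 * D * cum s" .
  have "pot \<alpha> z z' s - pot \<alpha> y y' s = - (1/2) * (s * (avg (?h z z') s - avg (?h y y') s))"
    by (simp add: pot_def algebra_simps)
  then have "\<bar>pot \<alpha> z z' s - pot \<alpha> y y' s\<bar> = 1/2 * (s * \<bar>avg (?h z z') s - avg (?h y y') s\<bar>)"
    using s by (simp add: abs_mult)
  then show ?thesis using * by linarith
qed

text \<open>The exponential contributes \<open>exp (Z * r)\<close> and the weight
  \<open>exp (max N1 N2 * r)\<close>, together \<open>exp (rate * r)\<close>. Multiplied by the
  bound \<open>D * cum r\<close> for the potentials and by the factor 1/2 of \<open>op\<close>, this
  is exactly a quarter of \<open>D * bielecki s\<close> at \<open>r = s\<close>.\<close>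

lemma op_lipschitz:
  assumes z: "continuous_on UNIV z" "continuous_on UNIV z'" "continuous_on UNIV y" "continuous_on UNIV y'"
    and n: "0 \<le> n" "n \<le> max N1 N2" and \<alpha>: "\<alpha> \<le> 0" and s: "0 \<le> s"
    and d: "\<And>r. 0 \<le> r \<Longrightarrow> \<bar>z r - y r\<bar> \<le> D * bielecki r" "\<And>r. 0 \<le> r \<Longrightarrow> \<bar>z' r - y' r\<bar> \<le> D * bielecki r"
  shows "\<bar>op n \<alpha> z z' s - op n \<alpha> y y' s\<bar> \<le> D / 4 * bielecki s"
proof -
  have "0 \<le> D * bielecki 0" using d(1)[OF order_refl] by linarith
  then have "0 \<le> D" using bielecki_pos[of 0] by (simp add: zero_le_mult_iff)
  let ?B = "exp (rate * s) * (D * cum s)"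
  have "\<bar>avg (\<lambda>r. wt n r * exp (pot \<alpha> z z' r)) s - avg (\<lambda>r. wt n r * exp (pot \<alpha> y y' r)) s\<bar> \<le> avg (\<lambda>_. ?B) s"
  proof (rule avg_abs_diff_le)
    fix r assume r: "0 \<le> r" "r \<le> s"
    have le: "\<alpha> + \<tau> * Z * r / 2 \<le> Z * r"
    proof -
      have "\<tau> * (Z * r) \<le> 1 * (Z * r)" using \<tau> Z r by (intro mult_right_mono) auto
      moreover have "0 \<le> Z * r" using Z r by simp
      ultimately show ?thesis using \<alpha> unfolding mult.assoc by linarith
    qed
    have p: "pot \<alpha> z z' r \<le> Z * r" "pot \<alpha> y y' r \<le> Z * r"
      using pot_bounds(1)[OF z(1,2) r(1), of \<alpha>] pot_bounds(1)[OF z(3,4) r(1), of \<alpha>] le by auto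
    have "\<bar>exp (pot \<alpha> z z' r) - exp (pot \<alpha> y y' r)\<bar> \<le> exp (Z * r) * \<bar>pot \<alpha> z z' r - pot \<alpha> y y' r\<bar>"
      by (rule exp_diff_le[OF p])
    also have "\<dots> \<le> exp (Z * r) * (D * cum r)"
      by (intro mult_left_mono pot_lipschitz z r d) auto
    finally have e: "\<bar>exp (pot \<alpha> z z' r) - exp (pot \<alpha> y y' r)\<bar> \<le> exp (Z * r) * (D * cum r)" .
    have "\<bar>wt n r * exp (pot \<alpha> z z' r) - wt n r * exp (pot \<alpha> y y' r)\<bar> = wt n r * \<bar>exp (pot \<alpha> z z' r) - exp (pot \<alpha> y y' r)\<bar>"
      by (simp add: right_diff_distrib[symmetric] abs_mult wt_nonneg)
    also have "\<dots> \<le> exp (max N1 N2 * r) * (exp (Z * r) * (D * cum r))"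
      using wt_le_exp[OF n r(1)] e \<open>0 \<le> D\<close> cum_pos[of r] by (intro mult_mono) (auto simp: wt_nonneg)
    also have "\<dots> = exp (rate * r) * (D * cum r)"
      by (simp add: rate_def exp_add[symmetric] algebra_simps)
    also have "\<dots> \<le> ?B"
      using r \<open>0 \<le> D\<close> rate_pos cum_pos[of r] unfolding cum_def
      by (intro mult_mono) (auto intro!: mult_left_mono mult_nonneg_nonneg divide_right_mono)
    finally show "\<bar>wt n r * exp (pot \<alpha> z z' r) - wt n r * exp (pot \<alpha> y y' r)\<bar> \<le> ?B" .
  qed (auto intro!: integrand_continuous z n s)
  then have "\<bar>1/2 * avg (\<lambda>r. wt n r * exp (pot \<alpha> z z' r)) s - 1/2 * avg (\<lambda>r. wt n r * exp (pot \<alpha> y y' r)) s\<bar> \<le> 1/2 * ?B"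
    unfolding avg_const by linarith
  then show ?thesis by (simp add: op_def bielecki_def mult_ac)
qed


text \<open>Banach's fixed point theorem for bounded continuous functions of the pair (s, l), the
  unknowns being divided by \<open>bielecki\<close>. Since the parameter is an argument of the
  unknown, continuous dependence on it is part of the membership in the space. The sign of \<alpha>1
  and \<alpha>2 makes all bounds uniform in l.\<close>

theorem clamped_solution_exists:
  fixes \<alpha>1 \<alpha>2 :: "real \<Rightarrow> real"
  assumes \<alpha>: "continuous_on UNIV \<alpha>1" "continuous_on UNIV \<alpha>2" "\<And>l. \<alpha>1 l \<le> 0" "\<And>l. \<alpha>2 l \<le> 0"
  obtains z1 z2 :: "real \<Rightarrow> real \<Rightarrow> real"
  where "continuous_on UNIV (\<lambda>(s,l). z1 s l)" "continuous_on UNIV (\<lambda>(s,l). z2 s l)"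
    "\<And>s l. 0 \<le> s \<Longrightarrow> z1 s l = op N1 (\<alpha>1 l) (\<lambda>r. z1 r l) (\<lambda>r. z2 r l) s"
    "\<And>s l. 0 \<le> s \<Longrightarrow> z2 s l = op N2 (\<alpha>2 l) (\<lambda>r. z2 r l) (\<lambda>r. z1 r l) s"
proof -
  define Y1 :: "((real\<times>real) \<Rightarrow>\<^sub>C (real\<times>real)) \<Rightarrow> real \<Rightarrow> real \<Rightarrow> real"
    where "Y1 y s l = bielecki s * fst (apply_bcontfun y (s, l))" for y s l
  define Y2 :: "((real\<times>real) \<Rightarrow>\<^sub>C (real\<times>real)) \<Rightarrow> real \<Rightarrow> real \<Rightarrow> real"
    where "Y2 y s l = bielecki s * snd (apply_bcontfun y (s, l))" for y s l
  define Q1 where "Q1 y s l = op N1 (\<alpha>1 l) (\<lambda>r. Y1 y r l) (\<lambda>r. Y2 y r l) s" for y s l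
  define Q2 where "Q2 y s l = op N2 (\<alpha>2 l) (\<lambda>r. Y2 y r l) (\<lambda>r. Y1 y r l) s" for y s l
  have bc: "continuous_on UNIV (\<lambda>x::real\<times>real. bielecki (fst x))"
    by (rule continuous_on_compose2[OF bielecki_continuous[of UNIV]]) (auto intro!: continuous_intros)
  have Yc: "continuous_on UNIV (\<lambda>(s,l). Y1 y s l)" "continuous_on UNIV (\<lambda>(s,l). Y2 y s l)" for y
    unfolding Y1_def Y2_def case_prod_beta by (auto intro!: continuous_intros bc)
  have Yc1: "continuous_on UNIV (\<lambda>r. Y1 y r l)" "continuous_on UNIV (\<lambda>r. Y2 y r l)" for y l
    unfolding Y1_def Y2_def
    by (auto intro!: continuous_intros bielecki_continuous continuous_on_compose2[OF continuous_on_apply_bcontfun[of UNIV]])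
  have Qc: "continuous_on UNIV (\<lambda>(s,l). Q1 y s l)" "continuous_on UNIV (\<lambda>(s,l). Q2 y s l)" for y
    unfolding Q1_def Q2_def by (intro op_continuous Yc \<alpha> N)+
  \<comment> \<open>The estimates hold for nonnegative s only; to the left of the origin the image
    is continued by its value at s = 0.\<close>
  define \<Phi> where "\<Phi> y = (\<lambda>x::real\<times>real. (Q1 y (max 0 (fst x)) (snd x) / bielecki (max 0 (fst x)),
      Q2 y (max 0 (fst x)) (snd x) / bielecki (max 0 (fst x))))" for y
  have \<Phi>c: "continuous_on UNIV (\<Phi> y)" for y
  proof -
    have m: "continuous_on UNIV (\<lambda>x::real\<times>real. (max 0 (fst x), snd x))" by (intro continuous_intros)
    have "continuous_on UNIV (\<lambda>x. Q1 y (max 0 (fst x)) (snd x))" "continuous_on UNIV (\<lambda>x. Q2 y (max 0 (fst x)) (snd x))"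
      using continuous_on_compose2[OF Qc(1) m] continuous_on_compose2[OF Qc(2) m] by auto
    moreover have "continuous_on UNIV (\<lambda>x::real\<times>real. bielecki (max 0 (fst x)))"
      by (rule continuous_on_compose2[OF bielecki_continuous[of UNIV]]) (auto intro!: continuous_intros)
    moreover have "bielecki r \<noteq> 0" for r using bielecki_pos[of r] by simp
    ultimately show ?thesis unfolding \<Phi>_def by (intro continuous_intros) auto
  qed
  have op_bound: "0 \<le> op n a u u' s" "op n a u u' s / bielecki s \<le> 1"
    if "continuous_on UNIV u" "continuous_on UNIV u'" "0 \<le> n" "n \<le> max N1 N2" "a \<le> 0" "0 \<le> s" for n a u u' s
  proof -
    show "0 \<le> op n a u u' s" by (rule op_nonneg[OF that(1-3,6)])
    have "\<tau> * (Z * s) \<le> 1 * (Z * s)" using \<tau> Z that by (intro mult_right_mono) auto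
    moreover have "0 \<le> Z * s" using Z that by simp
    ultimately have le: "a + \<tau> * Z * s / 2 \<le> Z * s" using that(5) unfolding mult.assoc by linarith
    have "op n a u u' s \<le> 1/2 * (exp (max N1 N2 * s) * exp (a + \<tau> * Z * s / 2))"
      by (rule op_le[OF that(1-4,6)])
    also have "\<dots> \<le> 1/2 * (exp (max N1 N2 * s) * exp (Z * s))" using le by simp
    also have "\<dots> = 1/2 * exp (rate * s)" by (simp add: rate_def exp_add[symmetric] algebra_simps)
    also have "\<dots> \<le> 2 * exp (rate * s) * 1" by simp
    also have "\<dots> \<le> bielecki s" unfolding bielecki_def cum_def using rate_pos by (intro mult_left_mono) auto
    finally show "op n a u u' s / bielecki s \<le> 1" using bielecki_pos[of s] by simp
  qed
  have \<Phi>b: "norm (\<Phi> y x) \<le> 2" for y x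
  proof -
    obtain s l where x: "x = (s, l)" by (cases x)
    have "0 \<le> Q1 y (max 0 s) l" "Q1 y (max 0 s) l / bielecki (max 0 s) \<le> 1"
      "0 \<le> Q2 y (max 0 s) l" "Q2 y (max 0 s) l / bielecki (max 0 s) \<le> 1"
      unfolding Q1_def Q2_def using N \<alpha> by (auto intro!: op_bound Yc1)
    then have "\<bar>Q1 y (max 0 s) l / bielecki (max 0 s)\<bar> \<le> 1" "\<bar>Q2 y (max 0 s) l / bielecki (max 0 s)\<bar> \<le> 1"
      using bielecki_pos[of "max 0 s"] by (auto simp: abs_of_nonneg)
    then show ?thesis unfolding x \<Phi>_def
      using norm_Pair_le[of "Q1 y (max 0 s) l / bielecki (max 0 s)" "Q2 y (max 0 s) l / bielecki (max 0 s)"] by simp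
  qed
  define \<Psi> where "\<Psi> y = Bcontfun (\<Phi> y)" for y
  have \<Psi>: "apply_bcontfun (\<Psi> y) = \<Phi> y" for y
    unfolding \<Psi>_def by (rule Bcontfun_inverse[OF bcontfun_normI[OF \<Phi>c \<Phi>b]])
  have lip: "dist (\<Psi> y) (\<Psi> y') \<le> 1/2 * dist y y'" for y y'
  proof (rule dist_bound)
    fix x :: "real \<times> real"
    obtain s' l where x: "x = (s', l)" by (cases x)
    define s where "s = max 0 s'"
    have s: "0 \<le> s" by (simp add: s_def)
    let ?D = "dist y y'"
    have D: "\<bar>fst (apply_bcontfun y p) - fst (apply_bcontfun y' p)\<bar> \<le> ?D"
      "\<bar>snd (apply_bcontfun y p) - snd (apply_bcontfun y' p)\<bar> \<le> ?D" for p
      using dist_bounded[of y p y'] dist_fst_le[of "apply_bcontfun y p" "apply_bcontfun y' p"]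
        dist_snd_le[of "apply_bcontfun y p" "apply_bcontfun y' p"] by (auto simp: dist_real_def)
    have dY: "\<bar>Y1 y r l - Y1 y' r l\<bar> \<le> ?D * bielecki r" "\<bar>Y2 y r l - Y2 y' r l\<bar> \<le> ?D * bielecki r" for r
      unfolding Y1_def Y2_def right_diff_distrib[symmetric] abs_mult
      using D[of "(r, l)"] bielecki_pos[of r] by (auto simp: mult.commute intro!: mult_left_mono)
    have "\<bar>Q1 y s l - Q1 y' s l\<bar> \<le> ?D / 4 * bielecki s"
      unfolding Q1_def by (rule op_lipschitz[OF Yc1 Yc1]) (use N \<alpha> s dY in auto)
    moreover have "\<bar>Q2 y s l - Q2 y' s l\<bar> \<le> ?D / 4 * bielecki s"
      unfolding Q2_def by (rule op_lipschitz[OF Yc1(2,1) Yc1(2,1)]) (use N \<alpha> s dY in auto)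
    ultimately have "\<bar>Q1 y s l / bielecki s - Q1 y' s l / bielecki s\<bar> \<le> ?D / 4" "\<bar>Q2 y s l / bielecki s - Q2 y' s l / bielecki s\<bar> \<le> ?D / 4"
      using bielecki_pos[of s] by (simp_all add: diff_divide_distrib[symmetric] abs_divide divide_le_eq)
    \<comment> \<open>The norm of a pair is bounded by the sum of the two norms, so the two quarters
      give the contraction factor 1/2.\<close>
    then have "norm (\<Phi> y x - \<Phi> y' x) \<le> ?D / 4 + ?D / 4"
      unfolding x \<Phi>_def fst_conv snd_conv s_def[symmetric] diff_Pair
      by (intro order_trans[OF norm_Pair_le]) auto
    then show "dist (apply_bcontfun (\<Psi> y) x) (apply_bcontfun (\<Psi> y') x) \<le> 1/2 * ?D"
      by (simp add: \<Psi> dist_norm)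
  qed
  then obtain y where y: "\<Psi> y = y"
    using banach_fix_type[of "1/2" \<Psi>] by auto
  have fix1: "Y1 y s l = Q1 y s l" "Y2 y s l = Q2 y s l" if "0 \<le> s" for s l
  proof -
    have "apply_bcontfun y (s, l) = \<Phi> y (s, l)" using \<Psi>[of y] y by simp
    then show "Y1 y s l = Q1 y s l" "Y2 y s l = Q2 y s l"
      using that bielecki_pos[of s] by (simp_all add: Y1_def Y2_def \<Phi>_def max_absorb2)
  qed
  show thesis
    by (rule that[of "Y1 y" "Y2 y"]) (use Yc fix1 in \<open>auto simp: Q1_def Q2_def\<close>)
qed

end

text \<open>The two conditions on \<open>\<delta>\<close> and \<open>Z\<close> exclude the clamp in
  two regimes. On [0, \<open>\<delta>\<close>] the crude exponential bound stays below
  \<open>Z\<close> by \<open>Z_large\<close>. Beyond \<open>\<delta>\<close> the a priori bound on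
  \<open>s * z1 s\<close> and \<open>s * z2 s\<close> given by the Pohozaev identity is smaller than
  \<open>\<delta> * Z\<close>, hence than \<open>s * Z\<close>.\<close>

locale clamped_solution = clamped_problem +
  fixes \<alpha>1 \<alpha>2 \<delta> :: real and z1 z2 :: "real \<Rightarrow> real"
  assumes z1_cont: "continuous_on UNIV z1" and z2_cont: "continuous_on UNIV z2"
    and z1_eq: "\<And>s. 0 \<le> s \<Longrightarrow> z1 s = op N1 \<alpha>1 z1 z2 s"
    and z2_eq: "\<And>s. 0 \<le> s \<Longrightarrow> z2 s = op N2 \<alpha>2 z2 z1 s"
    and \<alpha>1: "\<alpha>1 \<le> 0" and \<alpha>2: "\<alpha>2 \<le> 0"
    and \<delta>: "0 < \<delta>" and \<delta>Z: "8 * ((N1 + 1) + (N2 + 1)) < \<delta> * Z"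
    and Z_large: "1/2 * (exp (max N1 N2 * \<delta>) * exp (\<tau> * Z * \<delta> / 2)) < Z"
begin

lemma swap: "clamped_solution N2 N1 \<tau> Z \<alpha>2 \<alpha>1 \<delta> z2 z1"
  by unfold_locales
    (use N \<tau> Z z1_cont z2_cont z1_eq z2_eq \<alpha>1 \<alpha>2 \<delta> \<delta>Z Z_large in \<open>auto simp: max.commute add_ac\<close>)

definition f1 where "f1 s = s * z1 s"
definition w1 where "w1 = pot \<alpha>1 z1 z2"
definition P1 where "P1 s = s * (s powr N1 * exp (w1 s))"
definition f2 where "f2 s = s * z2 s"
definition w2 where "w2 = pot \<alpha>2 z2 z1"
definition P2 where "P2 s = s * (s powr N2 * exp (w2 s))"

lemma w1_deriv: "(w1 has_real_derivative - (1/2) * (clampZ (z1 s) - \<tau> * clampZ (z2 s))) (at s)"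
proof -
  have "continuous_on UNIV (\<lambda>r. clampZ (z1 r) - \<tau> * clampZ (z2 r))"
    by (intro continuous_intros z1_cont z2_cont)
  then have "((\<lambda>s. \<alpha>1 - 1/2 * (s * avg (\<lambda>r. clampZ (z1 r) - \<tau> * clampZ (z2 r)) s)) has_real_derivative
      0 - 1/2 * (clampZ (z1 s) - \<tau> * clampZ (z2 s))) (at s)"
    by (intro DERIV_diff DERIV_const DERIV_cmult avg_deriv)
  then show ?thesis by (simp add: w1_def pot_def[abs_def])
qed

lemma w1_cont: "continuous_on A w1"
  by (intro continuous_at_imp_continuous_on ballI DERIV_isCont[OF w1_deriv])

lemma f1_deriv:
  assumes "0 < s" shows "(f1 has_real_derivative P1 s / (2 * s)) (at s)"
proof -
  have "((\<lambda>s. 1/2 * (s * avg (\<lambda>r. wt N1 r * exp (w1 r)) s)) has_real_derivative 1/2 * (wt N1 s * exp (w1 s))) (at s)"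
    unfolding w1_def by (intro DERIV_cmult avg_deriv integrand_continuous z1_cont z2_cont N)
  moreover have "1/2 * (wt N1 s * exp (w1 s)) = P1 s / (2 * s)"
    using assms by (simp add: P1_def wt_pos_eq)
  ultimately have "((\<lambda>s. 1/2 * (s * avg (\<lambda>r. wt N1 r * exp (w1 r)) s)) has_real_derivative P1 s / (2 * s)) (at s)"
    by (rule DERIV_cong)
  then show ?thesis
    by (rule has_field_derivative_transform_within_open[where S = "{0<..}"])
      (use assms in \<open>auto simp: f1_def z1_eq op_def w1_def\<close>)
qed

lemma P1_deriv:
  assumes "0 < s"
  shows "(P1 has_real_derivative P1 s / (2 * s) * (2 * (N1 + 1) - s * clampZ (z1 s) + \<tau> * (s * clampZ (z2 s)))) (at s)"
proof -
  have *: "s powr (N1 - 1) = s powr N1 / s" using assms by (simp add: powr_diff)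
  show ?thesis
    unfolding P1_def
    apply (rule derivative_eq_intros DERIV_powr w1_deriv refl assms)+
    using assms by (simp add: * field_simps)
qed

lemma z1_nonneg: "0 \<le> s \<Longrightarrow> 0 \<le> z1 s"
  using op_nonneg[OF z1_cont z2_cont N(1)] z1_eq by simp

lemma f1_lim0: "(f1 \<longlongrightarrow> 0) (at_right 0)"
proof -
  have "continuous_on UNIV f1" unfolding f1_def by (intro continuous_intros z1_cont)
  then have "(f1 \<longlongrightarrow> f1 0) (at 0)" by (simp add: continuous_on_def)
  then show ?thesis by (simp add: f1_def filterlim_at_split)
qed

lemma P1_lim0: "(P1 \<longlongrightarrow> 0) (at_right 0)"
proof -
  have "continuous_on UNIV (\<lambda>s. s * (wt N1 s * exp (w1 s)))"
    by (intro continuous_intros wt_continuous N w1_cont)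
  then have "((\<lambda>s. s * (wt N1 s * exp (w1 s))) \<longlongrightarrow> 0 * (wt N1 0 * exp (w1 0))) (at 0)"
    unfolding continuous_on_def by (metis UNIV_I)
  then have "((\<lambda>s. s * (wt N1 s * exp (w1 s))) \<longlongrightarrow> 0) (at_right 0)"
    by (simp add: filterlim_at_split)
  then show ?thesis
    by (rule Lim_transform_eventually)
      (auto simp: eventually_at_right_field P1_def wt_pos_eq intro!: exI[of _ 1])
qed

lemma P1_pos: "0 < s \<Longrightarrow> 0 < P1 s"
  by (simp add: P1_def)

lemma z1_less_near_0:
  assumes "0 \<le> s" "s \<le> \<delta>" shows "z1 s < Z"
proof -
  have "z1 s \<le> 1/2 * (exp (max N1 N2 * s) * exp (\<alpha>1 + \<tau> * Z * s / 2))"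
    using op_le[OF z1_cont z2_cont N(1) _ assms(1), of "max N1 N2" \<alpha>1] z1_eq[OF assms(1)] by simp
  also have "exp (max N1 N2 * s) \<le> exp (max N1 N2 * \<delta>)"
    using assms N by (auto intro!: mult_left_mono)
  also have "\<alpha>1 + \<tau> * Z * s / 2 \<le> \<tau> * Z * \<delta> / 2"
  proof -
    have "\<tau> * Z * s \<le> \<tau> * Z * \<delta>" using assms \<tau> Z by (intro mult_left_mono) auto
    then show ?thesis using \<alpha>1 by linarith
  qed
  finally show ?thesis using Z_large by simp
qed

end

text \<open>In the swapped instance the defined functions appear with exchanged arguments; these
  equations bring facts on the first component into the notation of the second.\<close>

lemma (in clamped_solution) swap_defs:
  "clamped_solution.f1 z2 = f2" "clamped_solution.w1 \<tau> Z \<alpha>2 z2 z1 = w2"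
  "clamped_solution.P1 N2 \<tau> Z \<alpha>2 z2 z1 = P2" "clamped_solution.w2 \<tau> Z \<alpha>1 z2 z1 = w1"
  by (auto simp: fun_eq_iff clamped_solution.f1_def[OF swap] f2_def
      clamped_solution.w1_def[OF swap] w2_def clamped_solution.P1_def[OF swap] P2_def
      clamped_solution.w2_def[OF swap] w1_def)

context clamped_solution
begin

lemmas w2_cont = clamped_solution.w1_cont[OF swap, unfolded swap_defs]
lemmas f2_deriv = clamped_solution.f1_deriv[OF swap, unfolded swap_defs]
lemmas P2_deriv = clamped_solution.P1_deriv[OF swap, unfolded swap_defs]
lemmas z2_nonneg = clamped_solution.z1_nonneg[OF swap]
lemmas f2_lim0 = clamped_solution.f1_lim0[OF swap, unfolded swap_defs]
lemmas P2_lim0 = clamped_solution.P1_lim0[OF swap, unfolded swap_defs]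
lemmas P2_pos = clamped_solution.P1_pos[OF swap, unfolded swap_defs]
lemmas z2_less_near_0 = clamped_solution.z1_less_near_0[OF swap]

lemma clampZ_id: "0 \<le> x \<Longrightarrow> x \<le> Z \<Longrightarrow> clampZ x = x"
  by (simp add: clampZ_def)

text \<open>The first point where the clamp could become active is excluded by the a priori
  bound that the Pohozaev identity gives up to that point.\<close>

lemma clamp_inactive:
  assumes "0 \<le> s" shows "z1 s < Z \<and> z2 s < Z"
proof (rule ccontr)
  assume bad: "\<not> ?thesis"
  define A where "A = {s. 0 \<le> s \<and> (Z \<le> z1 s \<or> Z \<le> z2 s)}"
  have A: "A \<noteq> {}" "bdd_below A" using bad assms by (auto simp: A_def not_less)
  have "A = {0..} \<inter> ({s. Z \<le> z1 s} \<union> {s. Z \<le> z2 s})" by (auto simp: A_def)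
  then have "closed A"
    by (auto intro!: closed_Int closed_Un closed_Collect_le continuous_intros z1_cont z2_cont)
  define S where "S = Inf A"
  have SA: "S \<in> A" unfolding S_def using A \<open>closed A\<close> by (intro closed_contains_Inf)
  have before: "z1 r < Z" "z2 r < Z" if "0 \<le> r" "r < S" for r
    using that cInf_lower[OF _ A(2), of r] by (fastforce simp: A_def S_def not_le)+
  have S: "\<delta> < S" using SA z1_less_near_0[of S] z2_less_near_0[of S] by (force simp: A_def)
  have z: "clampZ (z1 r) = z1 r" "clampZ (z2 r) = z2 r" if "0 < r" "r < S" for r
    using that before[of r] z1_nonneg[of r] z2_nonneg[of r] by (auto intro: clampZ_id)
  have bound: "f1 r \<le> 8 * ((N1+1) + (N2+1))" "f2 r \<le> 8 * ((N1+1) + (N2+1))" if r: "0 < r" "r < S" for r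
  proof -
    have "P1 r + P2 r = 2*(N1+1)*f1 r + 2*(N2+1)*f2 r - (f1 r)\<^sup>2/2 - (f2 r)\<^sup>2/2 + \<tau> * f1 r * f2 r"
    proof (rule pohozaev_identity_on[OF f1_deriv f2_deriv _ _ f1_lim0 f2_lim0 P1_lim0 P2_lim0 r])
      fix x assume x: "0 < x" "x < S"
      show "(P1 has_real_derivative P1 x / (2 * x) * (2 * (N1 + 1) - f1 x + \<tau> * f2 x)) (at x)"
        using P1_deriv[OF x(1)] by (simp add: z[OF x] f1_def f2_def)
      show "(P2 has_real_derivative P2 x / (2 * x) * (2 * (N2 + 1) - f2 x + \<tau> * f1 x)) (at x)"
        using P2_deriv[OF x(1)] by (simp add: z[OF x] f1_def f2_def)
    qed
    then show "f1 r \<le> 8 * ((N1+1) + (N2+1))" "f2 r \<le> 8 * ((N1+1) + (N2+1))"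
      using conic_bound[of "f1 r" "f2 r" "N1+1" "N2+1" \<tau>] P1_pos[OF r(1)] P2_pos[OF r(1)]
        z1_nonneg[of r] z2_nonneg[of r] r N \<tau> by (auto simp: f1_def f2_def)
  qed
  have lim: "(f1 \<longlongrightarrow> f1 S) (at_left S)" "(f2 \<longlongrightarrow> f2 S) (at_left S)"
    using DERIV_isCont[OF f1_deriv[of S]] DERIV_isCont[OF f2_deriv[of S]] S \<delta>
    by (auto simp: isCont_def filterlim_at_split)
  have ev: "eventually (\<lambda>r. 0 < r \<and> r < S) (at_left S)"
    using S \<delta> by (auto simp: eventually_at_left_field intro!: exI[of _ 0])
  have "f1 S \<le> 8 * ((N1+1) + (N2+1))" "f2 S \<le> 8 * ((N1+1) + (N2+1))"
    by (rule tendsto_upperbound[OF lim(1)] tendsto_upperbound[OF lim(2)];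
        use ev bound in \<open>auto elim!: eventually_mono\<close>)+
  moreover have "\<delta> * Z < S * Z" using S Z by simp
  ultimately have "S * z1 S < S * Z" "S * z2 S < S * Z" using \<delta>Z by (auto simp: f1_def f2_def)
  then have "z1 S < Z" "z2 S < Z" using S \<delta> by auto
  then show False using SA by (auto simp: A_def)
qed

lemma clampZ_z1: "0 \<le> s \<Longrightarrow> clampZ (z1 s) = z1 s"
  using clamp_inactive[of s] z1_nonneg[of s] by (auto intro: clampZ_id)

lemma clampZ_z2: "0 \<le> s \<Longrightarrow> clampZ (z2 s) = z2 s"
  using clamp_inactive[of s] z2_nonneg[of s] by (auto intro: clampZ_id)

lemma is_flow: "liouville_flow (N1+1) (N2+1) \<tau> f1 f2 P1 P2"
proof
  fix s :: real assume s: "0 < s"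
  show "(P1 has_real_derivative P1 s / (2 * s) * (2 * (N1 + 1) - f1 s + \<tau> * f2 s)) (at s)"
    using P1_deriv[OF s] s by (simp add: clampZ_z1 clampZ_z2 f1_def f2_def)
  show "(P2 has_real_derivative P2 s / (2 * s) * (2 * (N2 + 1) - f2 s + \<tau> * f1 s)) (at s)"
    using P2_deriv[OF s] s by (simp add: clampZ_z1 clampZ_z2 f1_def f2_def)
qed (use N \<tau> P1_pos P2_pos f1_deriv f2_deriv f1_lim0 f2_lim0 in auto)

text \<open>The factor \<open>exp \<alpha>1\<close> is kept: for the swapped system it makes the
  late component as small as desired on a bounded interval.\<close>

lemma z1_le_exp:
  assumes "0 \<le> s" shows "z1 s \<le> exp (max N1 N2 * s) * exp (Z * s) * exp \<alpha>1"
proof -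
  have "z1 s \<le> 1/2 * (exp (max N1 N2 * s) * exp (\<alpha>1 + \<tau> * Z * s / 2))"
    using op_le[OF z1_cont z2_cont N(1) _ assms(1), of "max N1 N2" \<alpha>1] z1_eq[OF assms(1)] by simp
  also have "\<dots> \<le> exp (max N1 N2 * s) * exp (\<alpha>1 + \<tau> * Z * s / 2)" by simp
  also have "\<tau> * Z * s / 2 \<le> Z * s"
  proof -
    have "\<tau> * (Z * s) \<le> 1 * (Z * s)" using \<tau> Z assms by (intro mult_right_mono) auto
    moreover have "0 \<le> Z * s" using Z assms by simp
    ultimately show ?thesis unfolding mult.assoc by linarith
  qed
  finally show ?thesis by (simp add: exp_add mult_ac)
qed

text \<open>The clamp bounds the potential from below whatever the other component does. For fixed
  \<open>\<alpha>1\<close> this supplies a uniform lower bound \<open>c\<close> for the first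
  bubble.\<close>

lemma f1_1_ge: "exp (\<alpha>1 - Z/2) / 2 * avg (wt N1) 1 \<le> f1 1"
proof -
  have "avg (\<lambda>r. exp (\<alpha>1 - Z/2) * wt N1 r) 1 \<le> avg (\<lambda>r. wt N1 r * exp (pot \<alpha>1 z1 z2 r)) 1"
  proof (rule avg_mono)
    fix r :: real assume r: "0 \<le> r" "r \<le> 1"
    have "\<alpha>1 - Z/2 \<le> \<alpha>1 - Z * r / 2" using r Z by simp
    also have "\<dots> \<le> pot \<alpha>1 z1 z2 r" by (rule pot_bounds(2)[OF z1_cont z2_cont r(1)])
    finally show "exp (\<alpha>1 - Z/2) * wt N1 r \<le> wt N1 r * exp (pot \<alpha>1 z1 z2 r)"
      unfolding mult.commute[of "exp (\<alpha>1 - Z/2)"] using wt_nonneg[of N1 r]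
      by (intro mult_left_mono) auto
  qed (auto intro!: continuous_intros wt_continuous N pot_continuous1 z1_cont z2_cont)
  also have "avg (\<lambda>r. exp (\<alpha>1 - Z/2) * wt N1 r) 1 = exp (\<alpha>1 - Z/2) * avg (wt N1) 1"
    by (simp add: avg_def)
  finally show ?thesis by (simp add: f1_def z1_eq op_def)
qed

end

lemma avg_wt_pos:
  assumes "0 \<le> n" shows "0 < avg (wt n) 1"
proof -
  obtain F where F: "\<And>x. (F has_real_derivative wt n x) (at x)"
    using antiderivative_exists[OF wt_continuous[OF assms]] by blast
  have "continuous_on {0..1} F"
    by (intro continuous_at_imp_continuous_on ballI DERIV_isCont[OF F])
  then have "F 0 < F 1"
    by (intro DERIV_pos_imp_increasing_open[of 0 1 F]) (use F in \<open>force simp: wt_pos_eq\<close>)+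
  then show ?thesis using avg_antiderivative[OF F, of 1] by simp
qed

section \<open>Every point of the arc is attained\<close>

text \<open>With \<open>\<alpha>1 = 0\<close> and \<open>\<alpha>2\<close> very negative the first
  bubble is complete before the second starts, and \<open>late_bubble\<close> applies with
  \<open>K\<close> close to \<open>4 * (N1+1)\<close>. The threshold \<open>L\<close> must serve all
  solutions, which is why the bounds before were made uniform.\<close>

lemma (in clamped_problem) late_flux:
  assumes "0 < \<eta>"
  shows "\<exists>L. \<forall>\<alpha>2 \<delta> z1 z2 b. \<alpha>2 \<le> L \<longrightarrow> clamped_solution N1 N2 \<tau> Z 0 \<alpha>2 \<delta> z1 z2 \<longrightarrow>
    ((\<lambda>s. s * z2 s) \<longlongrightarrow> b) at_top \<longrightarrow> 4 * (N2+1) + 8 * \<tau> * (N1+1) - \<eta> \<le> b"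
proof -
  \<comment> \<open>\<open>c\<close> bounds the first flux at 1 from below, by time \<open>T\<close>
    this flux is within \<open>\<eta>/2\<close> of \<open>4 * (N1+1)\<close>, and \<open>q\<close>
    bounds \<open>exp \<alpha>2\<close> so that the second flux at \<open>T\<close> is at most
    \<open>\<eta>/2\<close>.\<close>
  define c where "c = exp (- Z/2) / 2 * avg (wt N1) 1"
  have c: "0 < c" using avg_wt_pos[OF N(1)] by (simp add: c_def)
  define T where "T = exp (16 * (N1+1) / (c * (\<eta>/2)))"
  define q where "q = \<eta> / 2 / (T * (exp (max N1 N2 * T) * exp (Z * T)))"
  have T: "0 < T" by (simp add: T_def)
  have q: "0 < q" using assms T by (simp add: q_def)
  have "4 * (N2+1) + 8 * \<tau> * (N1+1) - \<eta> \<le> b"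
    if "\<alpha>2 \<le> ln q" and sol: "clamped_solution N1 N2 \<tau> Z 0 \<alpha>2 \<delta> z1 z2"
      and lim: "((\<lambda>s. s * z2 s) \<longlongrightarrow> b) at_top" for \<alpha>2 \<delta> z1 z2 b
  proof -
    interpret S: clamped_solution N1 N2 \<tau> Z 0 \<alpha>2 \<delta> z1 z2 by (rule sol)
    interpret F: liouville_flow "N1+1" "N2+1" \<tau> S.f1 S.f2 S.P1 S.P2 by (rule S.is_flow)
    have "4 * (N1+1) - \<eta>/2 \<le> S.f1 T"
      unfolding T_def by (rule F.f1_reaches_first_bubble[OF c]) (use S.f1_1_ge assms in \<open>auto simp: c_def\<close>)
    moreover have "(S.f2 \<longlongrightarrow> b) at_top" using lim by (simp add: S.f2_def[abs_def])
    ultimately have "4 * (N2+1) + 2 * \<tau> * (4 * (N1+1) - \<eta>/2) - S.f2 T \<le> b"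
      by (intro F.late_bubble T)
    moreover have "S.f2 T \<le> \<eta>/2"
    proof -
      have "z2 T \<le> exp (max N2 N1 * T) * exp (Z * T) * exp \<alpha>2"
        by (rule clamped_solution.z1_le_exp[OF S.swap]) (use T in auto)
      also have "exp \<alpha>2 \<le> q" using that(1) q by (simp add: ln_ge_iff)
      finally have "z2 T \<le> exp (max N1 N2 * T) * exp (Z * T) * q" by (simp add: max.commute)
      then have "T * z2 T \<le> T * (exp (max N1 N2 * T) * exp (Z * T) * q)" using T by (intro mult_left_mono) auto
      also have "\<dots> = \<eta>/2" using T by (simp add: q_def)
      finally show ?thesis by (simp add: S.f2_def)
    qed
    \<comment> \<open>The two losses \<open>\<tau> * \<eta>\<close> and \<open>\<eta>/2\<close> add
      up to at most \<open>\<eta>\<close>.\<close>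
    moreover have "\<tau> * \<eta> \<le> 1/2 * \<eta>" using \<tau> assms by (intro mult_right_mono) auto
    ultimately show ?thesis by (simp add: algebra_simps)
  qed
  then show ?thesis by blast
qed

theorem flow_realizing_arc_point:
  assumes N: "0 \<le> N1" "0 \<le> N2" and \<tau>: "0 < \<tau>" "\<tau> \<le> 1/2"
    and arc: "flux_arc (N1+1) (N2+1) \<tau>" and on: "flux_arc.on_arc (N1+1) (N2+1) \<tau> \<beta>1 \<beta>2"
  obtains Z \<alpha>1 \<alpha>2 \<delta> z1 z2 where "clamped_solution N1 N2 \<tau> Z \<alpha>1 \<alpha>2 \<delta> z1 z2"
    "((\<lambda>s. s * z1 s) \<longlongrightarrow> \<beta>1) at_top" "((\<lambda>s. s * z2 s) \<longlongrightarrow> \<beta>2) at_top"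
proof -
  interpret A: flux_arc "N1+1" "N2+1" \<tau> by (rule arc)
  \<comment> \<open>The product \<open>\<delta> * Z\<close> is fixed to be \<open>M\<close>, one
    more than the a priori bound on the fluxes. Then \<open>\<tau> * Z * \<delta>\<close> does not
    depend on \<open>\<delta>\<close>, and \<open>Z = M / \<delta>\<close> exceeds the exponential
    bound on [0, \<open>\<delta>\<close>] once \<open>\<delta>\<close> is small.\<close>
  define M where "M = 8 * ((N1+1) + (N2+1)) + 1"
  define K where "K = max N1 N2"
  define \<delta> where "\<delta> = min 1 (M * exp (- (K + \<tau> * M / 2)))"
  define Z where "Z = M / \<delta>"
  have M: "0 < M" using N by (simp add: M_def)
  have K: "0 \<le> K" using N by (simp add: K_def)
  have \<delta>: "0 < \<delta>" "\<delta> \<le> 1" "\<delta> \<le> M * exp (- (K + \<tau> * M / 2))" using M by (auto simp: \<delta>_def)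
  have Z: "0 < Z" using M \<delta> by (simp add: Z_def)
  have Z\<delta>: "Z * \<delta> = M" "\<delta> * Z = M" using \<delta> by (auto simp: Z_def)
  have large: "1/2 * (exp (max N1 N2 * \<delta>) * exp (\<tau> * Z * \<delta> / 2)) < Z"
  proof -
    have "exp (K * \<delta>) * exp (\<tau> * Z * \<delta> / 2) = exp (K * \<delta> + \<tau> * M / 2)"
      by (simp add: exp_add[symmetric] mult.assoc Z\<delta>)
    also have "\<dots> \<le> exp (K + \<tau> * M / 2)" using K \<delta> by (auto intro: mult_left_le)
    also have "\<dots> \<le> Z"
      using \<delta> M by (simp add: Z_def pos_le_divide_eq exp_minus field_simps)
    finally show ?thesis using Z by (simp add: K_def)
  qed
  interpret P: clamped_problem N1 N2 \<tau> Z by unfold_locales (use N \<tau> Z in auto)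
  \<comment> \<open>The scaling freedom is used to keep one of the two initial values at 0 and the
    other nonpositive. Large positive l delays the second component, large negative l the
    first.\<close>
  define \<alpha>1 \<alpha>2 :: "real \<Rightarrow> real" where "\<alpha>1 l = min 0 l" and "\<alpha>2 l = min 0 (- l)" for l
  have \<alpha>: "continuous_on UNIV \<alpha>1" "continuous_on UNIV \<alpha>2" "\<alpha>1 l \<le> 0" "\<alpha>2 l \<le> 0" for l
    unfolding \<alpha>1_def \<alpha>2_def by (auto intro!: continuous_intros)
  obtain z1 z2 where zc: "continuous_on UNIV (\<lambda>(s,l). z1 s l)" "continuous_on UNIV (\<lambda>(s,l). z2 s l)"
    and z: "\<And>s l. 0 \<le> s \<Longrightarrow> z1 s l = P.op N1 (\<alpha>1 l) (\<lambda>r. z1 r l) (\<lambda>r. z2 r l) s"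
      "\<And>s l. 0 \<le> s \<Longrightarrow> z2 s l = P.op N2 (\<alpha>2 l) (\<lambda>r. z2 r l) (\<lambda>r. z1 r l) s"
    using P.clamped_solution_exists[OF \<alpha>] by metis
  have sol: "clamped_solution N1 N2 \<tau> Z (\<alpha>1 l) (\<alpha>2 l) \<delta> (\<lambda>s. z1 s l) (\<lambda>s. z2 s l)" for l
  proof
    have c: "continuous_on UNIV (\<lambda>s::real. (s, l))" by (intro continuous_intros)
    show "continuous_on UNIV (\<lambda>s. z1 s l)" "continuous_on UNIV (\<lambda>s. z2 s l)"
      using continuous_on_compose2[OF zc(1) c] continuous_on_compose2[OF zc(2) c] by auto
    show "8 * (N1 + 1 + (N2 + 1)) < \<delta> * Z" by (simp add: Z\<delta> M_def)
  qed (use z \<alpha> \<delta> large in auto)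
  have zc2: "continuous_on UNIV (\<lambda>l. z1 s l)" "continuous_on UNIV (\<lambda>l. z2 s l)" for s
  proof -
    have c: "continuous_on UNIV (\<lambda>l::real. (s, l))" by (intro continuous_intros)
    show "continuous_on UNIV (\<lambda>l. z1 s l)" "continuous_on UNIV (\<lambda>l. z2 s l)"
      using continuous_on_compose2[OF zc(1) c] continuous_on_compose2[OF zc(2) c] by auto
  qed
  have facts: "\<exists>b1 b2. ((\<lambda>s. s * z1 s l) \<longlongrightarrow> b1) at_top \<and> ((\<lambda>s. s * z2 s l) \<longlongrightarrow> b2) at_top \<and>
      A.on_arc b1 b2 \<and> (\<forall>s>0. s * z1 s l < b1 \<and> s * z2 s l < b2)" for l
  proof -
    interpret S: clamped_solution N1 N2 \<tau> Z "\<alpha>1 l" "\<alpha>2 l" \<delta> "\<lambda>s. z1 s l" "\<lambda>s. z2 s l" by (rule sol)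
    interpret F: liouville_flow "N1+1" "N2+1" \<tau> S.f1 S.f2 S.P1 S.P2 by (rule S.is_flow)
    obtain b1 b2 where b: "(S.f1 \<longlongrightarrow> b1) at_top" "(S.f2 \<longlongrightarrow> b2) at_top"
      using F.f1_convergent[OF \<tau>(2)] F.f2_convergent[OF \<tau>(2)] by blast
    have "A.on_arc b1 b2"
      using F.flux_identity[OF b] F.flux1_gt[OF b(1)] F.flux2_gt[OF b(2)] by (simp add: A.on_arc_def)
    then show ?thesis
      using b F.f1_less_limit[OF b(1)] F.f2_less_limit[OF b(2)]
      by (intro exI[of _ b1] exI[of _ b2]) (auto simp: S.f1_def[abs_def] S.f2_def[abs_def])
  qed
  define b1 b2 where "b1 l = Lim at_top (\<lambda>s. s * z1 s l)" and "b2 l = Lim at_top (\<lambda>s. s * z2 s l)" for l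
  have b_facts: "((\<lambda>s. s * z1 s l) \<longlongrightarrow> b1 l) at_top" "((\<lambda>s. s * z2 s l) \<longlongrightarrow> b2 l) at_top"
    "A.on_arc (b1 l) (b2 l)" "\<forall>s>0. s * z1 s l < b1 l \<and> s * z2 s l < b2 l" for l
  proof -
    obtain c1 c2 where c: "((\<lambda>s. s * z1 s l) \<longlongrightarrow> c1) at_top" "((\<lambda>s. s * z2 s l) \<longlongrightarrow> c2) at_top"
      "A.on_arc c1 c2" "\<forall>s>0. s * z1 s l < c1 \<and> s * z2 s l < c2" using facts[of l] by blast
    have eq: "b1 l = c1" "b2 l = c2"
      unfolding b1_def b2_def using c(1,2) by (auto intro!: tendsto_Lim)
    show "((\<lambda>s. s * z1 s l) \<longlongrightarrow> b1 l) at_top" "((\<lambda>s. s * z2 s l) \<longlongrightarrow> b2 l) at_top"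
      "A.on_arc (b1 l) (b2 l)" "\<forall>s>0. s * z1 s l < b1 l \<and> s * z2 s l < b2 l"
      unfolding eq by (fact c)+
  qed
  note b = b_facts(1,2) and b_arc = b_facts(3)
  have b_less: "s * z1 s l < b1 l" "s * z2 s l < b2 l" if "0 < s" for l s
    using b_facts(4)[of l] that by auto
  text \<open>Each flux is a supremum of continuous functions, hence lower semicontinuous; as the arc is a
    decreasing graph, the sets where the first or the second flux is too large separate the parameters.\<close>
  define U where "U = {l. \<beta>1 < b1 l}"
  define V where "V = {l. \<beta>2 < b2 l}"
  have lsc: "(\<beta> < bb l) = (\<exists>s>0. \<beta> < s * zz s l)"
    if lim: "\<And>l. ((\<lambda>s. s * zz s l) \<longlongrightarrow> bb l) at_top" and less: "\<And>l s. 0 < s \<Longrightarrow> s * zz s l < bb l"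
    for bb :: "real \<Rightarrow> real" and zz :: "real \<Rightarrow> real \<Rightarrow> real" and \<beta> l
  proof
    assume "\<beta> < bb l"
    then have "eventually (\<lambda>s. \<beta> < s * zz s l) at_top" by (rule order_tendstoD(1)[OF lim])
    then have "eventually (\<lambda>s. 0 < s \<and> \<beta> < s * zz s l) at_top"
      using eventually_gt_at_top[of 0] by eventually_elim auto
    then show "\<exists>s>0. \<beta> < s * zz s l" by (rule eventually_happens'[rotated]) simp
  next
    assume "\<exists>s>0. \<beta> < s * zz s l" then show "\<beta> < bb l" using less by (meson less_trans)
  qed
  have "U = (\<Union>s\<in>{0<..}. {l. \<beta>1 < s * z1 s l})" using lsc[where bb = b1 and zz = z1, OF b(1) b_less(1)] by (auto simp: U_def)
  then have U: "open U" by (auto intro!: open_UN open_Collect_less continuous_intros zc2)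
  have "V = (\<Union>s\<in>{0<..}. {l. \<beta>2 < s * z2 s l})" using lsc[where bb = b2 and zz = z2, OF b(2) b_less(2)] by (auto simp: V_def)
  then have V: "open V" by (auto intro!: open_UN open_Collect_less continuous_intros zc2)
  have disj: "U \<inter> V = {}"
  proof -
    have "\<not> (\<beta>1 < b1 l \<and> \<beta>2 < b2 l)" for l
      using A.arc_antichain(1)[OF on b_arc[of l]] by linarith
    then show ?thesis by (auto simp: U_def V_def)
  qed
  have "V \<noteq> {}"
  proof -
    \<comment> \<open>Half of the distance from \<open>\<beta>2\<close> to the end of the arc, so a
      flux within \<open>\<eta>\<close> of that end still exceeds \<open>\<beta>2\<close> by at
      least \<open>\<eta>\<close>.\<close>
    define \<eta> where "\<eta> = (4 * (N2+1) + 8 * \<tau> * (N1+1) - \<beta>2) / 2"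
    have \<eta>: "0 < \<eta>" using A.arc_less2[OF on] by (simp add: \<eta>_def)
    obtain L where L: "\<And>a \<delta> y1 y2 b. a \<le> L \<Longrightarrow> clamped_solution N1 N2 \<tau> Z 0 a \<delta> y1 y2 \<Longrightarrow>
        ((\<lambda>s. s * y2 s) \<longlongrightarrow> b) at_top \<Longrightarrow> 4 * (N2+1) + 8 * \<tau> * (N1+1) - \<eta> \<le> b"
      using P.late_flux[OF \<eta>] by blast
    define l where "l = max 0 (- L)"
    have "\<alpha>1 l = 0" "\<alpha>2 l \<le> L" by (auto simp: \<alpha>1_def \<alpha>2_def l_def)
    then have "4 * (N2+1) + 8 * \<tau> * (N1+1) - \<eta> \<le> b2 l" using L[of "\<alpha>2 l", OF _ _ b(2)] sol[of l] by simp
    moreover have "2 * \<eta> = 4 * (N2+1) + 8 * \<tau> * (N1+1) - \<beta>2" by (simp add: \<eta>_def)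
    ultimately have "\<beta>2 < b2 l" using \<eta> by argo
    then have "l \<in> V" by (simp add: V_def)
    then show ?thesis by blast
  qed
  moreover have "U \<noteq> {}"
  proof -
    interpret Q: clamped_problem N2 N1 \<tau> Z by unfold_locales (use N \<tau> Z in auto)
    define \<eta> where "\<eta> = (4 * (N1+1) + 8 * \<tau> * (N2+1) - \<beta>1) / 2"
    have \<eta>: "0 < \<eta>" using A.arc_less1[OF on] by (simp add: \<eta>_def)
    obtain L where L: "\<And>a \<delta> y1 y2 b. a \<le> L \<Longrightarrow> clamped_solution N2 N1 \<tau> Z 0 a \<delta> y1 y2 \<Longrightarrow>
        ((\<lambda>s. s * y2 s) \<longlongrightarrow> b) at_top \<Longrightarrow> 4 * (N1+1) + 8 * \<tau> * (N2+1) - \<eta> \<le> b"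
      using Q.late_flux[OF \<eta>] by blast
    define l where "l = min 0 L"
    have "\<alpha>2 l = 0" "\<alpha>1 l \<le> L" by (auto simp: \<alpha>1_def \<alpha>2_def l_def)
    then have "4 * (N1+1) + 8 * \<tau> * (N2+1) - \<eta> \<le> b1 l"
      using L[of "\<alpha>1 l", OF _ _ b(1)] clamped_solution.swap[OF sol[of l]] by simp
    moreover have "2 * \<eta> = 4 * (N1+1) + 8 * \<tau> * (N2+1) - \<beta>1" by (simp add: \<eta>_def)
    ultimately have "\<beta>1 < b1 l" using \<eta> by argo
    then have "l \<in> U" by (simp add: U_def)
    then show ?thesis by blast
  qed
  ultimately have "\<not> UNIV \<subseteq> U \<union> V"
    using connectedD[OF connected_UNIV U V] disj by auto
  then obtain l where "l \<notin> U" "l \<notin> V" by auto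
  \<comment> \<open>Only inequalities are obtained here; both pairs lie on the arc, and its
    antichain property turns them into equalities.\<close>
  then have "b1 l \<le> \<beta>1" "b2 l \<le> \<beta>2" by (simp_all add: U_def V_def not_less)
  then have "b1 l = \<beta>1" "b2 l = \<beta>2" using A.arc_antichain[OF b_arc on] by auto
  then show thesis using that[OF sol] b by metis
qed

section \<open>Smooth radial test functions\<close>

text \<open>As this class is closed under differentiation, its members are smooth, and no derivative has to be
  iterated explicitly.\<close>

inductive_set Smooth1 :: "(real \<Rightarrow> real) set" where
  Smooth1_const: "(\<lambda>x. c) \<in> Smooth1"
| Smooth1_flat: "(\<lambda>x. if x > 0 then poly p (1/x) * exp (- (1/x)) else 0) \<in> Smooth1"
| Smooth1_add: "f \<in> Smooth1 \<Longrightarrow> g \<in> Smooth1 \<Longrightarrow> (\<lambda>x. f x + g x) \<in> Smooth1"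
| Smooth1_mult: "f \<in> Smooth1 \<Longrightarrow> g \<in> Smooth1 \<Longrightarrow> (\<lambda>x. f x * g x) \<in> Smooth1"
| Smooth1_affine: "f \<in> Smooth1 \<Longrightarrow> (\<lambda>x. f (k * x + d)) \<in> Smooth1"
| Smooth1_antideriv: "f \<in> Smooth1 \<Longrightarrow> (\<And>x. (F has_real_derivative f x) (at x)) \<Longrightarrow> F \<in> Smooth1"
| Smooth1_over: "f \<in> Smooth1 \<Longrightarrow> 0 < m \<Longrightarrow> (\<And>x. x \<le> m \<Longrightarrow> f x = 0) \<Longrightarrow> (\<lambda>x. f x / x) \<in> Smooth1"

lemma Smooth1_cmult: "f \<in> Smooth1 \<Longrightarrow> (\<lambda>x. c * f x) \<in> Smooth1"
  by (intro Smooth1_mult Smooth1_const)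

lemma Smooth1_diff: "f \<in> Smooth1 \<Longrightarrow> g \<in> Smooth1 \<Longrightarrow> (\<lambda>x. f x - g x) \<in> Smooth1"
  using Smooth1_add[OF _ Smooth1_cmult[of g "-1"], of f] by simp

lemma poly_exp_lim:
  "((\<lambda>x. poly p (1/x) * exp (- (1/x))) \<longlongrightarrow> 0) (at_right (0::real))"
proof -
  have "((\<lambda>y. poly p y * exp (- y)) \<longlongrightarrow> 0) at_top"
  proof -
    have "((\<lambda>y. \<Sum>i\<le>degree p. coeff p i * (y ^ i / exp y)) \<longlongrightarrow> (\<Sum>i\<le>degree p. coeff p i * 0)) at_top"
      by (intro tendsto_intros tendsto_power_div_exp_0)
    moreover have "(\<Sum>i\<le>degree p. coeff p i * (y ^ i / exp y)) = poly p y * exp (- y)" for y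
      by (simp add: poly_altdef exp_minus divide_inverse sum_distrib_left sum_distrib_right mult_ac)
    ultimately show ?thesis by simp
  qed
  then have "((\<lambda>y. poly p y * exp (- y)) \<longlongrightarrow> 0) (filtermap inverse (at_right 0))"
    by (simp add: at_top_to_right filtermap_filtermap)
  then show ?thesis by (simp add: filterlim_filtermap inverse_eq_divide)
qed

text \<open>In the variable y = 1/x the derivative is -y^2 d/dy, which maps p(y) exp(-y) to y^2 (p -
  p')(y) exp(-y): the same family, with another polynomial.\<close>

lemma flat_deriv:
  fixes p :: "real poly"
  defines "E \<equiv> \<lambda>p x. if x > 0 then poly p (1/x) * exp (- (1/x)) else (0::real)"
  shows "(E p has_real_derivative E ([:0,0,1:] * (p - pderiv p)) x) (at x)"
proof -
  consider "x > 0" | "x < 0" | "x = 0" by linarith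
  then show ?thesis
  proof cases
    case 1
    have "((\<lambda>x. poly p (1/x) * exp (- (1/x))) has_real_derivative E ([:0,0,1:] * (p - pderiv p)) x) (at x)"
      using 1 unfolding E_def
      by (auto intro!: derivative_eq_intros simp: field_simps power2_eq_square)
    then show ?thesis
      by (rule has_field_derivative_transform_within_open[where S="{0<..}"]) (use 1 in \<open>auto simp: E_def\<close>)
  next
    case 2
    have "((\<lambda>x. 0) has_real_derivative E ([:0,0,1:] * (p - pderiv p)) x) (at x)"
      using 2 by (simp add: E_def)
    then show ?thesis
      by (rule has_field_derivative_transform_within_open[where S="{..<0}"]) (use 2 in \<open>auto simp: E_def\<close>)
  next
    case 3
    have "((\<lambda>h. E p h / h) \<longlongrightarrow> 0) (at 0)"
      unfolding filterlim_at_split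
    proof
      show "((\<lambda>h. E p h / h) \<longlongrightarrow> 0) (at_left 0)"
        by (rule tendsto_eventually) (auto simp: E_def eventually_at_left_field intro!: exI[of _ "-1"])
      \<comment> \<open>Dividing by h multiplies the polynomial in 1/h by its variable, so the
        difference quotient is again a flat function.\<close>
      show "((\<lambda>h. E p h / h) \<longlongrightarrow> 0) (at_right 0)"
        using poly_exp_lim[of "[:0,1:] * p"]
        by (rule Lim_transform_eventually)
          (auto simp: E_def eventually_at_right_field intro!: exI[of _ 1])
    qed
    then show ?thesis using 3 by (simp add: DERIV_def) (simp add: E_def)
  qed
qed

lemma Smooth1_deriv:
  "f \<in> Smooth1 \<Longrightarrow> \<exists>f'\<in>Smooth1. \<forall>x. (f has_real_derivative f' x) (at x)"
proof (induction rule: Smooth1.induct)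
  case (Smooth1_const c)
  then show ?case by (intro bexI[of _ "\<lambda>_. 0"]) (auto intro: Smooth1.intros)
next
  case (Smooth1_flat p)
  show ?case
    by (rule bexI[OF _ Smooth1.Smooth1_flat[of "[:0,0,1:] * (p - pderiv p)"]]) (intro allI flat_deriv)
next
  case (Smooth1_add f g)
  then obtain f' g' where "f' \<in> Smooth1" "g' \<in> Smooth1"
    and d: "\<And>x. (f has_real_derivative f' x) (at x)" "\<And>x. (g has_real_derivative g' x) (at x)" by blast
  then show ?case by (intro bexI[of _ "\<lambda>x. f' x + g' x"]) (auto intro!: Smooth1.Smooth1_add derivative_intros)
next
  case (Smooth1_mult f g)
  then obtain f' g' where "f' \<in> Smooth1" "g' \<in> Smooth1"
    and d: "\<And>x. (f has_real_derivative f' x) (at x)" "\<And>x. (g has_real_derivative g' x) (at x)" by blast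
  then show ?case using Smooth1_mult
    by (intro bexI[of _ "\<lambda>x. f' x * g x + g' x * f x"] allI DERIV_mult Smooth1.Smooth1_add Smooth1.Smooth1_mult) auto
next
  case (Smooth1_affine f k d)
  then obtain f' where "f' \<in> Smooth1" and d: "\<And>x. (f has_real_derivative f' x) (at x)" by blast
  then have "(\<lambda>x. k * f' (k * x + d)) \<in> Smooth1" by (intro Smooth1_cmult Smooth1.Smooth1_affine)
  moreover have "((\<lambda>x. f (k * x + d)) has_real_derivative k * f' (k * x + d)) (at x)" for x
    by (rule DERIV_cong[OF DERIV_chain2[OF d]]) (auto intro!: derivative_eq_intros)
  ultimately show ?case by (intro bexI[of _ "\<lambda>x. k * f' (k * x + d)"]) auto
next
  case (Smooth1_antideriv f F)
  then show ?case by blast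
next
  case (Smooth1_over f m)
  then obtain f' where f': "f' \<in> Smooth1" and d: "\<And>x. (f has_real_derivative f' x) (at x)" by blast
  have z: "f' x = 0" if "x < m" for x
  proof -
    have "(f has_real_derivative 0) (at x)"
      by (rule has_field_derivative_transform_within_open[OF DERIV_const[of 0], where S="{..<m}"])
        (use that Smooth1_over in auto)
    then show ?thesis using d DERIV_unique by blast
  qed
  \<comment> \<open>\<open>f'\<close> has been shown to vanish on the open half-line below
    \<open>m\<close>, while the rule asks for a closed one; hence \<open>m/2\<close>.\<close>
  have "(\<lambda>x. f' x / x) \<in> Smooth1" using z Smooth1_over(2) by (intro Smooth1.Smooth1_over[OF f', of "m/2"]) auto
  moreover have "(\<lambda>x. f x / x / x) \<in> Smooth1"
    using Smooth1_over by (intro Smooth1.Smooth1_over[of "\<lambda>x. f x / x" m] Smooth1.Smooth1_over[of f m]) auto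
  ultimately have "(\<lambda>x. f' x / x - f x / x / x) \<in> Smooth1" by (rule Smooth1_diff)
  moreover have "((\<lambda>x. f x / x) has_real_derivative f' x / x - f x / x / x) (at x)" for x
  proof (cases "x = 0")
    case True
    have "((\<lambda>x. f x / x) has_real_derivative 0) (at x)"
      by (rule has_field_derivative_transform_within_open[OF DERIV_const[of 0], where S="{..<m}"])
        (use True Smooth1_over in auto)
    then show ?thesis using True by simp
  next
    case False
    then show ?thesis
      by (auto intro!: derivative_eq_intros d simp: field_simps power2_eq_square)
  qed
  ultimately show ?case by (intro bexI[of _ "\<lambda>x. f' x / x - f x / x / x"]) auto
qed

lemma Smooth1_continuous: "f \<in> Smooth1 \<Longrightarrow> continuous_on A f"
  using Smooth1_deriv[of f] by (meson DERIV_isCont continuous_at_imp_continuous_on)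

lemma Smooth1_derivative_continuous:
  assumes "f \<in> Smooth1" and d: "\<And>x. (f has_real_derivative f' x) (at x)"
  shows "continuous_on A f'"
proof -
  obtain g where g: "g \<in> Smooth1" "\<And>x. (f has_real_derivative g x) (at x)" using Smooth1_deriv[OF assms(1)] by blast
  have "f' = g" by (rule ext) (rule DERIV_unique[OF d g(2)])
  then show ?thesis using Smooth1_continuous[OF g(1)] by simp
qed

lemma Smooth1_antiderivative_exists:
  assumes "f \<in> Smooth1" obtains F where "F \<in> Smooth1" "\<And>x. (F has_real_derivative f x) (at x)"
proof -
  have "isCont f x" for x using Smooth1_continuous[OF assms, of UNIV] by (simp add: continuous_on_eq_continuous_at)
  then have "\<exists>F. \<forall>x::real. -\<infinity> < ereal x \<longrightarrow> ereal x < \<infinity> \<longrightarrow> (F has_vector_derivative f x) (at x)"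
    by (intro einterval_antiderivative) auto
  then obtain F where F: "\<And>x. (F has_real_derivative f x) (at x)"
    by (auto simp: has_real_derivative_iff_has_vector_derivative)
  then show thesis using that Smooth1.Smooth1_antideriv[OF assms F] by blast
qed

lemma smooth_step_exists:
  obtains \<sigma> where "\<sigma> \<in> Smooth1" "\<And>x. x \<le> 0 \<Longrightarrow> \<sigma> x = 0" "\<And>x. 1 \<le> x \<Longrightarrow> \<sigma> x = 1" "\<And>x. 0 \<le> \<sigma> x" "\<And>x. \<sigma> x \<le> 1"
proof -
  define E where "E x = (if x > 0 then poly 1 (1/x) * exp (- (1/x)) else (0::real))" for x
  have E: "E \<in> Smooth1" unfolding E_def by (rule Smooth1_flat)
  \<comment> \<open>A bump supported in [0, 1]; the step is its antiderivative, normalised to rise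
    from 0 to 1.\<close>
  define B where "B x = E x * E (-1 * x + 1)" for x
  have B: "B \<in> Smooth1" unfolding B_def by (intro Smooth1_mult Smooth1_affine E)
  have B_pos: "B x > 0" if "0 < x" "x < 1" for x using that by (simp add: B_def E_def)
  have B_nn: "B x \<ge> 0" for x by (simp add: B_def E_def)
  have B_0: "B x = 0" if "x \<le> 0 \<or> 1 \<le> x" for x using that by (auto simp: B_def E_def)
  obtain F where F: "F \<in> Smooth1" "\<And>x. (F has_real_derivative B x) (at x)"
    using Smooth1_antiderivative_exists[OF B] by blast
  have mono: "F x \<le> F y" if "x \<le> y" for x y
    using DERIV_nonneg_imp_nondecreasing[OF that] F(2) B_nn by blast
  have F0: "F x = F 0" if "x \<le> 0" for x
  proof (cases "x = 0")
    case False
    have "continuous_on {x..0} F" by (rule Smooth1_continuous[OF F(1)])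
    then show ?thesis
      using DERIV_isconst_end[of x 0 F] F(2) B_0 False that by (metis less_eq_real_def)
  qed simp
  have F1: "F x = F 1" if "1 \<le> x" for x
  proof (cases "x = 1")
    case False
    have "continuous_on {1..x} F" by (rule Smooth1_continuous[OF F(1)])
    then show ?thesis
      using DERIV_isconst_end[of 1 x F] F(2) B_0 False that by (metis less_eq_real_def)
  qed simp
  have "F 0 < F 1"
    by (rule DERIV_pos_imp_increasing_open[of 0 1 F])
      (use F(2) B_pos Smooth1_continuous[OF F(1)] in auto)
  define c where "c = 1 / (F 1 - F 0)"
  have c: "c > 0" using \<open>F 0 < F 1\<close> by (simp add: c_def)
  define \<sigma> where "\<sigma> x = c * (F x - F 0)" for x
  have "\<sigma> \<in> Smooth1" unfolding \<sigma>_def by (intro Smooth1_cmult Smooth1_diff F Smooth1_const)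
  moreover have "\<sigma> x = 0" if "x \<le> 0" for x using F0[OF that] by (simp add: \<sigma>_def)
  moreover have "\<sigma> x = 1" if "1 \<le> x" for x using F1[OF that] \<open>F 0 < F 1\<close> by (simp add: \<sigma>_def c_def)
  moreover have s0: "0 \<le> \<sigma> x" for x using mono[of 0 x] F0[of x] c by (cases "x \<le> 0") (auto simp: \<sigma>_def)
  moreover have "\<sigma> x \<le> 1" for x
    using mono[of x 1] F1[of x] \<open>F 0 < F 1\<close> by (cases "x \<le> 1") (auto simp: \<sigma>_def c_def field_simps)
  ultimately show thesis using that by blast
qed

section \<open>Smooth radial functions on the plane and their Laplacian\<close>

inductive_set Smooth_R2 :: "(R2 \<Rightarrow> real) set" where
  Smooth_R2_radial: "g \<in> Smooth1 \<Longrightarrow> (\<lambda>x. g (x \<bullet> x)) \<in> Smooth_R2"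
| Smooth_R2_const: "(\<lambda>x. c) \<in> Smooth_R2"
| Smooth_R2_lin: "(\<lambda>x. x \<bullet> w) \<in> Smooth_R2"
| Smooth_R2_add: "f \<in> Smooth_R2 \<Longrightarrow> g \<in> Smooth_R2 \<Longrightarrow> (\<lambda>x. f x + g x) \<in> Smooth_R2"
| Smooth_R2_mult: "f \<in> Smooth_R2 \<Longrightarrow> g \<in> Smooth_R2 \<Longrightarrow> (\<lambda>x. f x * g x) \<in> Smooth_R2"

lemma radial_has_derivative:
  assumes "(g has_real_derivative d) (at (x \<bullet> x))"
  shows "((\<lambda>x::R2. g (x \<bullet> x)) has_derivative (\<lambda>h. 2 * d * (x \<bullet> h))) (at x)"
proof -
  have "((\<lambda>x::R2. x \<bullet> x) has_derivative (\<lambda>h. 2 * (x \<bullet> h))) (at x)"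
    by (auto intro!: derivative_eq_intros simp: inner_commute)
  from has_derivative_compose[OF this assms[unfolded has_field_derivative_def]]
  show ?thesis by (simp add: mult_ac)
qed

lemma dirderiv_eq: "(f has_derivative f') (at x) \<Longrightarrow> dirderiv f v x = f' v"
  using frechet_derivative_at[of f f' x] by (simp add: dirderiv_def)

text \<open>The derivative of g(|x|^2) along w is 2 g'(|x|^2) times the linear form given by w; with
  linear forms, sums and products included, the class is closed under directional derivatives of
  every order.\<close>

lemma Smooth_R2_deriv:
  "f \<in> Smooth_R2 \<Longrightarrow> (\<forall>x. f differentiable (at x)) \<and> dirderiv f w \<in> Smooth_R2"
proof (induction rule: Smooth_R2.induct)
  case (Smooth_R2_radial g)
  obtain g' where g': "g' \<in> Smooth1" "\<And>x. (g has_real_derivative g' x) (at x)"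
    using Smooth1_deriv[OF Smooth_R2_radial] by blast
  note d = radial_has_derivative[OF g'(2)]
  have "dirderiv (\<lambda>x. g (x \<bullet> x)) w = (\<lambda>x. (2 * g' (x \<bullet> x)) * (x \<bullet> w))"
    using dirderiv_eq[OF d] by (auto simp: fun_eq_iff)
  moreover have "(\<lambda>x::R2. (2 * g' (x \<bullet> x)) * (x \<bullet> w)) \<in> Smooth_R2"
    by (intro Smooth_R2.intros g')
  ultimately show ?case using d by (auto simp: differentiable_def)
next
  case (Smooth_R2_const c)
  have d: "((\<lambda>x::R2. c) has_derivative (\<lambda>h. 0)) (at x)" for x by (rule has_derivative_const)
  have "dirderiv (\<lambda>x. c) w = (\<lambda>x. 0)" using dirderiv_eq[OF d] by (auto simp: fun_eq_iff)
  then show ?case using Smooth_R2.Smooth_R2_const d by (auto simp: differentiable_def)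
next
  case (Smooth_R2_lin w')
  have d: "((\<lambda>x::R2. x \<bullet> w') has_derivative (\<lambda>h. h \<bullet> w')) (at x)" for x by (auto intro!: derivative_eq_intros)
  have "dirderiv (\<lambda>x. x \<bullet> w') w = (\<lambda>x. w \<bullet> w')" using dirderiv_eq[OF d] by (auto simp: fun_eq_iff)
  then show ?case using Smooth_R2.Smooth_R2_const d by (auto simp: differentiable_def)
next
  case (Smooth_R2_add f g)
  then have df: "(f has_derivative frechet_derivative f (at x)) (at x)" and
    dg: "(g has_derivative frechet_derivative g (at x)) (at x)" for x
    by (auto simp: frechet_derivative_works)
  note d = has_derivative_add[OF df dg]
  have "dirderiv (\<lambda>x. f x + g x) w = (\<lambda>x. dirderiv f w x + dirderiv g w x)"
    using dirderiv_eq[OF d] by (auto simp: fun_eq_iff dirderiv_def)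
  then show ?case using Smooth_R2.Smooth_R2_add[of "dirderiv f w" "dirderiv g w"] Smooth_R2_add d by (auto simp: differentiable_def)
next
  case (Smooth_R2_mult f g)
  then have df: "(f has_derivative frechet_derivative f (at x)) (at x)" and
    dg: "(g has_derivative frechet_derivative g (at x)) (at x)" for x
    by (auto simp: frechet_derivative_works)
  note d = has_derivative_mult[OF df dg]
  have "dirderiv (\<lambda>x. f x * g x) w = (\<lambda>x. f x * dirderiv g w x + dirderiv f w x * g x)"
    using dirderiv_eq[OF d] by (auto simp: fun_eq_iff dirderiv_def)
  moreover have "(\<lambda>x. f x * dirderiv g w x + dirderiv f w x * g x) \<in> Smooth_R2"
    using Smooth_R2_mult by (intro Smooth_R2.Smooth_R2_add Smooth_R2.Smooth_R2_mult) auto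
  ultimately show ?case using d unfolding differentiable_def by auto
qed

lemma Smooth_R2_iter: "f \<in> Smooth_R2 \<Longrightarrow> iter_dirderiv ws f \<in> Smooth_R2"
  by (induction ws) (use Smooth_R2_deriv in \<open>auto simp: iter_dirderiv_def\<close>)

lemma radial_test_function:
  assumes "g \<in> Smooth1" and z: "\<And>s. K < s \<Longrightarrow> g s = 0"
  shows "test_function (\<lambda>x. g (x \<bullet> x))"
proof -
  have "smooth (\<lambda>x. g (x \<bullet> x))"
    using Smooth_R2_deriv[OF Smooth_R2_iter[OF Smooth_R2_radial[OF assms(1)]]] by (simp add: smooth_def)
  moreover have "{x::R2. g (x \<bullet> x) \<noteq> 0} \<subseteq> cball 0 (sqrt K)"
    using z by (auto simp: norm_eq_sqrt_inner not_less[symmetric])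
  then have "bounded {x::R2. g (x \<bullet> x) \<noteq> 0}" using bounded_cball bounded_subset by blast
  ultimately show ?thesis by (simp add: test_function_def compact_closure)
qed

text \<open>The right-hand side is 4 (s g'(s))' at s = |x|^2, so prescribing s g' prescribes the
  Laplacian up to a derivative.\<close>

lemma radial_laplacian:
  assumes d: "\<And>s. (g has_real_derivative g' s) (at s)" "\<And>s. (g' has_real_derivative g'' s) (at s)"
  shows "laplacian (\<lambda>x. g (x \<bullet> x)) x = 4 * (g' (x \<bullet> x) + (x \<bullet> x) * g'' (x \<bullet> x))"
proof -
  have 1: "dirderiv (\<lambda>x. g (x \<bullet> x)) w = (\<lambda>x. 2 * g' (x \<bullet> x) * (x \<bullet> w))" for w
    using dirderiv_eq[OF radial_has_derivative[OF d(1)]] by (auto simp: fun_eq_iff)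
  have 2: "dirderiv (\<lambda>x. 2 * g' (x \<bullet> x) * (x \<bullet> w)) w x = 2 * g' (x \<bullet> x) * (w \<bullet> w) + 4 * g'' (x \<bullet> x) * (x \<bullet> w)\<^sup>2" for w
  proof -
    have "((\<lambda>x. 2 * g' (x \<bullet> x) * (x \<bullet> w)) has_derivative
      (\<lambda>h. 2 * g' (x \<bullet> x) * (h \<bullet> w) + 2 * (2 * g'' (x \<bullet> x) * (x \<bullet> h)) * (x \<bullet> w))) (at x)"
      by (rule derivative_eq_intros radial_has_derivative d refl | simp)+
    from dirderiv_eq[OF this, of w] show ?thesis by (simp add: power2_eq_square)
  qed
  have "(\<Sum>i\<in>UNIV. (x \<bullet> axis i 1)\<^sup>2) = x \<bullet> x"
    by (simp only: inner_axis inner_vec_def[of x x]) (simp add: power2_eq_square)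
  then show ?thesis
    unfolding laplacian_def 1 2
    by (simp add: sum.distrib inner_axis_axis sum_distrib_left[symmetric] algebra_simps)
qed

section \<open>Integrals of radial functions\<close>

text \<open>The disc |x|^2 <= a has area \<pi> a, so the push-forward of planar Lebesgue measure
  under |x|^2 is \<pi> ds on the positive half-line; agreement on the rays up to a determines
  it.\<close>

lemma distr_norm_squared:
  "distr lborel borel (\<lambda>x::R2. x \<bullet> x) = density lborel (\<lambda>s. ennreal (pi * indicator {0<..} s))" (is "?M = ?N")
proof (rule measure_eqI_generator_eq_countable)
  let ?E = "range (\<lambda>a::real. {..a})"
  show "Int_stable ?E" by (auto simp: Int_stable_def)
  show "?E \<subseteq> Pow UNIV" by auto
  show "sets ?M = sigma_sets UNIV ?E" "sets ?N = sigma_sets UNIV ?E"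
    by (simp_all add: borel_eq_atMost)
  have M: "emeasure ?M {..a} = ennreal (pi * max 0 a)" for a
  proof -
    have "emeasure ?M {..a} = emeasure lborel {x::R2. x \<bullet> x \<le> a}"
      by (subst emeasure_distr) (auto simp: vimage_def)
    also have "\<dots> = ennreal (pi * max 0 a)"
    proof (cases "a \<ge> 0")
      case True
      have "{x::R2. x \<bullet> x \<le> a} = cball 0 (sqrt a)"
        using True by (auto simp: norm_eq_sqrt_inner)
      then show ?thesis using True by (simp add: emeasure_cball unit_ball_vol_2)
    next
      case False
      have "\<not> x \<bullet> x \<le> a" for x :: R2 using False inner_ge_zero[of x] by linarith
      then show ?thesis using False by simp
    qed
    finally show ?thesis .
  qed
  have N: "emeasure ?N {..a} = ennreal (pi * max 0 a)" for a
  proof -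
    have "emeasure ?N {..a} = (\<integral>\<^sup>+s. ennreal pi * indicator {0<..a} s \<partial>lborel)"
      by (subst emeasure_density) (auto intro!: nn_integral_cong simp: indicator_def)
    also have "\<dots> = ennreal pi * emeasure lborel {0<..a}"
      by (subst nn_integral_cmult_indicator) auto
    also have "\<dots> = ennreal (pi * max 0 a)"
      by (cases "0 \<le> a") (auto simp: ennreal_mult)
    finally show ?thesis .
  qed
  show "emeasure ?M X = emeasure ?N X" if "X \<in> ?E" for X
    using that M N by auto
  show "range (\<lambda>n::nat. {..real n}) \<subseteq> ?E" "countable (range (\<lambda>n::nat. {..real n}))" by auto
  show "(\<Union>(range (\<lambda>n::nat. {..real n}))) = UNIV"
    using real_arch_simple by auto
  show "emeasure ?M a \<noteq> \<infinity>" if "a \<in> range (\<lambda>n::nat. {..real n})" for a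
    using that M by auto
qed

lemma radial_integrable_iff:
  fixes g :: "real \<Rightarrow> real"
  assumes [measurable]: "g \<in> borel_measurable borel"
  shows "integrable lborel (\<lambda>x::R2. g (x \<bullet> x)) \<longleftrightarrow> integrable lborel (\<lambda>s. indicator {0<..} s * g s)"
proof -
  have "integrable lborel (\<lambda>x::R2. g (x \<bullet> x)) \<longleftrightarrow> integrable (distr lborel borel (\<lambda>x::R2. x \<bullet> x)) g"
    by (subst integrable_distr_eq) auto
  also have "\<dots> \<longleftrightarrow> integrable lborel (\<lambda>s. pi * (indicator {0<..} s * g s))"
    unfolding distr_norm_squared by (subst integrable_density) (auto simp: mult.assoc)
  finally show ?thesis by simp
qed

lemma radial_integral:
  fixes g :: "real \<Rightarrow> real"
  assumes [measurable]: "g \<in> borel_measurable borel"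
  shows "(\<integral>x. g ((x::R2) \<bullet> x) \<partial>lborel) = pi * (\<integral>s. indicator {0<..} s * g s \<partial>lborel)"
proof -
  have "(\<integral>x. g ((x::R2) \<bullet> x) \<partial>lborel) = integral\<^sup>L (distr lborel borel (\<lambda>x::R2. x \<bullet> x)) g"
    by (subst integral_distr) auto
  also have "\<dots> = (\<integral>s. pi * (indicator {0<..} s * g s) \<partial>lborel)"
    unfolding distr_norm_squared by (subst integral_density) (auto simp: mult.assoc)
  finally show ?thesis by simp
qed

section \<open>Primitives of integrable functions on the half-line\<close>

definition prim :: "(real \<Rightarrow> real) \<Rightarrow> real \<Rightarrow> real" where
  "prim H t = (\<integral>s. indicator {0<..t} s * H s \<partial>lborel)"

context
  fixes H :: "real \<Rightarrow> real"
  assumes [measurable]: "H \<in> borel_measurable borel"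
    and int: "integrable lborel (\<lambda>s. indicator {0<..} s * H s)"
begin

lemma prim_integrable: "integrable lborel (\<lambda>s. indicator {0<..t} s * H s)"
  by (rule Bochner_Integration.integrable_bound[OF int]) (auto simp: indicator_def)

lemma prim_isCont: "isCont (prim H) t"
  unfolding continuous_at_sequentially comp_def prim_def
proof (intro allI impI integral_dominated_convergence[where w = "\<lambda>s. \<bar>indicator {0<..} s * H s\<bar>"])
  fix X :: "nat \<Rightarrow> real" assume X: "X \<longlonglongrightarrow> t"
  have "(\<lambda>n. indicator {0<..X n} s * H s) \<longlonglongrightarrow> indicator {0<..t} s * H s" if ne: "s \<noteq> t" for s
  proof (rule tendsto_eventually)
    consider "s < t" | "s > t" using ne by (auto simp: neq_iff)
    then show "eventually (\<lambda>n. indicator {0<..X n} s * H s = indicator {0<..t} s * H s) sequentially"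
    proof cases
      case 1
      from order_tendstoD(1)[OF X 1] show ?thesis by eventually_elim (use 1 in \<open>auto simp: indicator_def\<close>)
    next
      case 2
      from order_tendstoD(2)[OF X 2] show ?thesis by eventually_elim (use 2 in \<open>auto simp: indicator_def\<close>)
    qed
  qed
  then have "AE s in lborel. s \<noteq> t \<longrightarrow> (\<lambda>n. indicator {0<..X n} s * H s) \<longlonglongrightarrow> indicator {0<..t} s * H s"
    by (intro AE_I2 impI)
  then show "AE s in lborel. (\<lambda>n. indicator {0<..X n} s * H s) \<longlonglongrightarrow> indicator {0<..t} s * H s"
    by (rule AE_mp[OF AE_lborel_singleton[of t]])
  show "AE s in lborel. norm (indicator {0<..X n} s * H s) \<le> \<bar>indicator {0<..} s * H s\<bar>" for n
    by (auto simp: indicator_def)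
qed (use int in auto)

lemma prim_lim0: "(prim H \<longlongrightarrow> 0) (at_right 0)"
proof -
  have "prim H 0 = 0" by (simp add: prim_def)
  moreover have "(prim H \<longlongrightarrow> prim H 0) (at_right 0)"
    using prim_isCont[of 0] unfolding isCont_def by (rule tendsto_within_subset) simp
  ultimately show ?thesis by simp
qed

lemma prim_lim_top: "(prim H \<longlongrightarrow> (\<integral>s. indicator {0<..} s * H s \<partial>lborel)) at_top"
  unfolding prim_def
proof (rule integral_dominated_convergence_at_top[where w = "\<lambda>s. \<bar>indicator {0<..} s * H s\<bar>"])
  show "AE s in lborel. ((\<lambda>t. indicator {0<..t} s * H s) \<longlongrightarrow> indicator {0<..} s * H s) at_top"
  proof (intro AE_I2 tendsto_eventually)
    fix s :: real
    show "eventually (\<lambda>t. indicator {0<..t} s * H s = indicator {0<..} s * H s) at_top"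
      using eventually_ge_at_top[of s] by eventually_elim (auto simp: indicator_def)
  qed
  show "\<forall>\<^sub>F t in at_top. AE s in lborel. norm (indicator {0<..t} s * H s) \<le> \<bar>indicator {0<..} s * H s\<bar>"
    by (auto simp: indicator_def)
qed (use int in auto)

lemma prim_diff:
  assumes "0 < a" "a \<le> b"
  shows "prim H b - prim H a = (\<integral>s. indicator {a..b} s * H s \<partial>lborel)"
proof -
  have "prim H b - prim H a = (\<integral>s. indicator {0<..b} s * H s - indicator {0<..a} s * H s \<partial>lborel)"
    unfolding prim_def by (subst Bochner_Integration.integral_diff) (auto intro: prim_integrable)
  also have "\<dots> = (\<integral>s. indicator {a..b} s * H s \<partial>lborel)"
    by (rule integral_cong_AE, simp, simp, rule AE_mp[OF AE_lborel_singleton[of a]])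
      (use assms in \<open>auto simp: indicator_def intro!: AE_I2\<close>)
  finally show ?thesis .
qed

lemma prim_deriv:
  assumes cont: "continuous_on {0<..} H" and t: "0 < t"
  shows "(prim H has_real_derivative H t) (at t)"
proof -
  define a b where "a = t/2" and "b = 2*t"
  have ab: "0 < a" "a < t" "t < b" using t by (auto simp: a_def b_def)
  have c: "continuous_on {a..b} H" using cont ab by (auto intro: continuous_on_subset)
  have eq: "prim H a + integral {a..x} H = prim H x" if "x \<in> {a<..<b}" for x
  proof -
    have "set_integrable lborel {a..x} H"
      using c that by (intro borel_integrable_atLeastAtMost' continuous_on_subset[OF c]) auto
    then have "(LINT s:{a..x}|lborel. H s) = integral {a..x} H"
      by (rule set_borel_integral_eq_integral(2))
    then show ?thesis using prim_diff[of a x] ab that by (simp add: set_lebesgue_integral_def)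
  qed
  have "((\<lambda>x. integral {a..x} H) has_real_derivative H t) (at t within {a..b})"
    using ab by (intro integral_has_real_derivative c) auto
  then have "((\<lambda>x. integral {a..x} H) has_real_derivative H t) (at t)"
    using ab by (simp add: at_within_Icc_at)
  then have "((\<lambda>x. prim H a + integral {a..x} H) has_real_derivative H t) (at t)"
    by (auto intro!: derivative_eq_intros)
  then show ?thesis
    by (rule has_field_derivative_transform_within_open[where S = "{a<..<b}"]) (use ab eq in auto)
qed

end

text \<open>The positive and negative parts of \<open>g\<close> are densities of two finite measures
  that agree on all rays, hence are equal; uniqueness of densities then gives equal parts almost
  everywhere.\<close>

lemma AE_zero_of_interval_integrals:
  fixes g :: "real \<Rightarrow> real"
  assumes int: "integrable lborel g" and z: "\<And>x. (\<integral>s. indicator {x<..} s * g s \<partial>lborel) = 0"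
  shows "AE s in lborel. g s = 0"
proof -
  have [measurable]: "g \<in> borel_measurable borel" using int by auto
  define M where "M h = density lborel (\<lambda>s. ennreal (max 0 (h s)))" for h :: "real \<Rightarrow> real"
  have em: "emeasure (M h) {x<..} = ennreal (\<integral>s. indicator {x<..} s * max 0 (h s) \<partial>lborel)"
    if h: "integrable lborel h" for h x
  proof -
    have [measurable]: "h \<in> borel_measurable borel" using h by auto
    have i: "integrable lborel (\<lambda>s. indicator {x<..} s * max 0 (h s))"
      by (rule Bochner_Integration.integrable_bound[OF h]) (auto simp: indicator_def)
    have "emeasure (M h) {x<..} = (\<integral>\<^sup>+s. ennreal (indicator {x<..} s * max 0 (h s)) \<partial>lborel)"
      unfolding M_def by (subst emeasure_density) (auto intro!: nn_integral_cong simp: indicator_def)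
    also have "\<dots> = ennreal (\<integral>s. indicator {x<..} s * max 0 (h s) \<partial>lborel)"
      by (rule nn_integral_eq_integral[OF i]) auto
    finally show ?thesis .
  qed
  have int': "integrable lborel (\<lambda>s. - g s)" using int by simp
  have "M g = M (\<lambda>s. - g s)"
  proof (rule measure_eqI_lessThan)
    fix x
    show "emeasure (M g) {x<..} < \<infinity>" unfolding em[OF int] by simp
    have i1: "integrable lborel (\<lambda>s. indicator {x<..} s * max 0 (g s))"
      by (rule Bochner_Integration.integrable_bound[OF int]) (auto simp: indicator_def)
    have i2: "integrable lborel (\<lambda>s. indicator {x<..} s * max 0 (- g s))"
      by (rule Bochner_Integration.integrable_bound[OF int]) (auto simp: indicator_def)
    have "(\<integral>s. indicator {x<..} s * max 0 (g s) \<partial>lborel) - (\<integral>s. indicator {x<..} s * max 0 (- g s) \<partial>lborel)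
      = (\<integral>s. indicator {x<..} s * g s \<partial>lborel)"
      by (subst Bochner_Integration.integral_diff[symmetric, OF i1 i2])
        (auto intro!: Bochner_Integration.integral_cong simp: indicator_def max_def)
    then show "emeasure (M g) {x<..} = emeasure (M (\<lambda>s. - g s)) {x<..}"
      unfolding em[OF int] em[OF int'] using z[of x] by simp
  qed (auto simp: M_def)
  then have "AE s in lborel. ennreal (max 0 (g s)) = ennreal (max 0 (- g s))"
    unfolding M_def by (intro sigma_finite_measure.density_unique[OF sigma_finite_lborel]) auto
  then show ?thesis by eventually_elim (auto simp: max_def split: if_splits)
qed

section \<open>Regular solutions of the flow solve the problem\<close>

lemma integral_translation:
  fixes g :: "R2 \<Rightarrow> real"
  assumes [measurable]: "g \<in> borel_measurable borel"
  shows "(\<integral>x. g (x + c) \<partial>lborel) = (\<integral>x. g x \<partial>lborel)"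
proof -
  have "(\<integral>x. g x \<partial>lborel) = (\<integral>x. g x \<partial>(distr lborel borel ((+) c)))"
    by (simp add: lborel_distr_plus)
  also have "\<dots> = (\<integral>x. g (c + x) \<partial>lborel)" by (subst integral_distr) auto
  finally show ?thesis by (simp add: add.commute)
qed

lemma integrable_bounded_support:
  fixes g :: "R2 \<Rightarrow> real"
  assumes [measurable]: "g \<in> borel_measurable borel"
    and z: "\<And>x. R < norm x \<Longrightarrow> g x = 0" and b: "\<And>x. norm x \<le> R \<Longrightarrow> \<bar>g x\<bar> \<le> B"
  shows "integrable lborel g"
proof (rule Bochner_Integration.integrable_bound)
  have "emeasure lborel (cball 0 R :: R2 set) < \<infinity>"
    by (rule emeasure_bounded_finite) simp
  then show "integrable lborel (\<lambda>x::R2. indicator (cball 0 R) x * B)"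
    by (intro integrable_mult_left integrable_real_indicator) auto
  show "AE x in lborel. norm (g x) \<le> norm (indicator (cball 0 R) x * B)"
    using z b by (intro AE_I2) (force simp: indicator_def not_le)
qed simp

text \<open>By translation invariance the difference quotients of \<open>g\<close> have integral zero.\<close>

lemma integral_directional_derivative_zero:
  fixes g g' :: "R2 \<Rightarrow> real" and e :: R2
  assumes [measurable]: "g \<in> borel_measurable borel" "g' \<in> borel_measurable borel"
    and d: "\<And>x. ((\<lambda>t. g (x + t *\<^sub>R e)) has_real_derivative g' x) (at 0)"
    and z: "\<And>x. R < norm x \<Longrightarrow> g x = 0"
    and bg: "\<And>x. norm x \<le> R \<Longrightarrow> \<bar>g x\<bar> \<le> B" and b: "\<And>x. \<bar>g' x\<bar> \<le> B"
  shows "(\<integral>x. g' x \<partial>lborel) = 0"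
proof -
  define h where "h n = inverse (real (Suc n))" for n
  have h: "0 < h n" "h n \<le> 1" "h \<longlonglongrightarrow> 0" for n
    using LIMSEQ_inverse_real_of_nat unfolding h_def[abs_def] by (auto simp: field_simps)
  have d': "((\<lambda>t. g (x + t *\<^sub>R e)) has_real_derivative g' (x + t *\<^sub>R e)) (at t)" for x t
  proof -
    have "((\<lambda>u. g (x + (u + t) *\<^sub>R e)) has_real_derivative g' (x + t *\<^sub>R e)) (at 0)"
      using d[of "x + t *\<^sub>R e"] by (simp add: algebra_simps)
    then show ?thesis using DERIV_shift[of "\<lambda>t. g (x + t *\<^sub>R e)" "g' (x + t *\<^sub>R e)" 0 t] by simp
  qed
  define D where "D n x = (g (x + h n *\<^sub>R e) - g x) / h n" for n x
  have int: "integrable lborel g" by (rule integrable_bounded_support[OF _ z bg]) auto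
  have int': "integrable lborel (\<lambda>x. g (x + c))" for c
  proof (rule integrable_bounded_support[where R = "R + norm c"])
    fix x :: R2 assume "R + norm c < norm x"
    then have "R < norm (x + c)" using norm_triangle_ineq4[of "x + c" c] by simp
    then show "g (x + c) = 0" by (rule z)
  next
    fix x :: R2 show "\<bar>g (x + c)\<bar> \<le> max B 0" using z[of "x + c"] bg[of "x + c"] by (cases "norm (x + c) \<le> R") auto
  qed simp
  have "(\<lambda>n. \<integral>x. D n x \<partial>lborel) \<longlonglongrightarrow> (\<integral>x. g' x \<partial>lborel)"
  proof (rule integral_dominated_convergence)
    have "emeasure lborel (cball 0 (R + norm e) :: R2 set) < \<infinity>"
      by (rule emeasure_bounded_finite) simp
    then show "integrable lborel (\<lambda>x::R2. indicator (cball 0 (R + norm e)) x * B)"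
      by (intro integrable_mult_left integrable_real_indicator) auto
    show "AE x in lborel. (\<lambda>n. D n x) \<longlonglongrightarrow> g' x"
    proof (intro AE_I2)
      fix x
      have "((\<lambda>t. (g (x + t *\<^sub>R e) - g x) / t) \<longlongrightarrow> g' x) (at 0)"
        using d[of x] by (simp add: DERIV_def)
      moreover have "filterlim h (at 0) sequentially"
        using h by (auto simp: filterlim_at intro!: always_eventually) (metis less_irrefl)
      ultimately show "(\<lambda>n. D n x) \<longlonglongrightarrow> g' x"
        unfolding D_def by (rule filterlim_compose)
    qed
    show "AE x in lborel. norm (D n x) \<le> indicator (cball 0 (R + norm e)) x * B" for n
    proof (intro AE_I2)
      fix x
      show "norm (D n x) \<le> indicator (cball 0 (R + norm e)) x * B"
      proof (cases "norm x \<le> R + norm e")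
        case True
        \<comment> \<open>The mean value theorem bounds the difference quotients by
          \<open>B\<close>; as \<open>h n \<le> 1\<close>, they live in the ball of radius
          \<open>R + norm e\<close>, which gives an integrable majorant.\<close>
        obtain t where "g (x + h n *\<^sub>R e) - g (x + 0 *\<^sub>R e) = (h n - 0) * g' (x + t *\<^sub>R e)"
          using MVT2[of 0 "h n" "\<lambda>t. g (x + t *\<^sub>R e)" "\<lambda>t. g' (x + t *\<^sub>R e)"] d' h(1)[of n] by blast
        then have "D n x = g' (x + t *\<^sub>R e)" using h(1)[of n] by (simp add: D_def)
        then show ?thesis using True b by (simp add: dist_norm)
      next
        case False
        have "norm x \<le> norm (x + h n *\<^sub>R e) + norm (h n *\<^sub>R e)"
          using norm_triangle_ineq4[of "x + h n *\<^sub>R e" "h n *\<^sub>R e"] by simp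
        moreover have "norm (h n *\<^sub>R e) \<le> norm e" using h(1,2)[of n] by (simp add: mult_left_le_one_le)
        ultimately have "R < norm (x + h n *\<^sub>R e)" "R < norm x" using False norm_ge_zero[of e] by linarith+
        then show ?thesis using False z by (simp add: D_def dist_norm)
      qed
    qed
  qed (auto simp: D_def)
  moreover have "(\<integral>x. D n x \<partial>lborel) = 0" for n
    using int int' integral_translation[of g "h n *\<^sub>R e"] by (simp add: D_def)
  ultimately show ?thesis by (simp add: LIMSEQ_const_iff)
qed

lemma smooth_iter_differentiable: "smooth \<phi> \<Longrightarrow> iter_dirderiv ws \<phi> differentiable (at x)"
  by (simp add: smooth_def)

lemma line_derivative:
  assumes "f differentiable (at x)"
  shows "((\<lambda>t. f (x + t *\<^sub>R e)) has_real_derivative dirderiv f e x) (at 0)"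
proof -
  have f: "(f has_derivative frechet_derivative f (at x)) (at (x + 0 *\<^sub>R e))"
    using assms by (simp add: frechet_derivative_works)
  have "((\<lambda>t. x + t *\<^sub>R e) has_derivative (\<lambda>t. t *\<^sub>R e)) (at 0)"
    by (auto intro!: derivative_eq_intros)
  from has_derivative_compose[OF this f]
  have "((\<lambda>t. f (x + t *\<^sub>R e)) has_derivative (\<lambda>t. frechet_derivative f (at x) (t *\<^sub>R e))) (at 0)" .
  moreover have "frechet_derivative f (at x) (t *\<^sub>R e) = dirderiv f e x * t" for t
    using linear_frechet_derivative[OF assms] by (simp add: dirderiv_def linear_cmul)
  ultimately show ?thesis by (simp add: has_field_derivative_def)
qed

lemma dirderiv_zero_outside:
  assumes "\<And>x. R < norm x \<Longrightarrow> f x = 0" "R < norm x"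
  shows "dirderiv f e x = 0"
proof -
  have "open {x::R2. R < norm x}" by (intro open_Collect_less continuous_intros)
  then have "(f has_derivative (\<lambda>_. 0)) (at x)"
    by (rule has_derivative_transform_within_open[OF has_derivative_const, of _ x "0::real"]) (use assms in auto)
  from dirderiv_eq[OF this] show ?thesis .
qed

text \<open>The second derivative of \<open>w\<close> is written as \<open>k s / s\<close> with
  \<open>k\<close> continuous because it may be unbounded at the origin, as for a weight |x|^(2N)
  with small N. The second derivatives of w(|x|^2) stay bounded nevertheless, and Green's formula
  holds across the origin.\<close>

lemma radial_neg_laplace_eq:
  fixes w w' k :: "real \<Rightarrow> real"
  assumes w': "\<And>s. (w has_real_derivative w' s) (at s)" and c: "continuous_on UNIV w'" "continuous_on UNIV k"
    and k: "\<And>s. 0 < s \<Longrightarrow> (w' has_real_derivative k s / s) (at s)"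
  shows "distr_neg_laplace_eq (\<lambda>x. w (x \<bullet> x)) (\<lambda>x. - 4 * (w' (x \<bullet> x) + k (x \<bullet> x)))"
  unfolding distr_neg_laplace_eq_def
proof (intro allI impI)
  fix \<phi> :: "R2 \<Rightarrow> real" assume \<phi>: "test_function \<phi>"
  obtain R where R: "0 < R" "\<And>x. R < norm x \<Longrightarrow> \<phi> x = 0"
  proof -
    have "bounded (closure {x. \<phi> x \<noteq> 0})" using \<phi> by (simp add: test_function_def compact_imp_bounded)
    then obtain R where "0 < R" "\<And>x. x \<in> closure {x. \<phi> x \<noteq> 0} \<Longrightarrow> norm x \<le> R" by (auto simp: bounded_pos)
    then show thesis using that[of R] closure_subset[of "{x. \<phi> x \<noteq> 0}"] by force
  qed
  have cw: "continuous_on UNIV w" by (intro continuous_at_imp_continuous_on ballI DERIV_isCont[OF w'])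
  let ?v = "\<lambda>x::R2. w (x \<bullet> x)"
  define V where "V e x = 2 * w' (x \<bullet> x) * (x \<bullet> e)" for e x :: R2
  define VV where "VV e x = 2 * w' (x \<bullet> x) * (e \<bullet> e) + 4 * ((x \<bullet> e)\<^sup>2 / (x \<bullet> x)) * k (x \<bullet> x)" for e x :: R2
  have cx: "continuous_on UNIV (\<lambda>x::R2. f (x \<bullet> x))" if "continuous_on UNIV f" for f :: "real \<Rightarrow> real"
    by (rule continuous_on_compose2[OF that]) (auto intro!: continuous_intros)
  have cv: "continuous_on UNIV ?v" by (rule cx[OF cw])
  have cV: "continuous_on UNIV (V e)" for e unfolding V_def by (intro continuous_intros cx c)
  have mVV: "VV e \<in> borel_measurable borel" for e
    unfolding VV_def using borel_measurable_continuous_onI[OF cx[OF c(1)]] borel_measurable_continuous_onI[OF cx[OF c(2)]]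
    by measurable
  have diff: "\<phi> differentiable (at x)" "dirderiv \<phi> e differentiable (at x)" "dirderiv (dirderiv \<phi> e) e differentiable (at x)" for e x
    using smooth_iter_differentiable[of \<phi> "[]" x] smooth_iter_differentiable[of \<phi> "[e]" x]
      smooth_iter_differentiable[of \<phi> "[e, e]" x] \<phi> by (auto simp: test_function_def iter_dirderiv_def)
  have c\<phi>: "continuous_on UNIV \<phi>" "continuous_on UNIV (dirderiv \<phi> e)" "continuous_on UNIV (dirderiv (dirderiv \<phi> e) e)" for e
    using diff by (auto intro!: continuous_at_imp_continuous_on differentiable_imp_continuous_within)
  have z1: "dirderiv \<phi> e x = 0" if "R < norm x" for e x by (rule dirderiv_zero_outside[OF R(2) that])
  have z2: "dirderiv (dirderiv \<phi> e) e x = 0" if "R < norm x" for e x by (rule dirderiv_zero_outside[OF z1 that])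
  have bdd: "\<exists>B. \<forall>x. norm x \<le> R \<longrightarrow> \<bar>f x\<bar> \<le> B" if "continuous_on UNIV f" for f :: "R2 \<Rightarrow> real"
  proof -
    have "compact (f ` cball 0 R)" by (intro compact_continuous_image continuous_on_subset[OF that]) auto
    then obtain B where "\<And>y. y \<in> f ` cball 0 R \<Longrightarrow> \<bar>y\<bar> \<le> B" using compact_imp_bounded by (force simp: bounded_iff)
    then show ?thesis by (intro exI[of _ B]) auto
  qed
  have bVV: "\<exists>B. \<forall>x. norm x \<le> R \<longrightarrow> \<bar>\<phi> x * VV e x\<bar> \<le> B" if e: "norm e = 1" for e
  proof -
    obtain B1 where B1: "\<And>x. norm x \<le> R \<Longrightarrow> \<bar>\<phi> x * (2 * w' (x \<bullet> x))\<bar> \<le> B1"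
      using bdd[OF continuous_on_mult[OF c\<phi>(1) continuous_on_mult[OF continuous_on_const cx[OF c(1)]]]] by blast
    obtain B2 where B2: "\<And>x. norm x \<le> R \<Longrightarrow> \<bar>\<phi> x * (4 * k (x \<bullet> x))\<bar> \<le> B2"
      using bdd[OF continuous_on_mult[OF c\<phi>(1) continuous_on_mult[OF continuous_on_const cx[OF c(2)]]]] by blast
    have "\<bar>\<phi> x * VV e x\<bar> \<le> B1 + B2" if x: "norm x \<le> R" for x
    proof -
      have q: "0 \<le> (x \<bullet> e)\<^sup>2 / (x \<bullet> x)" "(x \<bullet> e)\<^sup>2 / (x \<bullet> x) \<le> 1"
        using Cauchy_Schwarz_ineq[of x e] e by (auto simp: divide_le_eq_1 norm_eq_1)
      have "\<phi> x * VV e x = \<phi> x * (2 * w' (x \<bullet> x)) + (x \<bullet> e)\<^sup>2 / (x \<bullet> x) * (\<phi> x * (4 * k (x \<bullet> x)))"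
        using e by (simp add: VV_def norm_eq_1 algebra_simps)
      moreover have "\<bar>(x \<bullet> e)\<^sup>2 / (x \<bullet> x) * (\<phi> x * (4 * k (x \<bullet> x)))\<bar> \<le> \<bar>\<phi> x * (4 * k (x \<bullet> x))\<bar>"
        unfolding abs_mult[of "(x \<bullet> e)\<^sup>2 / (x \<bullet> x)"] using q by (intro mult_left_le_one_le) auto
      ultimately show ?thesis using B1[OF x] B2[OF x] by linarith
    qed
    then show ?thesis by blast
  qed
  have dv: "((\<lambda>t. ?v (x + t *\<^sub>R e)) has_real_derivative V e x) (at 0)" for x e
  proof -
    have d: "(?v has_derivative (\<lambda>h. 2 * w' (x \<bullet> x) * (x \<bullet> h))) (at x)"
      by (rule radial_has_derivative[OF w'])
    then have "?v differentiable (at x)" by (auto simp: differentiable_def)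
    from line_derivative[OF this] show ?thesis unfolding dirderiv_eq[OF d] V_def .
  qed
  \<comment> \<open>At the origin the quotient in \<open>VV\<close> is 0 by the convention for
    division by zero, and the remaining term is the true derivative of \<open>V e\<close> there;
    this case is computed from the difference quotient.\<close>
  have dV: "((\<lambda>t. V e (x + t *\<^sub>R e)) has_real_derivative VV e x) (at 0)" for x e
  proof (cases "x = 0")
    case True
    have "((\<lambda>t. 2 * w' (t * t * (e \<bullet> e)) * (e \<bullet> e)) \<longlongrightarrow> 2 * w' (0 * 0 * (e \<bullet> e)) * (e \<bullet> e)) (at 0)"
    proof -
      have "continuous_on UNIV (\<lambda>t. 2 * w' (t * t * (e \<bullet> e)) * (e \<bullet> e))"
        by (intro continuous_intros continuous_on_compose2[OF c(1)]) auto
      from this[unfolded continuous_on_def, rule_format, OF UNIV_I, of 0] show ?thesis .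
    qed
    moreover have "\<forall>\<^sub>F t in at 0. 2 * w' (t * t * (e \<bullet> e)) * (e \<bullet> e) = (V e (x + t *\<^sub>R e) - V e (x + 0 *\<^sub>R e)) / t"
      unfolding eventually_at_filter by (intro always_eventually) (auto simp: True V_def mult.assoc)
    ultimately have "((\<lambda>t. (V e (x + t *\<^sub>R e) - V e (x + 0 *\<^sub>R e)) / t) \<longlongrightarrow> 2 * w' (0 * 0 * (e \<bullet> e)) * (e \<bullet> e)) (at 0)"
      by (rule Lim_transform_eventually)
    then show ?thesis by (simp add: DERIV_def True VV_def)
  next
    case False
    then have pos: "0 < x \<bullet> x" by simp
    have d: "(V e has_derivative (\<lambda>h. 2 * w' (x \<bullet> x) * (h \<bullet> e) + 2 * (2 * (k (x \<bullet> x) / (x \<bullet> x)) * (x \<bullet> h)) * (x \<bullet> e))) (at x)"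
      unfolding V_def by (rule derivative_eq_intros radial_has_derivative k pos refl | simp)+
    then have "V e differentiable (at x)" by (auto simp: differentiable_def)
    from line_derivative[OF this, of e] show ?thesis
      unfolding dirderiv_eq[OF d] VV_def by (simp add: power2_eq_square mult_ac)
  qed
  have green: "(\<integral>x. ?v x * dirderiv (dirderiv \<phi> e) e x \<partial>lborel) = (\<integral>x. \<phi> x * VV e x \<partial>lborel)"
    "integrable lborel (\<lambda>x. ?v x * dirderiv (dirderiv \<phi> e) e x)" "integrable lborel (\<lambda>x. \<phi> x * VV e x)"
    if e: "norm e = 1" for e
  proof -
    \<comment> \<open>The flux of Green's second identity: it has compact support and its derivative
      along \<open>e\<close> is the difference of the two integrands, so one integration replaces
      two integrations by parts.\<close>
    define g where "g x = ?v x * dirderiv \<phi> e x - \<phi> x * V e x" for x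
    define g' where "g' x = ?v x * dirderiv (dirderiv \<phi> e) e x - \<phi> x * VV e x" for x
    have cg: "continuous_on UNIV g" unfolding g_def by (intro continuous_intros cv cV c\<phi>)
    have mg: "g \<in> borel_measurable borel" by (rule borel_measurable_continuous_onI[OF cg])
    have c1: "continuous_on UNIV (\<lambda>x. ?v x * dirderiv (dirderiv \<phi> e) e x)" by (intro continuous_intros cv c\<phi>)
    have m1: "(\<lambda>x. ?v x * dirderiv (dirderiv \<phi> e) e x) \<in> borel_measurable borel"
      by (rule borel_measurable_continuous_onI[OF c1])
    have m2: "(\<lambda>x. \<phi> x * VV e x) \<in> borel_measurable borel"
      using mVV borel_measurable_continuous_onI[OF c\<phi>(1)] by measurable
    have mg': "g' \<in> borel_measurable borel" unfolding g'_def using m1 m2 by measurable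
    obtain B1 where B1: "\<And>x. norm x \<le> R \<Longrightarrow> \<bar>?v x * dirderiv (dirderiv \<phi> e) e x\<bar> \<le> B1" using bdd[OF c1] by auto
    obtain B2 where B2: "\<And>x. norm x \<le> R \<Longrightarrow> \<bar>\<phi> x * VV e x\<bar> \<le> B2" using bVV[OF e] by auto
    obtain B3 where B3: "\<And>x. norm x \<le> R \<Longrightarrow> \<bar>g x\<bar> \<le> B3" using bdd[OF cg] by auto
    show i1: "integrable lborel (\<lambda>x. ?v x * dirderiv (dirderiv \<phi> e) e x)"
    proof (rule integrable_bounded_support[OF m1 _ B1])
      fix x :: R2 assume x: "R < norm x"
      show "?v x * dirderiv (dirderiv \<phi> e) e x = 0" unfolding z2[OF x] by simp
    qed
    show i2: "integrable lborel (\<lambda>x. \<phi> x * VV e x)"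
    proof (rule integrable_bounded_support[OF m2 _ B2])
      fix x :: R2 assume x: "R < norm x"
      show "\<phi> x * VV e x = 0" unfolding R(2)[OF x] by simp
    qed
    have "(\<integral>x. g' x \<partial>lborel) = 0"
    proof (rule integral_directional_derivative_zero[OF mg mg', where R = R and B = "max B3 (max 0 (B1 + B2))"])
      fix x
      have "((\<lambda>t. g (x + t *\<^sub>R e)) has_real_derivative
        (?v x * dirderiv (dirderiv \<phi> e) e x + V e x * dirderiv \<phi> e x) - (dirderiv \<phi> e x * V e x + VV e x * \<phi> x)) (at 0)"
        unfolding g_def
        using DERIV_diff[OF DERIV_mult[OF dv[of x e] line_derivative[OF diff(2), of e x e]]
            DERIV_mult[OF line_derivative[OF diff(1), of x e] dV[of e x]]]
        by (simp add: algebra_simps)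
      then show "((\<lambda>t. g (x + t *\<^sub>R e)) has_real_derivative g' x) (at 0)"
        by (simp add: g'_def algebra_simps)
      show "R < norm x \<Longrightarrow> g x = 0" by (simp add: g_def z1 R(2))
      show "norm x \<le> R \<Longrightarrow> \<bar>g x\<bar> \<le> max B3 (max 0 (B1 + B2))" using B3[of x] by auto
      show "\<bar>g' x\<bar> \<le> max B3 (max 0 (B1 + B2))"
      proof (cases "norm x \<le> R")
        case True
        then show ?thesis using B1[OF True] B2[OF True] unfolding g'_def by linarith
      next
        case False
        then show ?thesis by (simp add: g'_def z2 R(2))
      qed
    qed
    then show "(\<integral>x. ?v x * dirderiv (dirderiv \<phi> e) e x \<partial>lborel) = (\<integral>x. \<phi> x * VV e x \<partial>lborel)"
      unfolding g'_def using i1 i2 by simp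
  qed
  have "(\<integral>x. ?v x * (- laplacian \<phi> x) \<partial>lborel)
    = - (\<Sum>i\<in>UNIV. \<integral>x. ?v x * dirderiv (dirderiv \<phi> (axis i 1)) (axis i 1) x \<partial>lborel)"
    unfolding laplacian_def using green(2)
    by (simp add: sum_distrib_left integral_sum norm_axis_1)
  also have "\<dots> = - (\<Sum>i\<in>UNIV. \<integral>x. \<phi> x * VV (axis i 1) x \<partial>lborel)"
    by (simp add: green(1) norm_axis_1)
  also have "\<dots> = (\<integral>x. - (\<Sum>i\<in>UNIV. \<phi> x * VV (axis i 1) x) \<partial>lborel)"
    using green(3) by (simp add: integral_sum norm_axis_1)
  also have "\<dots> = (\<integral>x. (- 4 * (w' (x \<bullet> x) + k (x \<bullet> x))) * \<phi> x \<partial>lborel)"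
  proof (rule integral_cong_AE)
    show "(\<lambda>x. - (\<Sum>i\<in>UNIV. \<phi> x * VV (axis i 1) x)) \<in> borel_measurable lborel"
      using mVV borel_measurable_continuous_onI[OF c\<phi>(1)] by measurable
    show "(\<lambda>x. (- 4 * (w' (x \<bullet> x) + k (x \<bullet> x))) * \<phi> x) \<in> borel_measurable lborel"
      using borel_measurable_continuous_onI[OF cx[OF c(1)]] borel_measurable_continuous_onI[OF cx[OF c(2)]]
        borel_measurable_continuous_onI[OF c\<phi>(1)] by measurable
    have sq: "(\<Sum>i\<in>UNIV. (x \<bullet> axis i 1)\<^sup>2) = x \<bullet> x" for x :: R2
      by (simp only: inner_axis inner_vec_def[of x x]) (simp add: power2_eq_square)
    \<comment> \<open>The squares of the coordinates add up to |x|^2 and cancel the denominator; the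
      origin is a null set.\<close>
    have "(\<Sum>i\<in>UNIV. VV (axis i 1) x) = 4 * (w' (x \<bullet> x) + k (x \<bullet> x))" if "x \<noteq> 0" for x
    proof -
      have "(\<Sum>i\<in>UNIV. VV (axis i 1) x) = 2 * (2 * w' (x \<bullet> x)) + 4 * ((\<Sum>i\<in>UNIV. (x \<bullet> axis i 1)\<^sup>2) / (x \<bullet> x)) * k (x \<bullet> x)"
        unfolding VV_def by (simp add: sum.distrib inner_axis_axis sum_distrib_left sum_distrib_right sum_divide_distrib)
      then show ?thesis using that by (simp add: sq)
    qed
    then have "x \<noteq> 0 \<longrightarrow> - (\<Sum>i\<in>UNIV. \<phi> x * VV (axis i 1) x) = (- 4 * (w' (x \<bullet> x) + k (x \<bullet> x))) * \<phi> x" for x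
      by (simp add: sum_distrib_left[symmetric] algebra_simps)
    then show "AE x in lborel. - (\<Sum>i\<in>UNIV. \<phi> x * VV (axis i 1) x) = (- 4 * (w' (x \<bullet> x) + k (x \<bullet> x))) * \<phi> x"
      by (intro AE_mp[OF AE_lborel_singleton[of 0] AE_I2])
  qed
  finally show "(\<integral>x. ?v x * (- laplacian \<phi> x) \<partial>lborel) = (\<integral>x. (- 4 * (w' (x \<bullet> x) + k (x \<bullet> x))) * \<phi> x \<partial>lborel)" .
qed

section \<open>From the flow to a solution in the plane\<close>

lemma norm_powr_double: "norm (x::R2) powr (2 * N) = (x \<bullet> x) powr N"
proof (cases "x = 0")
  case False
  have "norm x powr (2 * N) = (norm x powr 2) powr N" by (rule powr_powr[symmetric])
  also have "norm x powr 2 = x \<bullet> x" using False by (simp add: powr_numeral power2_norm_eq_inner)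
  finally show ?thesis .
qed simp

lemma continuous_locally_integrable:
  assumes "continuous_on UNIV v" shows "locally_integrable v"
  unfolding locally_integrable_def set_integrable_def
  by (intro allI impI borel_integrable_compact) (auto intro: continuous_on_subset[OF assms])

context clamped_solution
begin

lemma P1_over: "0 < s \<Longrightarrow> P1 s / (2 * s) = 1/2 * (wt N1 s * exp (w1 s))"
  by (simp add: P1_def wt_pos_eq)

lemma density1_cont: "continuous_on A (\<lambda>s. wt N1 s * exp (w1 s))"
  by (intro continuous_intros wt_continuous N w1_cont)

text \<open>Convergence of the partial flux is used to prove integrability: for a nonnegative
  density the fundamental theorem on the half-line identifies its integral, possibly infinite a
  priori, with the limit of a primitive. The factor 2 \<pi> combines \<pi> ds with the 1/2 in the
  partial flux.\<close>

lemma has_flux1: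
  assumes lim: "((\<lambda>s. s * z1 s) \<longlongrightarrow> \<beta>) at_top"
  shows "has_bochner_integral lborel (\<lambda>x::R2. wt N1 (x \<bullet> x) * exp (w1 (x \<bullet> x))) (2 * pi * \<beta>)"
proof -
  define F1 where "F1 s = wt N1 s * exp (w1 s)" for s
  have F1c: "continuous_on UNIV F1" unfolding F1_def by (rule density1_cont)
  have [measurable]: "F1 \<in> borel_measurable borel" by (rule borel_measurable_continuous_onI[OF F1c])
  define F where "F s = 1/2 * (s * avg F1 s)" for s
  have F: "(F has_real_derivative 1/2 * F1 s) (at s)" for s
    unfolding F_def by (intro DERIV_cmult avg_deriv F1c)
  have Fz: "F s = s * z1 s" if "0 \<le> s" for s
    unfolding F_def z1_eq[OF that] op_def F1_def w1_def by simp
  have F_lim: "(F \<longlongrightarrow> \<beta>) at_top"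
    using lim by (rule Lim_transform_eventually)
      (rule eventually_mono[OF eventually_ge_at_top[of 0]], simp add: Fz)
  have nn: "0 \<le> F1 s" for s by (simp add: F1_def wt_nonneg)
  have "(\<integral>\<^sup>+s. ennreal (1/2 * F1 s) * indicator {0..} s \<partial>lborel) = \<beta> - F 0"
    by (rule nn_integral_FTC_atLeast[OF _ F _ F_lim]) (use nn in auto)
  also have "F 0 = 0" by (simp add: F_def)
  also have "(\<integral>\<^sup>+s. ennreal (1/2 * F1 s) * indicator {0..} s \<partial>lborel) = (\<integral>\<^sup>+s. ennreal (1/2 * (indicator {0<..} s * F1 s)) \<partial>lborel)"
    by (rule nn_integral_cong_AE, rule AE_mp[OF AE_lborel_singleton[of 0]])
      (auto intro!: AE_I2 simp: indicator_def)
  finally have nni: "(\<integral>\<^sup>+s. ennreal (1/2 * (indicator {0<..} s * F1 s)) \<partial>lborel) = ennreal \<beta>" by simp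
  have "0 \<le> \<beta>"
    by (rule tendsto_lowerbound[OF lim])
      (rule eventually_mono[OF eventually_ge_at_top[of 0]], simp_all add: z1_nonneg)
  with nni have "has_bochner_integral lborel (\<lambda>s. 1/2 * (indicator {0<..} s * F1 s)) \<beta>"
    by (intro has_bochner_integral_nn_integral) (use nn in auto)
  then have "has_bochner_integral lborel (\<lambda>s. 2 * (1/2 * (indicator {0<..} s * F1 s))) (2 * \<beta>)"
    by (rule has_bochner_integral_mult_right)
  then have "integrable lborel (\<lambda>s. indicator {0<..} s * F1 s)" "(\<integral>s. indicator {0<..} s * F1 s \<partial>lborel) = 2 * \<beta>"
    by (auto simp: has_bochner_integral_iff)
  then show ?thesis
    unfolding F1_def[symmetric] has_bochner_integral_iff radial_integrable_iff[OF \<open>F1 \<in> _\<close>] radial_integral[OF \<open>F1 \<in> _\<close>]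
    by simp
qed

lemma neg_laplace1:
  "distr_neg_laplace_eq (\<lambda>x. w1 (x \<bullet> x))
    (\<lambda>x. wt N1 (x \<bullet> x) * exp (w1 (x \<bullet> x)) - \<tau> * (wt N2 (x \<bullet> x) * exp (w2 (x \<bullet> x))))"
proof -
  define w' where "w' s = - (1/2) * (clampZ (z1 s) - \<tau> * clampZ (z2 s))" for s
  \<comment> \<open>This is s times the second derivative of the potential, obtained by
    differentiating \<open>z1 = f1 / s\<close> and \<open>z2 = f2 / s\<close>; in
    \<open>w' + k\<close> the terms in \<open>z1\<close> and \<open>z2\<close> cancel and only the
    densities remain.\<close>
  define k where "k s = - (1/2) * (1/2 * (wt N1 s * exp (w1 s) - \<tau> * (wt N2 s * exp (w2 s))) - (z1 s - \<tau> * z2 s))" for s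
  have "distr_neg_laplace_eq (\<lambda>x. w1 (x \<bullet> x)) (\<lambda>x. - 4 * (w' (x \<bullet> x) + k (x \<bullet> x)))"
  proof (rule radial_neg_laplace_eq)
    show "(w1 has_real_derivative w' s) (at s)" for s unfolding w'_def by (rule w1_deriv)
    show "continuous_on UNIV w'" unfolding w'_def by (intro continuous_intros z1_cont z2_cont)
    show "continuous_on UNIV k"
      unfolding k_def by (intro continuous_intros z1_cont z2_cont density1_cont wt_continuous N w1_cont w2_cont)
    fix s :: real assume s: "0 < s"
    define A B where "A = P1 s / (2 * s)" and "B = P2 s / (2 * s)"
    have "((\<lambda>s. - (1/2) * (f1 s / s - \<tau> * (f2 s / s))) has_real_derivative
        - (1/2) * ((A * s - f1 s * 1) / (s * s) - \<tau> * ((B * s - f2 s * 1) / (s * s)))) (at s)"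
      unfolding A_def B_def using s
      by (intro DERIV_cmult DERIV_diff DERIV_divide f1_deriv f2_deriv DERIV_ident) auto
    moreover have "- (1/2) * ((A * s - f1 s * 1) / (s * s) - \<tau> * ((B * s - f2 s * 1) / (s * s))) = k s / s"
    proof -
      have AB: "A = 1/2 * (wt N1 s * exp (w1 s))" "B = 1/2 * (wt N2 s * exp (w2 s))"
        using P1_over[OF s] s unfolding A_def B_def by (auto simp: P2_def wt_pos_eq)
      have "k s = - (1/2) * (A - \<tau> * B - (z1 s - \<tau> * z2 s))"
        unfolding AB k_def by (simp add: algebra_simps)
      note ks = this
      have q: "(A * s - f1 s * 1) / (s * s) = (A - z1 s) / s" "(B * s - f2 s * 1) / (s * s) = (B - z2 s) / s"
        using s by (simp_all add: f1_def f2_def field_simps)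
      show ?thesis unfolding q ks by (simp add: diff_divide_distrib add_divide_distrib algebra_simps)
    qed
    ultimately have "((\<lambda>s. - (1/2) * (f1 s / s - \<tau> * (f2 s / s))) has_real_derivative k s / s) (at s)"
      by (rule DERIV_cong)
    then show "(w' has_real_derivative k s / s) (at s)"
      by (rule has_field_derivative_transform_within_open[where S = "{0<..}"])
        (use s in \<open>auto simp: w'_def f1_def f2_def clampZ_z1 clampZ_z2\<close>)
  qed
  moreover have "- 4 * (w' (x \<bullet> x) + k (x \<bullet> x)) = wt N1 (x \<bullet> x) * exp (w1 (x \<bullet> x)) - \<tau> * (wt N2 (x \<bullet> x) * exp (w2 (x \<bullet> x)))" for x :: R2
    by (simp add: w'_def k_def clampZ_z1 clampZ_z2 algebra_simps)
  ultimately show ?thesis by simp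
qed

lemmas has_flux2 = clamped_solution.has_flux1[OF swap, unfolded swap_defs]
lemmas neg_laplace2 = clamped_solution.neg_laplace1[OF swap, unfolded swap_defs]

lemma radial_continuous:
  "continuous_on UNIV (\<lambda>x::R2. w1 (x \<bullet> x))" "continuous_on UNIV (\<lambda>x::R2. w2 (x \<bullet> x))"
  by (auto intro!: continuous_on_compose2[OF w1_cont[of UNIV]] continuous_on_compose2[OF w2_cont[of UNIV]] continuous_intros)

end

lemma solves_P_of_clamped_solution:
  assumes "clamped_solution N 0 \<tau> Z \<alpha>1 \<alpha>2 \<delta> z1 z2" and "0 < N"
    and lim: "((\<lambda>s. s * z1 s) \<longlongrightarrow> \<beta>1) at_top" "((\<lambda>s. s * z2 s) \<longlongrightarrow> \<beta>2) at_top"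
  shows "\<exists>v1 v2. solves_P N \<tau> v1 v2 \<beta>1 \<beta>2 \<and> radial v1 \<and> radial v2"
proof -
  interpret clamped_solution N 0 \<tau> Z \<alpha>1 \<alpha>2 \<delta> z1 z2 by fact
  define v1 v2 :: "R2 \<Rightarrow> real" where "v1 x = w1 (x \<bullet> x)" and "v2 x = w2 (x \<bullet> x)" for x
  have wt1: "wt N (x \<bullet> x) = norm x powr (2 * N)" for x :: R2
    using \<open>0 < N\<close> by (simp add: wt_def norm_powr_double)
  have wt2: "wt 0 s = 1" for s by (simp add: wt_def)
  have flux1: "has_bochner_integral lborel (\<lambda>x. norm x powr (2 * N) * exp (v1 x)) (2 * pi * \<beta>1)"
    using has_flux1[OF lim(1)] by (simp add: wt1 v1_def)
  have flux2: "has_bochner_integral lborel (\<lambda>x. exp (v2 x)) (2 * pi * \<beta>2)"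
    using has_flux2[OF lim(2)] by (simp add: wt2 v2_def)
  have "solves_P N \<tau> v1 v2 \<beta>1 \<beta>2"
    unfolding solves_P_def
  proof (intro conjI)
    show "locally_integrable v1" "locally_integrable v2"
      using radial_continuous by (auto simp: v1_def[abs_def] v2_def[abs_def] intro: continuous_locally_integrable)
    show "integrable lborel (\<lambda>x. norm x powr (2 * N) * exp (v1 x))" "integrable lborel (\<lambda>x. exp (v2 x))"
      using flux1 flux2 by (auto simp: has_bochner_integral_iff)
    show "\<beta>1 = 1 / (2 * pi) * (\<integral>x. norm x powr (2 * N) * exp (v1 x) \<partial>lborel)" "\<beta>2 = 1 / (2 * pi) * (\<integral>x. exp (v2 x) \<partial>lborel)"
      using flux1 flux2 by (auto simp: has_bochner_integral_iff)
    show "distr_neg_laplace_eq v1 (\<lambda>x. norm x powr (2 * N) * exp (v1 x) - \<tau> * exp (v2 x))"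
      using neg_laplace1 by (simp add: wt1 wt2 v1_def[abs_def] v2_def[abs_def])
    show "distr_neg_laplace_eq v2 (\<lambda>x. exp (v2 x) - \<tau> * norm x powr (2 * N) * exp (v1 x))"
      using neg_laplace2 by (simp add: wt1 wt2 v1_def[abs_def] v2_def[abs_def] mult.assoc)
  qed
  moreover have "radial v1" "radial v2"
    by (auto simp: radial_def v1_def v2_def dot_square_norm)
  ultimately show ?thesis by blast
qed

section \<open>Regularity of radial distributional solutions\<close>

lemma integrable_product:
  fixes p q :: "real \<Rightarrow> real"
  assumes p: "integrable lborel p" and q: "integrable lborel q"
  shows "integrable (lborel \<Otimes>\<^sub>M lborel) (\<lambda>(s, u). p s * q u)"
proof (rule lborel_pair.Fubini_integrable)
  have [measurable]: "p \<in> borel_measurable borel" "q \<in> borel_measurable borel" using p q by auto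
  show "(\<lambda>(s, u). p s * q u) \<in> borel_measurable (lborel \<Otimes>\<^sub>M lborel)" by measurable
  have "integrable lborel (\<lambda>s. \<bar>p s\<bar> * (\<integral>u. \<bar>q u\<bar> \<partial>lborel))" using p by simp
  then show "integrable lborel (\<lambda>s. \<integral>u. norm (case (s, u) of (s, u) \<Rightarrow> p s * q u) \<partial>lborel)"
    by (simp add: abs_mult)
  show "AE s in lborel. integrable lborel (\<lambda>u. case (s, u) of (s, u) \<Rightarrow> p s * q u)"
    using q by auto
qed

lemma integrable_times_continuous:
  fixes w c :: "real \<Rightarrow> real"
  assumes "integrable lborel (\<lambda>s. indicator {m..K} s * w s)" and [measurable]: "w \<in> borel_measurable borel"
    and c: "continuous_on UNIV c"
  shows "integrable lborel (\<lambda>s. indicator {m..K} s * (w s * c s))"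
proof -
  have [measurable]: "c \<in> borel_measurable borel" by (rule borel_measurable_continuous_onI[OF c])
  have "compact (c ` {m..K})" by (intro compact_continuous_image continuous_on_subset[OF c]) auto
  then obtain B where B: "\<And>s. s \<in> {m..K} \<Longrightarrow> \<bar>c s\<bar> \<le> B" using compact_imp_bounded by (force simp: bounded_iff)
  have "integrable lborel (\<lambda>s. B * (indicator {m..K} s * w s))" using assms(1) by simp
  then show ?thesis
  proof (rule Bochner_Integration.integrable_bound)
    show "AE s in lborel. norm (indicator {m..K} s * (w s * c s)) \<le> norm (B * (indicator {m..K} s * w s))"
    proof (intro AE_I2)
      fix s
      show "norm (indicator {m..K} s * (w s * c s)) \<le> norm (B * (indicator {m..K} s * w s))"
      proof (cases "s \<in> {m..K}")
        case True
        have "\<bar>w s\<bar> * \<bar>c s\<bar> \<le> \<bar>w s\<bar> * \<bar>B\<bar>" using B[OF True] by (intro mult_left_mono) auto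
        then show ?thesis using True by (simp add: abs_mult mult.commute)
      qed simp
    qed
  qed simp
qed

section \<open>The lemma of du Bois-Reymond on the half-line\<close>

lemma derivative_zero_where_zero:
  assumes d: "\<And>s. (f has_real_derivative f' s) (at s)" and z: "\<And>s. s \<in> T \<Longrightarrow> f s = 0" and T: "open T" "s \<in> T"
  shows "f' s = (0::real)"
proof -
  have "(f has_real_derivative 0) (at s)"
    by (rule has_field_derivative_transform_within_open[OF DERIV_const[of 0] T]) (use z in auto)
  then show ?thesis using d DERIV_unique by blast
qed

text \<open>\<open>h\<close> need not be integrable near 0 or at infinity, so \<open>h - c\<close>
  is truncated to intervals that exhaust the half-line and countably many null sets are
  united.\<close>

lemma AE_constant_of_interval_integrals:
  fixes h :: "real \<Rightarrow> real"
  assumes [measurable]: "h \<in> borel_measurable borel"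
    and int: "\<And>m K. 0 < m \<Longrightarrow> integrable lborel (\<lambda>s. indicator {m..K} s * h s)"
    and c: "\<And>a b. 0 < a \<Longrightarrow> a < b \<Longrightarrow> (\<integral>s. indicator {a<..b} s * h s \<partial>lborel) = (b - a) * c"
  shows "AE s in lborel. 0 < s \<longrightarrow> h s = c"
proof -
  define g where "g n s = indicator {1 / real (Suc n)<..real (Suc n)} s * (h s - c)" for n s
  have i1: "integrable lborel (\<lambda>s. indicator {a<..b} s * h s)" if "0 < a" for a b
    by (rule Bochner_Integration.integrable_bound[OF int[OF that, of b]]) (auto simp: indicator_def)
  have i2: "integrable lborel (\<lambda>s. indicator {a<..b} s * c)" for a b :: real
  proof -
    have "emeasure lborel {a<..b} < \<infinity>" by (rule emeasure_bounded_finite) simp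
    then show ?thesis by (intro integrable_mult_left integrable_real_indicator) auto
  qed
  have gi: "integrable lborel (g n)" for n
    unfolding g_def right_diff_distrib by (intro Bochner_Integration.integrable_diff i1 i2) auto
  have "AE s in lborel. g n s = 0" for n
  proof (rule AE_zero_of_interval_integrals[OF gi])
    fix x
    define a b where "a = max x (1 / real (Suc n))" and "b = real (Suc n)"
    have a: "0 < a" by (simp add: a_def less_max_iff_disj)
    have "(\<integral>s. indicator {x<..} s * g n s \<partial>lborel) = (\<integral>s. indicator {a<..b} s * h s - indicator {a<..b} s * c \<partial>lborel)"
      unfolding g_def by (intro Bochner_Integration.integral_cong) (auto simp: indicator_def a_def b_def)
    also have "\<dots> = (\<integral>s. indicator {a<..b} s * h s \<partial>lborel) - (\<integral>s. indicator {a<..b} s * c \<partial>lborel)"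
      by (intro Bochner_Integration.integral_diff i1 i2 a)
    also have "\<dots> = 0"
    proof (cases "a < b")
      case True
      then show ?thesis using c[OF a True] by simp
    qed simp
    finally show "(\<integral>s. indicator {x<..} s * g n s \<partial>lborel) = 0" .
  qed
  then have "AE s in lborel. \<forall>n. g n s = 0" by (simp add: AE_all_countable)
  then show ?thesis
  proof eventually_elim
    case (elim s)
    show ?case
    proof
      assume s: "0 < s"
      obtain n where n: "max s (1 / s) < real n" using reals_Archimedean2 by blast
      then have "1 / real (Suc n) < s" "s \<le> real (Suc n)" using s by (auto simp: field_simps)
      then show "h s = c" using elim[rule_format, of n] by (simp add: g_def)
    qed
  qed
qed

text \<open>Test functions whose derivatives converge boundedly to
  \<open>indicator {a<..b} - (b - a) * indicator {1<..2}\<close> show that the mean of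
  \<open>h\<close> over any interval equals its mean over (1, 2]. The subtracted term makes the
  integral of the derivative zero, as compact support requires.\<close>

lemma du_bois_reymond_half_line:
  fixes h :: "real \<Rightarrow> real"
  assumes mh [measurable]: "h \<in> borel_measurable borel"
    and int: "\<And>m K. 0 < m \<Longrightarrow> integrable lborel (\<lambda>s. indicator {m..K} s * h s)"
    and eq: "\<And>\<eta> \<eta>' m K. \<eta> \<in> Smooth1 \<Longrightarrow> 0 < m \<Longrightarrow> (\<And>s. s \<le> m \<Longrightarrow> \<eta> s = 0) \<Longrightarrow> (\<And>s. K \<le> s \<Longrightarrow> \<eta> s = 0) \<Longrightarrow>
      (\<And>s. (\<eta> has_real_derivative \<eta>' s) (at s)) \<Longrightarrow> (\<integral>s. indicator {m..K} s * (h s * \<eta>' s) \<partial>lborel) = 0"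
  shows "\<exists>c. AE s in lborel. 0 < s \<longrightarrow> h s = c"
proof -
  obtain \<sigma> where \<sigma>: "\<sigma> \<in> Smooth1" "\<And>x. x \<le> 0 \<Longrightarrow> \<sigma> x = 0" "\<And>x. 1 \<le> x \<Longrightarrow> \<sigma> x = 1" "\<And>x. 0 \<le> \<sigma> x" "\<And>x. \<sigma> x \<le> 1"
    using smooth_step_exists by blast
  obtain F where F: "F \<in> Smooth1" "\<And>x. (F has_real_derivative \<sigma> x) (at x)"
    using Smooth1_antiderivative_exists[OF \<sigma>(1)] by blast
  have F0: "F x = F 0" if "x \<le> 0" for x
  proof (cases "x = 0")
    case False
    then show ?thesis
      using DERIV_isconst_end[of x 0 F] Smooth1_continuous[OF F(1)] F(2) \<sigma>(2) that by (metis less_eq_real_def)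
  qed simp
  have F1: "F x = F 1 + (x - 1)" if "1 \<le> x" for x
  proof (cases "x = 1")
    case False
    have d: "((\<lambda>y. F y - y) has_real_derivative \<sigma> y - 1) (at y)" for y
      by (intro DERIV_diff F(2) DERIV_ident)
    have "continuous_on {1..x} (\<lambda>y. F y - y)" by (intro continuous_intros Smooth1_continuous[OF F(1)])
    then have "F x - x = F 1 - 1"
      using DERIV_isconst_end[of 1 x "\<lambda>y. F y - y"] d \<sigma>(3) False that
      by (metis diff_self less_eq_real_def)
    then show ?thesis by simp
  qed simp
  \<comment> \<open>A smooth approximation of the positive part of \<open>x - a\<close>. To the
    right of \<open>a + 1\<close> it is affine with an error that depends on \<open>n\<close> only,
    so the errors cancel in differences.\<close>
  define q where "q n a x = 1 / real (Suc n) * (F (real (Suc n) * x + (- real (Suc n) * a)) - F 0)" for n a x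
  have q_Sm: "q n a \<in> Smooth1" for n a
    unfolding q_def by (rule Smooth1_cmult[OF Smooth1_diff[OF Smooth1_affine[OF F(1)] Smooth1_const]])
  have qd: "(q n a has_real_derivative \<sigma> (real (Suc n) * (x - a))) (at x)" for n a x
  proof -
    have "((\<lambda>x. F (real (Suc n) * x + (- real (Suc n) * a))) has_real_derivative
        \<sigma> (real (Suc n) * x + (- real (Suc n) * a)) * real (Suc n)) (at x)"
      by (rule DERIV_chain2[OF F(2)]) (auto intro!: derivative_eq_intros)
    from DERIV_cmult[OF DERIV_diff[OF this DERIV_const[of "F 0"]], of "1 / real (Suc n)"]
    show ?thesis unfolding q_def by (simp add: algebra_simps del: of_nat_Suc)
  qed
  have q0: "q n a x = 0" if "x \<le> a" for n a x
  proof -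
    have "real (Suc n) * x + (- real (Suc n) * a) \<le> 0" using mult_left_mono[OF that, of "real (Suc n)"] by (simp del: of_nat_Suc)
    from F0[OF this] show ?thesis by (simp add: q_def)
  qed
  have q1: "q n a x = x - a + (F 1 - 1 - F 0) / real (Suc n)" if "a + 1 \<le> x" for n a x
  proof -
    have "real (Suc n) * 1 \<le> real (Suc n) * (x - a)" using that by (intro mult_left_mono) auto
    then have "1 \<le> real (Suc n) * x + (- real (Suc n) * a)" by (simp add: algebra_simps del: of_nat_Suc)
    from F1[OF this] show ?thesis by (simp add: q_def field_simps del: of_nat_Suc)
  qed
  define c where "c = (\<integral>s. indicator {1<..2} s * h s \<partial>lborel)"
  have "(\<integral>s. indicator {a<..b} s * h s \<partial>lborel) = (b - a) * c" if a: "0 < a" and ab: "a < b" for a b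
  proof -
    \<comment> \<open>All four break points \<open>a\<close>, \<open>b\<close>, 1, 2 lie between
      \<open>m\<close> and \<open>K - 1\<close>; to the right of \<open>K\<close> the affine parts
      cancel.\<close>
    define m K where "m = min a 1" and "K = max b 2 + 1"
    have m: "0 < m" using a by (simp add: m_def)
    define \<theta> where "\<theta> n x = \<sigma> (real (Suc n) * (x - a)) - \<sigma> (real (Suc n) * (x - b))
        - (b - a) * (\<sigma> (real (Suc n) * (x - 1)) - \<sigma> (real (Suc n) * (x - 2)))" for n x
    define \<kappa> where "\<kappa> x = indicator {a<..b} x - (b - a) * indicator {1<..2} x" for x :: real
    have z: "(\<integral>s. indicator {m..K} s * (h s * \<theta> n s) \<partial>lborel) = 0" for n
    proof (rule eq[OF _ m])
      show "(\<lambda>x. q n a x - q n b x - (b - a) * (q n 1 x - q n 2 x)) \<in> Smooth1"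
        by (rule Smooth1_diff[OF Smooth1_diff[OF q_Sm q_Sm] Smooth1_cmult[OF Smooth1_diff[OF q_Sm q_Sm]]])
      show "((\<lambda>x. q n a x - q n b x - (b - a) * (q n 1 x - q n 2 x)) has_real_derivative \<theta> n x) (at x)" for x
        unfolding \<theta>_def by (intro DERIV_diff DERIV_cmult qd)
      show "q n a x - q n b x - (b - a) * (q n 1 x - q n 2 x) = 0" if "x \<le> m" for x
        using that ab by (simp add: q0 m_def)
      show "q n a x - q n b x - (b - a) * (q n 1 x - q n 2 x) = 0" if "K \<le> x" for x
        using that ab by (simp add: q1 K_def algebra_simps)
    qed
    have lim: "(\<lambda>n. \<sigma> (real (Suc n) * (x - a'))) \<longlonglongrightarrow> indicator {a'<..} x" for x a'
    proof (cases "x \<le> a'")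
      case True
      then have "\<sigma> (real (Suc n) * (x - a')) = 0" for n by (intro \<sigma>(2) mult_nonneg_nonpos) auto
      then show ?thesis using True by simp
    next
      case False
      obtain n0 where "1 / (x - a') < real n0" using reals_Archimedean2 by blast
      then have n0: "1 < real n0 * (x - a')" using False by (simp add: field_simps)
      have "\<sigma> (real (Suc n) * (x - a')) = 1" if "n0 \<le> n" for n
      proof (rule \<sigma>(3))
        have "real n0 * (x - a') \<le> real (Suc n) * (x - a')" using that False by (intro mult_right_mono) auto
        then show "1 \<le> real (Suc n) * (x - a')" using n0 by simp
      qed
      then show ?thesis using False by (intro tendsto_eventually eventually_sequentiallyI[of n0]) auto
    qed
    have "(\<lambda>n. \<integral>s. indicator {m..K} s * (h s * \<theta> n s) \<partial>lborel) \<longlonglongrightarrow> (\<integral>s. indicator {m..K} s * (h s * \<kappa> s) \<partial>lborel)"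
    proof (rule integral_dominated_convergence)
      show "integrable lborel (\<lambda>s. (1 + (b - a)) * \<bar>indicator {m..K} s * h s\<bar>)" using int[OF m] by auto
      have [measurable]: "\<sigma> \<in> borel_measurable borel" by (rule borel_measurable_continuous_onI[OF Smooth1_continuous[OF \<sigma>(1)]])
      show "(\<lambda>s. indicator {m..K} s * (h s * \<theta> n s)) \<in> borel_measurable lborel" for n unfolding \<theta>_def by measurable
      show "(\<lambda>s. indicator {m..K} s * (h s * \<kappa> s)) \<in> borel_measurable lborel" unfolding \<kappa>_def by measurable
      show "AE s in lborel. (\<lambda>n. indicator {m..K} s * (h s * \<theta> n s)) \<longlonglongrightarrow> indicator {m..K} s * (h s * \<kappa> s)"
      proof (intro AE_I2 tendsto_mult tendsto_const)
        fix x
        have "\<kappa> x = indicator {a<..} x - indicator {b<..} x - (b - a) * (indicator {1<..} x - indicator {2<..} x)"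
          using ab by (auto simp: \<kappa>_def indicator_def)
        then show "(\<lambda>n. \<theta> n x) \<longlonglongrightarrow> \<kappa> x" unfolding \<theta>_def by (simp only:) (intro tendsto_intros lim)
      qed
      show "AE s in lborel. norm (indicator {m..K} s * (h s * \<theta> n s)) \<le> (1 + (b - a)) * \<bar>indicator {m..K} s * h s\<bar>" for n
      proof (intro AE_I2)
        fix x
        have 1: "\<bar>\<sigma> u - \<sigma> v\<bar> \<le> 1" for u v using \<sigma>(4,5)[of u] \<sigma>(4,5)[of v] by linarith
        have "\<bar>(b - a) * (\<sigma> (real (Suc n) * (x - 1)) - \<sigma> (real (Suc n) * (x - 2)))\<bar> \<le> (b - a) * 1"
          unfolding abs_mult using ab 1 by (intro mult_mono) auto
        from order_trans[OF abs_triangle_ineq4 add_mono[OF 1 this]]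
        have "\<bar>\<theta> n x\<bar> \<le> 1 + (b - a)" unfolding \<theta>_def by simp
        then have "\<bar>h x\<bar> * \<bar>\<theta> n x\<bar> \<le> \<bar>h x\<bar> * (1 + (b - a))" by (intro mult_left_mono) auto
        then show "norm (indicator {m..K} x * (h x * \<theta> n x)) \<le> (1 + (b - a)) * \<bar>indicator {m..K} x * h x\<bar>"
          by (cases "x \<in> {m..K}") (auto simp: abs_mult mult.commute)
      qed
    qed
    then have "(\<integral>s. indicator {m..K} s * (h s * \<kappa> s) \<partial>lborel) = 0" by (simp add: z LIMSEQ_const_iff)
    also have "(\<integral>s. indicator {m..K} s * (h s * \<kappa> s) \<partial>lborel)
        = (\<integral>s. indicator {a<..b} s * h s - (b - a) * (indicator {1<..2} s * h s) \<partial>lborel)"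
      using ab by (intro Bochner_Integration.integral_cong) (auto simp: indicator_def \<kappa>_def m_def K_def algebra_simps)
    also have "\<dots> = (\<integral>s. indicator {a<..b} s * h s \<partial>lborel) - (b - a) * c"
    proof -
      have i: "integrable lborel (\<lambda>s. indicator {a'<..b'} s * h s)" if "0 < a'" for a' b'
        by (rule Bochner_Integration.integrable_bound[OF int[OF that, of b']]) (auto simp: indicator_def)
      show ?thesis unfolding c_def using i[OF a, of b] i[of 1 2] by simp
    qed
    finally show ?thesis by simp
  qed
  then show ?thesis using AE_constant_of_interval_integrals[OF mh int] by blast
qed

section \<open>The weak equation of a radial solution and its regularity\<close>

lemma integral_against_primitive:
  fixes H \<psi> \<kappa> :: "real \<Rightarrow> real"
  assumes [measurable]: "H \<in> borel_measurable borel"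
    and int: "integrable lborel (\<lambda>s. indicator {0<..} s * H s)"
    and d: "\<And>s. (\<psi> has_real_derivative \<kappa> s) (at s)" and c: "continuous_on UNIV \<kappa>"
    and K: "\<And>s. K \<le> s \<Longrightarrow> \<psi> s = 0" and m: "\<And>s. s < m \<Longrightarrow> \<kappa> s = 0"
  shows "(\<integral>s. indicator {0<..} s * (H s * \<psi> s) \<partial>lborel) = - (\<integral>u. \<kappa> u * prim H u \<partial>lborel)"
proof -
  have K0: "\<kappa> s = 0" if "K < s" for s
    by (rule derivative_zero_where_zero[OF d, where T = "{K<..}"]) (use that K in auto)
  have [measurable]: "\<kappa> \<in> borel_measurable borel" by (rule borel_measurable_continuous_onI[OF c])
  have int\<kappa>: "integrable lborel \<kappa>"
  proof -
    have "integrable lborel (\<lambda>s. indicator {m..K} s *\<^sub>R \<kappa> s)"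
      by (rule borel_integrable_compact) (auto intro: continuous_on_subset[OF c])
    also have "(\<lambda>s. indicator {m..K} s *\<^sub>R \<kappa> s) = \<kappa>"
    proof
      fix s show "indicator {m..K} s *\<^sub>R \<kappa> s = \<kappa> s"
        by (cases "s < m"; cases "K < s") (auto simp: m K0 indicator_def)
    qed
    finally show ?thesis .
  qed
  \<comment> \<open>Integration by parts through Fubini on the region s < u, since \<open>H\<close>
    is merely integrable. Integrating in \<open>u\<close> yields \<open>- \<psi> s\<close>, as
    \<open>\<psi>\<close> vanishes to the right of \<open>K\<close>; integrating in \<open>s\<close>
    yields \<open>prim H u\<close>.\<close>
  define f where "f s u = indicator {0<..} s * H s * (indicator {s<..} u * \<kappa> u)" for s u
  have fint: "integrable (lborel \<Otimes>\<^sub>M lborel) (case_prod f)"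
  proof (rule Bochner_Integration.integrable_bound[OF integrable_product[OF int int\<kappa>]])
    have "case_prod f = (\<lambda>(s, u). indicator {0<..} s * H s * (indicator {p. fst p < snd p} (s, u) * \<kappa> u))"
      by (auto simp: fun_eq_iff f_def indicator_def)
    also have "\<dots> \<in> borel_measurable (lborel \<Otimes>\<^sub>M lborel)" by measurable
    finally show "case_prod f \<in> borel_measurable (lborel \<Otimes>\<^sub>M lborel)" .
  qed (auto simp: f_def indicator_def)
  have inner1: "(\<integral>u. f s u \<partial>lborel) = - (indicator {0<..} s * (H s * \<psi> s))" for s
  proof -
    define L where "L = max s K"
    have "(\<integral>u. indicator {s<..} u * \<kappa> u \<partial>lborel) = (\<integral>u. indicator {s..L} u *\<^sub>R \<kappa> u \<partial>lborel)"
    proof (rule integral_cong_AE)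
      show "AE u in lborel. indicator {s<..} u * \<kappa> u = indicator {s..L} u *\<^sub>R \<kappa> u"
        by (rule AE_mp[OF AE_lborel_singleton[of s]]) (auto intro!: AE_I2 simp: indicator_def K0 L_def)
    qed simp_all
    also have "\<dots> = \<psi> L - \<psi> s"
      by (rule integral_FTC_atLeastAtMost)
        (auto simp: L_def intro!: continuous_on_subset[OF c] has_vector_derivative_at_within[OF d[unfolded has_real_derivative_iff_has_vector_derivative]])
    also have "\<dots> = - \<psi> s" by (simp add: K L_def)
    finally have "(\<integral>u. indicator {s<..} u * \<kappa> u \<partial>lborel) = - \<psi> s" .
    then show ?thesis by (simp add: f_def)
  qed
  have inner2: "(\<integral>s. f s u \<partial>lborel) = \<kappa> u * prim H u" for u
  proof -
    have "(\<integral>s. f s u \<partial>lborel) = (\<integral>s. \<kappa> u * (indicator {0<..u} s * H s) \<partial>lborel)"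
    proof (rule integral_cong_AE)
      have "(\<lambda>s. f s u) = (\<lambda>s. indicator {0<..} s * H s * (indicator {..<u} s * \<kappa> u))"
        by (auto simp: f_def fun_eq_iff indicator_def)
      then show "(\<lambda>s. f s u) \<in> borel_measurable lborel" by simp
      show "AE s in lborel. f s u = \<kappa> u * (indicator {0<..u} s * H s)"
        by (rule AE_mp[OF AE_lborel_singleton[of u]]) (auto intro!: AE_I2 simp: indicator_def f_def)
    qed simp
    then show ?thesis by (simp add: prim_def)
  qed
  have "(\<integral>u. (\<integral>s. f s u \<partial>lborel) \<partial>lborel) = (\<integral>s. (\<integral>u. f s u \<partial>lborel) \<partial>lborel)"
    by (rule lborel_pair.Fubini_integral[OF fint])
  then show ?thesis unfolding inner1 inner2 by simp
qed

text \<open>Testing with \<open>\<psi>(|x|\<^sup>2)\<close>, where \<open>s \<psi>'(s) = \<eta>(s)\<close>: the Laplacian of the test function is \<open>4 \<eta>'(|x|\<^sup>2)\<close>.\<close>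

lemma weak_radial_equation:
  assumes eq: "distr_neg_laplace_eq (\<lambda>x. w (x \<bullet> x)) (\<lambda>x. H (x \<bullet> x))"
    and [measurable]: "w \<in> borel_measurable borel" "H \<in> borel_measurable borel"
    and int: "integrable lborel (\<lambda>s. indicator {0<..} s * H s)"
    and \<eta>: "\<eta> \<in> Smooth1" "0 < m" "\<And>s. s \<le> m \<Longrightarrow> \<eta> s = 0" "\<And>s. K \<le> s \<Longrightarrow> \<eta> s = 0"
    and d: "\<And>s. (\<eta> has_real_derivative \<eta>' s) (at s)"
  shows "(\<integral>s. indicator {m..K} s * (w s * \<eta>' s) \<partial>lborel) = (\<integral>s. indicator {m..K} s * (prim H s / (4 * s) * \<eta> s) \<partial>lborel)"
proof -
  define \<kappa> where "\<kappa> s = \<eta> s / s" for s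
  have \<kappa>: "\<kappa> \<in> Smooth1" unfolding \<kappa>_def by (rule Smooth1_over[OF \<eta>(1-3)])
  obtain \<kappa>' where \<kappa>': "\<And>s. (\<kappa> has_real_derivative \<kappa>' s) (at s)" using Smooth1_deriv[OF \<kappa>] by blast
  obtain \<Psi> where \<Psi>: "\<Psi> \<in> Smooth1" "\<And>s. (\<Psi> has_real_derivative \<kappa> s) (at s)" using Smooth1_antiderivative_exists[OF \<kappa>] by blast
  \<comment> \<open>Near the origin \<open>\<psi>\<close> is constant but in general not zero, so
    the equation is tested at the origin as well. Therefore \<open>prim H\<close> enters without an
    additive constant: a point mass there is excluded.\<close>
  define \<psi> where "\<psi> s = \<Psi> s - \<Psi> K" for s
  have \<psi>: "\<psi> \<in> Smooth1" unfolding \<psi>_def by (rule Smooth1_diff[OF \<Psi>(1) Smooth1_const])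
  have \<psi>d: "(\<psi> has_real_derivative \<kappa> s) (at s)" for s
    using DERIV_diff[OF \<Psi>(2) DERIV_const[of "\<Psi> K"], of s] by (simp add: \<psi>_def[abs_def])
  have \<psi>0: "\<psi> s = 0" if "K \<le> s" for s
  proof (cases "s = K")
    case False
    have "\<Psi> s = \<Psi> K"
    proof (rule DERIV_isconst_end[of K s \<Psi>])
      show "(\<Psi> has_real_derivative 0) (at x)" if "K < x" "x < s" for x
        using \<Psi>(2)[of x] \<eta>(4)[of x] that by (simp add: \<kappa>_def)
    qed (use False that Smooth1_continuous[OF \<Psi>(1)] in auto)
    then show ?thesis by (simp add: \<psi>_def)
  qed (simp add: \<psi>_def)
  have \<eta>': "\<kappa> s + s * \<kappa>' s = \<eta>' s" for s
  proof -
    have "(\<lambda>s. s * \<kappa> s) = \<eta>" using \<eta>(2,3) by (auto simp: fun_eq_iff \<kappa>_def)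
    moreover have "((\<lambda>s. s * \<kappa> s) has_real_derivative 1 * \<kappa> s + \<kappa>' s * s) (at s)"
      by (intro DERIV_mult DERIV_ident \<kappa>')
    ultimately show ?thesis using DERIV_unique[OF d[of s]] by (simp add: mult.commute)
  qed
  have \<eta>'0: "\<eta>' s = 0" if out: "s \<notin> {m..K}" for s
  proof -
    consider "s < m" | "K < s" using out by fastforce
    then show ?thesis
    proof cases
      case 1 then show ?thesis by (intro derivative_zero_where_zero[OF d, where T = "{..<m}"]) (use \<eta> in auto)
    next
      case 2 then show ?thesis by (intro derivative_zero_where_zero[OF d, where T = "{K<..}"]) (use \<eta> in auto)
    qed
  qed
  have [measurable]: "\<psi> \<in> borel_measurable borel" by (rule borel_measurable_continuous_onI[OF Smooth1_continuous[OF \<psi>]])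
  have [measurable]: "\<eta>' \<in> borel_measurable borel"
    by (rule borel_measurable_continuous_onI[OF Smooth1_derivative_continuous[OF \<eta>(1) d]])
  have "test_function (\<lambda>x. \<psi> (x \<bullet> x))"
    by (rule radial_test_function[OF \<psi>, of K]) (simp add: \<psi>0)
  then have "(\<integral>x. w (x \<bullet> x) * (- laplacian (\<lambda>x. \<psi> (x \<bullet> x)) x) \<partial>lborel) = (\<integral>x. H ((x::R2) \<bullet> x) * \<psi> (x \<bullet> x) \<partial>lborel)"
    using eq by (simp add: distr_neg_laplace_eq_def)
  also have "(\<lambda>x::R2. w (x \<bullet> x) * (- laplacian (\<lambda>x. \<psi> (x \<bullet> x)) x)) = (\<lambda>x. (\<lambda>s. w s * (- 4 * \<eta>' s)) (x \<bullet> x))"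
    by (simp add: radial_laplacian[OF \<psi>d \<kappa>'] \<eta>')
  also have "(\<integral>x. (\<lambda>s. w s * (- 4 * \<eta>' s)) ((x::R2) \<bullet> x) \<partial>lborel) = pi * (\<integral>s. indicator {0<..} s * (w s * (- 4 * \<eta>' s)) \<partial>lborel)"
    by (rule radial_integral) simp
  also have "(\<integral>x. H ((x::R2) \<bullet> x) * \<psi> (x \<bullet> x) \<partial>lborel) = pi * (\<integral>s. indicator {0<..} s * (H s * \<psi> s) \<partial>lborel)"
    by (rule radial_integral) simp
  also have "(\<integral>s. indicator {0<..} s * (H s * \<psi> s) \<partial>lborel) = - (\<integral>u. \<kappa> u * prim H u \<partial>lborel)"
    by (rule integral_against_primitive[OF _ int \<psi>d Smooth1_continuous[OF \<kappa>] \<psi>0, where m = m]) (use \<eta> in \<open>auto simp: \<kappa>_def\<close>)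
  finally have "(\<integral>s. indicator {0<..} s * (w s * (- 4 * \<eta>' s)) \<partial>lborel) = - (\<integral>u. \<kappa> u * prim H u \<partial>lborel)" by simp
  also have "(\<lambda>s. indicator {0<..} s * (w s * (- 4 * \<eta>' s))) = (\<lambda>s. - 4 * (indicator {m..K} s * (w s * \<eta>' s)))"
  proof
    fix s show "indicator {0<..} s * (w s * (- 4 * \<eta>' s)) = - 4 * (indicator {m..K} s * (w s * \<eta>' s))"
      using \<eta>(2) by (cases "s \<in> {m..K}") (auto simp: \<eta>'0)
  qed
  also have "(\<lambda>u. \<kappa> u * prim H u) = (\<lambda>s. 4 * (indicator {m..K} s * (prim H s / (4 * s) * \<eta> s)))"
  proof
    fix s show "\<kappa> s * prim H s = 4 * (indicator {m..K} s * (prim H s / (4 * s) * \<eta> s))"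
      by (cases "s < m"; cases "K < s") (auto simp: \<eta> \<kappa>_def)
  qed
  finally show ?thesis unfolding integral_mult_right_zero by linarith
qed

text \<open>The weak identity says that \<open>w\<close> has distributional derivative
  \<open>- prim H s / (4 * s)\<close> on the half-line, a continuous function. A classical
  antiderivative \<open>W\<close> satisfies the same identity, so \<open>w - W\<close> is constant
  almost everywhere.\<close>

lemma radial_profile_regular:
  assumes eq: "distr_neg_laplace_eq (\<lambda>x. w (x \<bullet> x)) (\<lambda>x. H (x \<bullet> x))"
    and mw [measurable]: "w \<in> borel_measurable borel" and mH [measurable]: "H \<in> borel_measurable borel"
    and intH: "integrable lborel (\<lambda>s. indicator {0<..} s * H s)"
    and intw: "\<And>m K. 0 < m \<Longrightarrow> integrable lborel (\<lambda>s. indicator {m..K} s * w s)"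
  shows "\<exists>W. (\<forall>s>0. (W has_real_derivative - prim H s / (4 * s)) (at s)) \<and> (AE s in lborel. 0 < s \<longrightarrow> w s = W s)"
proof -
  have G: "isCont (prim H) s" for s by (rule prim_isCont[OF mH intH])
  have "isCont (\<lambda>s. - prim H s / (4 * s)) s" if "0 < s" for s
    using G that by (intro continuous_intros) auto
  then have "\<exists>W. \<forall>s::real. 0 < ereal s \<longrightarrow> ereal s < \<infinity> \<longrightarrow> (W has_vector_derivative - prim H s / (4 * s)) (at s)"
    by (intro einterval_antiderivative) (auto simp: zero_ereal_def)
  then obtain W where W: "\<And>s. 0 < s \<Longrightarrow> (W has_real_derivative - prim H s / (4 * s)) (at s)"
    by (auto simp: has_real_derivative_iff_has_vector_derivative zero_ereal_def)
  define h where "h s = w s - indicator {0<..} s * W s" for s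
  have cW: "continuous_on {0<..} W" by (intro continuous_at_imp_continuous_on ballI DERIV_isCont[OF W]) auto
  have mW [measurable]: "(\<lambda>s. indicator {0<..} s * W s) \<in> borel_measurable borel"
    using borel_measurable_continuous_on_indicator[OF _ cW] by simp
  have iW: "integrable lborel (\<lambda>s. indicator {m..K} s * (indicator {0<..} s * W s))" if "0 < m" for m K
  proof -
    have "integrable lborel (\<lambda>s. indicator {m..K} s *\<^sub>R W s)"
      by (rule borel_integrable_compact) (use that in \<open>auto intro!: continuous_on_subset[OF cW]\<close>)
    also have "(\<lambda>s. indicator {m..K} s *\<^sub>R W s) = (\<lambda>s. indicator {m..K} s * (indicator {0<..} s * W s))"
      using that by (auto simp: fun_eq_iff indicator_def)
    finally show ?thesis .
  qed
  have "\<exists>c. AE s in lborel. 0 < s \<longrightarrow> h s = c"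
  proof (rule du_bois_reymond_half_line)
    show "h \<in> borel_measurable borel" unfolding h_def by measurable
    show "integrable lborel (\<lambda>s. indicator {m..K} s * h s)" if "0 < m" for m K
      unfolding h_def right_diff_distrib by (intro Bochner_Integration.integrable_diff intw iW that)
    fix \<eta> \<eta>' :: "real \<Rightarrow> real" and m K :: real
    assume \<eta>: "\<eta> \<in> Smooth1" "0 < m" "\<And>s. s \<le> m \<Longrightarrow> \<eta> s = 0" "\<And>s. K \<le> s \<Longrightarrow> \<eta> s = 0"
      and d: "\<And>s. (\<eta> has_real_derivative \<eta>' s) (at s)"
    have c\<eta>': "continuous_on UNIV \<eta>'" by (rule Smooth1_derivative_continuous[OF \<eta>(1) d])
    let ?I = "\<lambda>f. (\<integral>s. indicator {m..K} s * f s \<partial>lborel)"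
    have i1: "integrable lborel (\<lambda>s. indicator {m..K} s * (w s * \<eta>' s))"
      by (rule integrable_times_continuous[OF intw[OF \<eta>(2)] mw c\<eta>'])
    have i2: "integrable lborel (\<lambda>s. indicator {m..K} s * ((indicator {0<..} s * W s) * \<eta>' s))"
      by (rule integrable_times_continuous[OF iW[OF \<eta>(2)] mW c\<eta>'])
    have ibp: "?I (\<lambda>s. - prim H s / (4 * s) * \<eta> s + \<eta>' s * W s) = 0"
    proof (cases "m \<le> K")
      case True
      have "(\<integral>s. indicator {m..K} s *\<^sub>R (- prim H s / (4 * s) * \<eta> s + \<eta>' s * W s) \<partial>lborel) = W K * \<eta> K - W m * \<eta> m"
      proof (rule integral_FTC_atLeastAtMost[OF True])
        fix x assume x: "m \<le> x" "x \<le> K"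
        have "((\<lambda>s. W s * \<eta> s) has_real_derivative - prim H x / (4 * x) * \<eta> x + \<eta>' x * W x) (at x)"
          using W d x \<eta>(2) by (intro DERIV_mult) auto
        then show "((\<lambda>s. W s * \<eta> s) has_vector_derivative - prim H x / (4 * x) * \<eta> x + \<eta>' x * W x) (at x within {m..K})"
          by (rule has_vector_derivative_at_within[OF iffD1[OF has_real_derivative_iff_has_vector_derivative]])
      next
        have "continuous_on {m..K} (prim H)" by (intro continuous_at_imp_continuous_on ballI G)
        then show "continuous_on {m..K} (\<lambda>s. - prim H s / (4 * s) * \<eta> s + \<eta>' s * W s)"
          using \<eta>(2) by (intro continuous_intros Smooth1_continuous[OF \<eta>(1)] continuous_on_subset[OF c\<eta>'] continuous_on_subset[OF cW]) auto
      qed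
      then show ?thesis using \<eta> by simp
    qed simp
    have cG: "continuous_on {m..K} (\<lambda>s. prim H s / (4 * s) * \<eta> s)"
      using \<eta>(2) by (intro continuous_intros continuous_at_imp_continuous_on[of _ "prim H"] ballI G Smooth1_continuous[OF \<eta>(1)]) auto
    have iG: "integrable lborel (\<lambda>s. indicator {m..K} s * (prim H s / (4 * s) * \<eta> s))"
      using borel_integrable_compact[OF _ cG] by simp
    have "?I (\<lambda>s. - prim H s / (4 * s) * \<eta> s + \<eta>' s * W s)
        = (\<integral>s. indicator {m..K} s * ((indicator {0<..} s * W s) * \<eta>' s) - indicator {m..K} s * (prim H s / (4 * s) * \<eta> s) \<partial>lborel)"
      using \<eta>(2) by (intro Bochner_Integration.integral_cong) (auto simp: indicator_def)
    also have "\<dots> = ?I (\<lambda>s. (indicator {0<..} s * W s) * \<eta>' s) - ?I (\<lambda>s. prim H s / (4 * s) * \<eta> s)"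
      by (rule Bochner_Integration.integral_diff[OF i2 iG])
    finally have "?I (\<lambda>s. (indicator {0<..} s * W s) * \<eta>' s) = ?I (\<lambda>s. prim H s / (4 * s) * \<eta> s)"
      using ibp by simp
    also have "\<dots> = ?I (\<lambda>s. w s * \<eta>' s)"
      by (rule weak_radial_equation[OF eq mw mH intH \<eta> d, symmetric])
    finally have "?I (\<lambda>s. w s * \<eta>' s) - ?I (\<lambda>s. (indicator {0<..} s * W s) * \<eta>' s) = 0" by simp
    then show "?I (\<lambda>s. h s * \<eta>' s) = 0"
      unfolding h_def left_diff_distrib right_diff_distrib[of "indicator {m..K} _"]
      using i1 i2 by (simp add: Bochner_Integration.integral_diff)
  qed
  then obtain c where c: "AE s in lborel. 0 < s \<longrightarrow> h s = c" by blast
  show ?thesis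
  proof (intro exI[of _ "\<lambda>s. W s + c"] conjI allI impI)
    show "((\<lambda>s. W s + c) has_real_derivative - prim H s / (4 * s)) (at s)" if "0 < s" for s
      using DERIV_add[OF W[OF that] DERIV_const[of c]] by simp
    show "AE s in lborel. 0 < s \<longrightarrow> w s = W s + c"
      using c by eventually_elim (auto simp: h_def)
  qed
qed

section \<open>The flux pairs of radial solutions\<close>

text \<open>A primitive sees its integrand only up to null sets, so it is differentiable as soon as
  the density has a continuous representative. The regularity of the profile is thus turned into the
  differential equations of the flow.\<close>

lemma prim_deriv_of_AE:
  assumes mF [measurable]: "F \<in> borel_measurable borel" and int: "integrable lborel (\<lambda>s. indicator {0<..} s * F s)"
    and ae: "AE s in lborel. 0 < s \<longrightarrow> F s = s powr n * exp (W s)"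
    and W: "continuous_on {0<..} W" and s: "0 < s"
  shows "(prim F has_real_derivative s powr n * exp (W s)) (at s)"
proof -
  define E where "E s = indicator {0<..} s * (s powr n * exp (W s))" for s
  have c: "continuous_on {0<..} (\<lambda>s. s powr n * exp (W s))"
    by (intro continuous_intros W) auto
  have mE [measurable]: "E \<in> borel_measurable borel"
    unfolding E_def using borel_measurable_continuous_on_indicator[OF _ c] by simp
  have cE: "continuous_on {0<..} E"
    using c by (rule continuous_on_eq) (simp add: E_def)
  have eq: "AE s in lborel. indicator A s * F s = indicator A s * E s" if "A \<subseteq> {0<..}" for A
    using ae by eventually_elim (use that in \<open>auto simp: E_def indicator_def\<close>)
  have "integrable lborel (\<lambda>s. indicator {0<..} s * E s)"
    using int integrable_cong_AE[OF _ _ eq[of "{0<..}"]] by simp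
  note d = prim_deriv[OF mE this cE s]
  have "prim F t = prim E t" for t
    unfolding prim_def by (intro integral_cong_AE eq) auto
  then have "prim F = prim E" by (rule ext)
  then show ?thesis using d s by (simp add: E_def)
qed

lemma bubble_density_deriv:
  assumes W: "(W has_real_derivative - x / (2 * s)) (at s)" and s: "0 < s"
  shows "((\<lambda>s. s * (s powr n * exp (W s))) has_real_derivative
    (s * (s powr n * exp (W s))) / (2 * s) * (2 * (n + 1) - x)) (at s)"
proof -
  have *: "s powr (n - 1) = s powr n / s" using s by (simp add: powr_diff)
  have "((\<lambda>s. s * (s powr n * exp (W s))) has_real_derivative
    1 * (s powr n * exp (W s)) + (n * s powr (n - 1) * exp (W s) + exp (W s) * (- x / (2 * s)) * s powr n) * s) (at s)"
    by (intro DERIV_mult DERIV_ident has_real_derivative_powr[OF s] DERIV_fun_exp W)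
  then show ?thesis
    by (rule DERIV_cong) (use s in \<open>simp add: * field_simps\<close>)
qed

lemma locally_integrable_measurable:
  assumes "locally_integrable v" shows "v \<in> borel_measurable borel"
proof (rule borel_measurable_LIMSEQ_real)
  fix n :: nat
  have "integrable lborel (\<lambda>x. indicator (cball 0 (real n)) x *\<^sub>R v x)"
    using assms by (simp add: locally_integrable_def set_integrable_def)
  then show "(\<lambda>x. indicator (cball 0 (real n)) x *\<^sub>R v x) \<in> borel_measurable borel" by auto
next
  fix x :: R2
  obtain n0 where "norm x < real n0" using reals_Archimedean2 by blast
  then show "(\<lambda>n. indicator (cball 0 (real n)) x *\<^sub>R v x) \<longlonglongrightarrow> v x"
    by (intro tendsto_eventually eventually_sequentiallyI[of n0]) (simp add: indicator_def)
qed

text \<open>The profile is read off on a ray. Its integrability is claimed only on intervals with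
  \<open>0 < m\<close> because the change of variables describes the positive half-line.\<close>

lemma radial_profile:
  assumes "radial v" and loc: "locally_integrable v"
  obtains w where "w \<in> borel_measurable borel" "\<And>x. v x = w (x \<bullet> x)"
    "\<And>m K. 0 < m \<Longrightarrow> integrable lborel (\<lambda>s. indicator {m..K} s * w s)"
proof -
  define w where "w s = v (sqrt s *\<^sub>R axis 1 1)" for s
  have vw: "v x = w (x \<bullet> x)" for x
  proof -
    have "norm (sqrt (x \<bullet> x) *\<^sub>R (axis 1 1 :: R2)) = norm x" by (simp add: norm_eq_sqrt_inner inner_axis_axis)
    then show ?thesis using assms(1) unfolding radial_def w_def by metis
  qed
  have [measurable]: "v \<in> borel_measurable borel" by (rule locally_integrable_measurable[OF loc])
  have mw [measurable]: "w \<in> borel_measurable borel" unfolding w_def by measurable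
  have "integrable lborel (\<lambda>s. indicator {m..K} s * w s)" if m: "0 < m" for m K
  proof -
    define K' where "K' = max 0 K"
    have "integrable lborel (\<lambda>x. indicator (cball 0 (sqrt K')) x *\<^sub>R v x)"
      using loc by (simp add: locally_integrable_def set_integrable_def)
    also have "(\<lambda>x. indicator (cball 0 (sqrt K')) x *\<^sub>R v x) = (\<lambda>x. (\<lambda>s. indicator {..K'} s * w s) (x \<bullet> x))"
      by (auto simp: fun_eq_iff vw indicator_def norm_eq_sqrt_inner)
    finally have "integrable lborel (\<lambda>s. indicator {0<..} s * (indicator {..K'} s * w s))"
      by (subst (asm) radial_integrable_iff) auto
    then show ?thesis
      by (rule Bochner_Integration.integrable_bound) (use m in \<open>auto simp: indicator_def K'_def\<close>)
  qed
  then show thesis using that mw vw by blast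
qed

lemma radial_solution_fluxes:
  assumes N: "0 < N" and \<tau>: "0 < \<tau>" and sol: "solves_P N \<tau> v1 v2 \<beta>1 \<beta>2" and rad: "radial v1" "radial v2"
  shows "\<beta>1\<^sup>2 + \<beta>2\<^sup>2 - 2*\<tau>*\<beta>1*\<beta>2 - 4*(N+1)*\<beta>1 - 4*\<beta>2 = 0" "\<beta>1 > 4*(N+1)" "\<beta>2 > 4"
proof -
  note S = sol[unfolded solves_P_def]
  obtain w1 where w1 [measurable]: "w1 \<in> borel_measurable borel" and v1: "\<And>x. v1 x = w1 (x \<bullet> x)"
    and int1: "\<And>m K. 0 < m \<Longrightarrow> integrable lborel (\<lambda>s. indicator {m..K} s * w1 s)"
    using radial_profile[OF rad(1)] S by blast
  obtain w2 where w2 [measurable]: "w2 \<in> borel_measurable borel" and v2: "\<And>x. v2 x = w2 (x \<bullet> x)"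
    and int2: "\<And>m K. 0 < m \<Longrightarrow> integrable lborel (\<lambda>s. indicator {m..K} s * w2 s)"
    using radial_profile[OF rad(2)] S by blast
  define F1 F2 where "F1 s = s powr N * exp (w1 s)" and "F2 s = exp (w2 s)" for s
  have mF [measurable]: "F1 \<in> borel_measurable borel" "F2 \<in> borel_measurable borel" unfolding F1_def F2_def by measurable
  have F1: "norm x powr (2*N) * exp (v1 x) = F1 (x \<bullet> x)" for x by (simp add: F1_def v1 norm_powr_double)
  have F2: "exp (v2 x) = F2 (x \<bullet> x)" for x by (simp add: F2_def v2)
  have iF: "integrable lborel (\<lambda>s. indicator {0<..} s * F1 s)" "integrable lborel (\<lambda>s. indicator {0<..} s * F2 s)"
    using S by (simp_all add: F1 F2 radial_integrable_iff)
  have flux: "\<beta>1 = 1/2 * (\<integral>s. indicator {0<..} s * F1 s \<partial>lborel)" "\<beta>2 = 1/2 * (\<integral>s. indicator {0<..} s * F2 s \<partial>lborel)"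
    using S by (simp_all add: F1 F2 radial_integral)
  define f1 f2 where "f1 s = 1/2 * prim F1 s" and "f2 s = 1/2 * prim F2 s" for s
  have iH: "integrable lborel (\<lambda>s. indicator {0<..} s * (F s - \<tau> * F' s))"
    "prim (\<lambda>s. F s - \<tau> * F' s) t = prim F t - \<tau> * prim F' t"
    if [measurable]: "F \<in> borel_measurable borel" "F' \<in> borel_measurable borel"
      and i: "integrable lborel (\<lambda>s. indicator {0<..} s * F s)" "integrable lborel (\<lambda>s. indicator {0<..} s * F' s)" for F F' t
  proof -
    have e: "indicator A s * (F s - \<tau> * F' s) = indicator A s * F s - \<tau> * (indicator A s * F' s)" for A s
      by (simp add: algebra_simps)
    show "integrable lborel (\<lambda>s. indicator {0<..} s * (F s - \<tau> * F' s))" unfolding e using i by simp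
    show "prim (\<lambda>s. F s - \<tau> * F' s) t = prim F t - \<tau> * prim F' t"
      unfolding prim_def e using prim_integrable[OF _ i(1), of t] prim_integrable[OF _ i(2), of t] by simp
  qed
  have eq1: "distr_neg_laplace_eq (\<lambda>x. w1 (x \<bullet> x)) (\<lambda>x. F1 (x \<bullet> x) - \<tau> * F2 (x \<bullet> x))"
    using S by (simp add: F1 F2 v1[symmetric])
  have eq2: "distr_neg_laplace_eq (\<lambda>x. w2 (x \<bullet> x)) (\<lambda>x. F2 (x \<bullet> x) - \<tau> * F1 (x \<bullet> x))"
    using S by (simp add: F1 F2 v2[symmetric] mult.assoc)
  obtain W1 where W1: "\<And>s. 0 < s \<Longrightarrow> (W1 has_real_derivative - prim (\<lambda>s. F1 s - \<tau> * F2 s) s / (4 * s)) (at s)"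
    and ae1: "AE s in lborel. 0 < s \<longrightarrow> w1 s = W1 s"
    using radial_profile_regular[OF eq1 w1 _ iH(1)[OF mF iF] int1] by auto
  obtain W2 where W2: "\<And>s. 0 < s \<Longrightarrow> (W2 has_real_derivative - prim (\<lambda>s. F2 s - \<tau> * F1 s) s / (4 * s)) (at s)"
    and ae2: "AE s in lborel. 0 < s \<longrightarrow> w2 s = W2 s"
    using radial_profile_regular[OF eq2 w2 _ iH(1)[OF mF(2,1) iF(2,1)] int2] by auto
  have W1': "(W1 has_real_derivative - (f1 s - \<tau> * f2 s) / (2 * s)) (at s)" if "0 < s" for s
    by (rule DERIV_cong[OF W1[OF that]])
      (unfold iH(2)[OF mF iF] f1_def f2_def, use that in \<open>simp add: field_simps\<close>)
  have W2': "(W2 has_real_derivative - (f2 s - \<tau> * f1 s) / (2 * s)) (at s)" if "0 < s" for s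
    by (rule DERIV_cong[OF W2[OF that]])
      (unfold iH(2)[OF mF(2,1) iF(2,1)] f1_def f2_def, use that in \<open>simp add: field_simps\<close>)
  have cW: "continuous_on {0<..} W1" "continuous_on {0<..} W2"
    by (auto intro!: continuous_at_imp_continuous_on DERIV_isCont[OF W1] DERIV_isCont[OF W2])
  \<comment> \<open>For positive s the factor \<open>s powr 0\<close> is 1; writing it makes the
    second component an instance with weight exponent 0.\<close>
  have aeF: "AE s in lborel. 0 < s \<longrightarrow> F1 s = s powr N * exp (W1 s)" "AE s in lborel. 0 < s \<longrightarrow> F2 s = s powr 0 * exp (W2 s)"
    using ae1 ae2 by (auto simp: F1_def F2_def elim!: eventually_mono)
  interpret liouville_flow "N+1" "0+1" \<tau> f1 f2 "\<lambda>s. s * (s powr N * exp (W1 s))" "\<lambda>s. s * (s powr 0 * exp (W2 s))"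
  proof
    fix s :: real assume s: "0 < s"
    show "(f1 has_real_derivative s * (s powr N * exp (W1 s)) / (2 * s)) (at s)"
      unfolding f1_def[abs_def]
      by (rule DERIV_cong[OF DERIV_cmult[OF prim_deriv_of_AE[OF mF(1) iF(1) aeF(1) cW(1) s]]]) (use s in simp)
    show "(f2 has_real_derivative s * (s powr 0 * exp (W2 s)) / (2 * s)) (at s)"
      unfolding f2_def[abs_def]
      by (rule DERIV_cong[OF DERIV_cmult[OF prim_deriv_of_AE[OF mF(2) iF(2) aeF(2) cW(2) s]]]) (use s in simp)
    show "((\<lambda>s. s * (s powr N * exp (W1 s))) has_real_derivative
        s * (s powr N * exp (W1 s)) / (2 * s) * (2 * (N + 1) - f1 s + \<tau> * f2 s)) (at s)"
      using bubble_density_deriv[OF W1'[OF s] s, of N] by (simp add: algebra_simps)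
    show "((\<lambda>s. s * (s powr 0 * exp (W2 s))) has_real_derivative
        s * (s powr 0 * exp (W2 s)) / (2 * s) * (2 * (0 + 1) - f2 s + \<tau> * f1 s)) (at s)"
      using bubble_density_deriv[OF W2'[OF s] s, of 0] by (simp add: algebra_simps)
  next
    show "(f1 \<longlongrightarrow> 0) (at_right 0)" "(f2 \<longlongrightarrow> 0) (at_right 0)"
      unfolding f1_def[abs_def] f2_def[abs_def]
      using tendsto_mult_right_zero[OF prim_lim0[OF mF(1) iF(1)], of "1/2"]
        tendsto_mult_right_zero[OF prim_lim0[OF mF(2) iF(2)], of "1/2"] by auto
  qed (use N \<tau> in auto)
  have lim: "(f1 \<longlongrightarrow> \<beta>1) at_top" "(f2 \<longlongrightarrow> \<beta>2) at_top"
    unfolding f1_def[abs_def] f2_def[abs_def] flux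
    by (intro tendsto_mult tendsto_const prim_lim_top mF iF)+
  show "\<beta>1\<^sup>2 + \<beta>2\<^sup>2 - 2*\<tau>*\<beta>1*\<beta>2 - 4*(N+1)*\<beta>1 - 4*\<beta>2 = 0" using flux_identity[OF lim] by simp
  show "\<beta>1 > 4*(N+1)" by (rule flux1_gt[OF lim(1)])
  show "\<beta>2 > 4" using flux2_gt[OF lim(2)] by simp
qed

text \<open>With a = N + 1 the threshold is the positive root of 4 \<tau>^2 + 2 a \<tau> = 1, that
  is, equality in \<open>cond2\<close>. The other condition follows from it because a > 1.\<close>

lemma flux_arc_of_threshold:
  fixes N \<tau> :: real
  assumes N: "N > 0" and \<tau>: "\<tau> > 0" and le: "\<tau> \<le> 1 / (N + 1 + sqrt ((N + 1)^2 + 4))"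
  shows "flux_arc (N+1) (0+1) \<tau>" "\<tau> \<le> 1/2"
proof -
  define a where "a = N + 1"
  define r where "r = sqrt (a\<^sup>2 + 4)"
  have a: "1 < a" using N by (simp add: a_def)
  have r: "0 < r" "r\<^sup>2 = a\<^sup>2 + 4" by (simp_all add: r_def add_nonneg_pos)
  have "\<tau> * (a + r) \<le> 1" using le[folded a_def, folded r_def] a r by (simp add: pos_le_divide_eq)
  then have "\<tau> * r \<le> 1 - \<tau> * a" by (simp add: algebra_simps)
  \<comment> \<open>Squaring removes the root, and the terms
    \<open>\<tau>\<^sup>2 * a\<^sup>2\<close> cancel on both sides.\<close>
  then have "(\<tau> * r)\<^sup>2 \<le> (1 - \<tau> * a)\<^sup>2" using \<tau> r by (intro power_mono) auto
  then have "\<tau>\<^sup>2 * (a\<^sup>2 + 4) \<le> 1 - 2 * (\<tau> * a) + \<tau>\<^sup>2 * a\<^sup>2"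
    unfolding power_mult_distrib r(2) by (simp add: power2_eq_square algebra_simps)
  then have c2: "4 * \<tau>\<^sup>2 + 2 * (\<tau> * a) \<le> 1" by (simp add: algebra_simps)
  have ta: "\<tau> * 1 \<le> \<tau> * a" using \<tau> a by (intro mult_left_mono) auto
  then show "\<tau> \<le> 1/2" using c2 zero_le_power2[of \<tau>] by linarith
  have "(4 * \<tau>\<^sup>2 + 2 * (\<tau> * a)) * a \<le> 1 * a" using c2 a by (intro mult_right_mono) auto
  moreover have "\<tau> * 1 \<le> (\<tau> * a) * a"
    using mult_mono[of "\<tau> * 1" "\<tau> * a" 1 a] ta \<tau> a by simp
  ultimately have c1: "4 * \<tau>\<^sup>2 * a + 2 * \<tau> * 1 \<le> a" by (simp add: algebra_simps)
  show "flux_arc (N+1) (0+1) \<tau>"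
    unfolding a_def[symmetric]
    by unfold_locales (use a \<tau> c1 c2 \<open>\<tau> \<le> 1/2\<close> in auto)
qed

theorem mainTheorem1:
  fixes N \<tau> \<beta>1 \<beta>2 :: real
  assumes "N > 0" and "\<tau> > 0"
    and "\<tau> \<le> 1 / (N + 1 + sqrt ((N + 1)^2 + 4))"
  shows "(\<exists>v1 v2. solves_P N \<tau> v1 v2 \<beta>1 \<beta>2 \<and> radial v1 \<and> radial v2) \<longleftrightarrow>
         (\<beta>1^2 + \<beta>2^2 - 2*\<tau>*\<beta>1*\<beta>2 - 4*(N+1)*\<beta>1 - 4*\<beta>2 = 0 \<and>
          \<beta>1 > 4*(N+1) \<and> \<beta>2 > 4)"
proof
  assume "\<exists>v1 v2. solves_P N \<tau> v1 v2 \<beta>1 \<beta>2 \<and> radial v1 \<and> radial v2"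
  then show "\<beta>1^2 + \<beta>2^2 - 2*\<tau>*\<beta>1*\<beta>2 - 4*(N+1)*\<beta>1 - 4*\<beta>2 = 0 \<and> \<beta>1 > 4*(N+1) \<and> \<beta>2 > 4"
    using radial_solution_fluxes[OF assms(1,2)] by blast
next
  assume R: "\<beta>1^2 + \<beta>2^2 - 2*\<tau>*\<beta>1*\<beta>2 - 4*(N+1)*\<beta>1 - 4*\<beta>2 = 0 \<and> \<beta>1 > 4*(N+1) \<and> \<beta>2 > 4"
  note arc = flux_arc_of_threshold[OF assms]
  have "flux_arc.on_arc (N+1) (0+1) \<tau> \<beta>1 \<beta>2"
    unfolding flux_arc.on_arc_def[OF arc(1)] using R by simp
  from _ _ assms(2) arc(2,1) this show "\<exists>v1 v2. solves_P N \<tau> v1 v2 \<beta>1 \<beta>2 \<and> radial v1 \<and> radial v2"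
  proof (rule flow_realizing_arc_point)
    fix Z \<alpha>1 \<alpha>2 \<delta> z1 z2
    assume "clamped_solution N 0 \<tau> Z \<alpha>1 \<alpha>2 \<delta> z1 z2"
      "((\<lambda>s. s * z1 s) \<longlongrightarrow> \<beta>1) at_top" "((\<lambda>s. s * z2 s) \<longlongrightarrow> \<beta>2) at_top"
    then show ?thesis by (rule solves_P_of_clamped_solution[OF _ assms(1)])
  qed (use assms(1) in auto)
qed

end
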